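(* Let $G$ be split of type $G_2$, let $(\mathbf P_\infty,\psi,\mathbf Q_0)$ be the specific data described in the context (with $L\cong\mathrm{SO}_4$, $\psi=x^3u+y^3v$, $T_\psi=B_\psi\cong\mathbb G_m$ and $L/Q\cong\mathbb P^1$ the flag variety of the short root factor), and let $\chi:T_\psi(k)\to\overline{\mathbb Q}_\ell^\times$ be a non-trivial character. Then the automorphic datum $(\mathbf P_\infty,\psi,\chi,\mathbf Q_0)$ is euphotic and strict.
   Context: SPECIFIC DATA. Let $k$ be a finite field of characteristic $p$, $\ell\neq p$ a prime, $G$ split of type $G_2$ over $k$ (also regarded over $F=k(t)$) with split maximal torus $A$ and simple roots $\alpha_1$ (long), $\alpha_2$ (short), highest root $\eta$; it is assumed that $\mathfrak g$ has a nondegenerate invariant symmetric bilinear form and $p\nmid m$ for $m=2$. $\mathbf P_\infty\subset G(F_\infty)$ is the standard parahoric whose Levi quotient $L\cong\mathrm{SO}_4$ has roots $\pm\alpha_2,\pm\eta$. Then $m=2$ and $V_{\mathbf P}=\mathbf P_\infty^+/\mathbf P_\infty^{++}\cong\mathrm{Sym}^3(\mathrm{St})\otimes\mathrm{St}'\cong V_{\mathbf P}^*$, where $\mathrm{St},\mathrm{St}'$ are the standard representations of the short root and long root $\mathrm{SL}_2$. Identify $V_{\mathbf P}^*$ with polynomials bihomogeneous in $(x,y)$ and $(u,v)$, cubic in $(x,y)$ and linear in $(u,v)$; $\psi=x^3u+y^3v$. $L_\psi$, the stabilizer of $\psi$ in $L$, is $\cong\mathbb G_m\rtimes\mu_2$,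 and $T_\psi=B_\psi=\mathbb G_m\subset L_\psi$ is the index 2 subgroup acting by $s\cdot(x,y,u,v)=(sx,s^{-1}y,s^{-3}u,s^3v)$. $Q\subset L$ is a parabolic containing $A$ such that $L/Q\cong\mathbb P^1$ is the flag variety of the short root factor; $\mathbf P_0\subset G(F_0)$ is the parahoric opposite to $\mathbf P_\infty$ (defined below) and $\mathbf Q_0\subset\mathbf P_0$ is the preimage of $Q$ under $\mathbf P_0\to L$. GENERAL DEFINITIONS. $\mathfrak A$ is the apartment of $A$ in the building of $G(F_\infty)$, $F_\infty=k((t^{-1}))$, with affine roots viewed as affine functions on it (real ones are those nontrivial on $A$), simple affine roots $\Delta_{\mathrm{aff}}$ and fundamental alcove $C$. For a standard parahoric with facet $\mathfrak F\subset\overline C$, $m=\sum_{\alpha\in\Delta_{\mathrm{aff}},\alpha|_{\mathfrak F}\neq0}n_\alpha$ with $\sum_{\Delta_{\mathrm{aff}}} n_\alpha\alpha=1$; $x_{\mathbf P}\in\mathfrak F$ is the point where all $\alpha\in\Delta_{\mathrm{aff}}$ not vanishing on $\mathfrak F$ equal $1/m$; $\mathbf P_\infty^+,\mathbf P_\infty^{++}$ are the Moy–Prasad subgroups of depth $1/m,2/m$ at $x_{\mathbf P}$; $L=\mathbf P_\infty/\mathbf P_\infty^+$. The apartment of $A$ for $G(F_0)$, $F_0=k((t))$, is identified with $\mathfrak A$ so that the translation actions of $X_*(A)_{\mathbb R}$ are opposite and the special vertices of $G(k[[t]])$ and $G(k[[t^{-1}]])$ agree; $\mathbf P_0$ is the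 parahoric of $G(F_0)$ for the same facet, with Levi quotient $L$. $x_{\mathbf Q}$ is the barycenter of the facet of $\mathbf Q_0$. $\widetilde W=X_*(A)\rtimes W$ acts on $\mathfrak A$, $\Omega$ is the stabilizer of $C$ in $\widetilde W$ (trivial for $G_2$), and $W_{\mathbf Q}\subset W_{\mathbf P}$ are the Weyl groups of the Levi of $\mathbf Q_0$ and of $L$. For $w\in\widetilde W$: $Q_w\subset L$ is the parabolic containing $A$ with roots $\{\alpha\text{ real affine}:\alpha(x_{\mathbf P})=0,\alpha(wx_{\mathbf Q})\le0\}$; $V_w=\bigoplus_{\alpha(x_{\mathbf P})=1/m,\alpha(wx_{\mathbf Q})\le0}V_{\mathbf P}(\alpha)$ with annihilator $V_w^\perp\subset V_{\mathbf P}^*$; $Y_w=\{\ell Q_w\in L/Q_w:{}^{\ell^{-1}}\psi\in V_w^\perp\}$ with its $L_\psi$-action. For $H$ connected reductive with Borel $B_H$ and universal Cartan $T_H$, an $H$-scheme $Y$ of finite type is spectrally meager if for all $y\in Y(\bar k)$, $\mathrm{Stab}_{B_H}(y)$ contains a nontrivial torus; $\mathcal S(Y)$ is then the set of images in $T_{H,\bar k}$ of the groups $\mathrm{Stab}_{B_H}(y)^\circ$ (for $L_\psi$-schemes use $H=L_\psi^\circ$). $\mathcal K_\chi$ is the Kummer (character) local system on $T_\psi$ attached to $\chi$. The datum is euphotic if: (i) for $w\in\Omega$, any Borel $B_\psi$ of $L_\psi^\circ$ acts on $Y_w$ with an open orbit with finite stabilizers; (ii) for $w\in\widetilde W-W_{\mathbf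 P}\Omega W_{\mathbf Q}$, $Y_w$ is spectrally meager for $L_\psi$; (iii) for $S\in\bigcup_{w\notin W_{\mathbf P}\Omega W_{\mathbf Q}}\mathcal S(Y_w)$, $\mathcal K_\chi|_S$ is nontrivial. It is strict if moreover: for $w\in\Omega$ and $x\in(L/Q_w)(\bar k)$ outside the open $B_\psi$-orbit, with $S_x$ the image of $\mathrm{Stab}_{B_\psi}(x)^\circ\to T_{\psi,\bar k}$, $\mathcal K_\chi|_{S_x}$ is nontrivial (in particular $S_x$ is nontrivial); and the stabilizer on the open $B_\psi$-orbit is the center $ZG$ (trivial for $G_2$). *)

theory Defs
  imports
    "HOL-Analysis.Analysis"
    "HOL-Algebra.Algebra"
    "HOL-Algebra.Algebraic_Closure_Type"
    "HOL-Computational_Algebra.Fraction_Field"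
begin

hide_const (open) Divisibility.prime
no_notation fps_nth (infixl \<open>$\<close> 75)

section \<open>The coefficient field\<close>

text \<open>The \<open>\<ell>\<close>-adic integers are compatible sequences of residues; the prime \<open>\<ell>\<close> is the
  cardinality of the type argument.\<close>

class prime_card = finite +
  assumes prime_card: "prime CARD('a)"

typedef ('l::prime_card) padic_int =
  "{f :: nat \<Rightarrow> int. \<forall>n. f n mod int CARD('l) ^ n = f n \<and> f (Suc n) mod int CARD('l) ^ n = f n}"
  morphisms padic_res Abs_padic_int
  by (rule exI[of _ "\<lambda>_. 0"]) simp

lemma padic_res_mod [simp]:
  "padic_res (x :: 'l::prime_card padic_int) n mod int CARD('l) ^ n = padic_res x n"
  using padic_res[of x] by simp

lemma padic_res_Suc: "padic_res (x :: 'l::prime_card padic_int) (Suc n) mod int CARD('l) ^ n = padic_res x n"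
  using padic_res[of x] by simp

lemma padic_res_le:
  "n \<le> m \<Longrightarrow> padic_res (x :: 'l::prime_card padic_int) m mod int CARD('l) ^ n = padic_res x n"
proof (induction m rule: dec_induct)
  case (step m)
  have "padic_res x (Suc m) mod int CARD('l) ^ n
      = padic_res x (Suc m) mod int CARD('l) ^ m mod int CARD('l) ^ n"
    using step.hyps by (simp add: mod_mod_cancel le_imp_power_dvd)
  then show ?case
    using step.IH by (simp add: padic_res_Suc)
qed simp

definition padic_of :: "(nat \<Rightarrow> int) \<Rightarrow> 'l::prime_card padic_int" where
  "padic_of f = Abs_padic_int (\<lambda>n. f n mod int CARD('l) ^ n)"

lemma padic_res_of:
  assumes "\<And>n. f (Suc n) mod int CARD('l) ^ n = f n mod int CARD('l) ^ n"
  shows "padic_res (padic_of f :: 'l::prime_card padic_int) n = f n mod int CARD('l) ^ n"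
proof -
  have "f (Suc n) mod int CARD('l) ^ Suc n mod int CARD('l) ^ n = f n mod int CARD('l) ^ n" for n
    using assms[of n] by (simp add: mod_mod_cancel le_imp_power_dvd del: power_Suc)
  then show ?thesis
    unfolding padic_of_def by (subst Abs_padic_int_inverse) auto
qed

lemma padic_int_eqI: "(\<And>n. padic_res x n = padic_res y n) \<Longrightarrow> x = y"
  by (simp add: padic_res_inject[symmetric] fun_eq_iff)

instantiation padic_int :: (prime_card) comm_ring_1
begin

definition "0 = padic_of (\<lambda>_. 0)"
definition "1 = padic_of (\<lambda>_. 1)"
definition "x + y = padic_of (\<lambda>n. padic_res x n + padic_res y n)"
definition "x - y = padic_of (\<lambda>n. padic_res x n - padic_res y n)"
definition "- x = padic_of (\<lambda>n. - padic_res x n)"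
definition "x * y = padic_of (\<lambda>n. padic_res x n * padic_res y n)"

lemma padic_res_0: "padic_res (0 :: 'a padic_int) n = 0"
  unfolding zero_padic_int_def by (subst padic_res_of) auto
lemma padic_res_1: "padic_res (1 :: 'a padic_int) n = 1 mod int CARD('a) ^ n"
  unfolding one_padic_int_def by (subst padic_res_of) auto
lemma padic_res_add:
  "padic_res (x + y :: 'a padic_int) n = (padic_res x n + padic_res y n) mod int CARD('a) ^ n"
  unfolding plus_padic_int_def
  by (subst padic_res_of) (auto intro!: mod_add_cong simp: padic_res_Suc)
lemma padic_res_diff:
  "padic_res (x - y :: 'a padic_int) n = (padic_res x n - padic_res y n) mod int CARD('a) ^ n"
  unfolding minus_padic_int_def
  by (subst padic_res_of) (auto intro!: mod_diff_cong simp: padic_res_Suc)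
lemma padic_res_minus: "padic_res (- x :: 'a padic_int) n = (- padic_res x n) mod int CARD('a) ^ n"
  unfolding uminus_padic_int_def
  by (subst padic_res_of) (auto intro!: mod_minus_cong simp: padic_res_Suc)
lemma padic_res_mult:
  "padic_res (x * y :: 'a padic_int) n = (padic_res x n * padic_res y n) mod int CARD('a) ^ n"
  unfolding times_padic_int_def
  by (subst padic_res_of) (auto intro!: mod_mult_cong simp: padic_res_Suc)

lemmas padic_res_simps =
  padic_res_0 padic_res_1 padic_res_add padic_res_diff padic_res_minus padic_res_mult

instance
proof
  fix a b c :: "'a padic_int"
  show "a * b * c = a * (b * c)"
    by (rule padic_int_eqI) (simp add: padic_res_simps mod_simps ac_simps)
  show "a * b = b * a"
    by (rule padic_int_eqI) (simp add: padic_res_simps mod_simps ac_simps)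
  show "1 * a = a"
    by (rule padic_int_eqI) (simp add: padic_res_simps mod_simps)
  show "a + b + c = a + (b + c)"
    by (rule padic_int_eqI) (simp add: padic_res_simps mod_simps ac_simps)
  show "a + b = b + a"
    by (rule padic_int_eqI) (simp add: padic_res_simps mod_simps ac_simps)
  show "0 + a = a"
    by (rule padic_int_eqI) (simp add: padic_res_simps mod_simps)
  show "- a + a = 0"
    by (rule padic_int_eqI) (simp add: padic_res_simps mod_simps)
  show "a - b = a + - b"
    by (rule padic_int_eqI) (simp add: padic_res_simps mod_simps)
  show "(a + b) * c = a * c + b * c"
    by (rule padic_int_eqI) (simp add: padic_res_simps mod_simps algebra_simps)
  have "1 < int CARD('a)"
    using prime_card[where 'a = 'a] prime_gt_1_nat by force
  then have "padic_res (0 :: 'a padic_int) 1 \<noteq> padic_res (1 :: 'a padic_int) 1"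
    by (simp add: padic_res_simps)
  then show "(0 :: 'a padic_int) \<noteq> 1" by metis
qed

end

instance padic_int :: (prime_card) idom
proof
  fix a b :: "'a padic_int"
  assume ab: "a \<noteq> 0" "b \<noteq> 0"
  let ?l = "int CARD('a)"
  have l: "prime ?l" using prime_card[where 'a = 'a] by simp
  obtain n where n: "padic_res a n \<noteq> 0"
    using ab(1) padic_int_eqI[of a 0] by (metis padic_res_0)
  obtain m where m: "padic_res b m \<noteq> 0"
    using ab(2) padic_int_eqI[of b 0] by (metis padic_res_0)
  have "\<not> ?l ^ n dvd padic_res a (n + m)" "\<not> ?l ^ m dvd padic_res b (n + m)"
    using n m padic_res_le[of n "n + m" a] padic_res_le[of m "n + m" b]
    by (auto simp: dvd_eq_mod_eq_0)
  moreover obtain c where c: "n + m = Suc c"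
  proof (cases "n + m")
    case 0
    then have "padic_res a n = 0" using padic_res_mod[of a n] by simp
    with n show ?thesis by simp
  qed simp
  moreover have "prime_elem ?l" using l by (rule prime_imp_prime_elem)
  ultimately have "\<not> ?l ^ c dvd padic_res a (n + m) * padic_res b (n + m)"
    using prime_elem_power_dvd_cases by blast
  moreover have "?l ^ c dvd ?l ^ (n + m)" using c by (simp add: le_imp_power_dvd)
  ultimately have "\<not> ?l ^ (n + m) dvd padic_res a (n + m) * padic_res b (n + m)"
    using dvd_trans by blast
  then have "padic_res (a * b) (n + m) \<noteq> 0"
    by (simp add: padic_res_mult dvd_eq_mod_eq_0)
  then show "a * b \<noteq> 0" by (auto simp: padic_res_0)
qed


text \<open>The algebraic closure of the field of fractions of the \<open>\<ell>\<close>-adic integers.\<close>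

type_synonym 'l Qlbar = "'l padic_int fract alg_closure"


section \<open>The Lie algebra of the split group of type $G_2$\<close>

text \<open>The split group of type $G_2$ is the automorphism group of the split octonions, here in
  Zorn's vector matrix form: \<open>(a, v, w, b)\<close> is the matrix with diagonal \<open>a, b\<close> and off-diagonal
  entries \<open>v\<close> (upper right) and \<open>w\<close> (lower left). Its Lie algebra is the algebra of derivations,
  over a field of any characteristic.\<close>

type_synonym 'k oct = "'k \<times> ('k^3) \<times> ('k^3) \<times> 'k"

definition dot3 :: "'k::comm_ring_1 ^ 3 \<Rightarrow> 'k ^ 3 \<Rightarrow> 'k" where
  "dot3 v w = (\<Sum>i\<in>UNIV. v $ i * w $ i)"

definition vcross :: "'k::comm_ring_1 ^ 3 \<Rightarrow> 'k ^ 3 \<Rightarrow> 'k ^ 3" where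
  "vcross v w = vector [v$2 * w$3 - v$3 * w$2, v$3 * w$1 - v$1 * w$3, v$1 * w$2 - v$2 * w$1]"

fun oct_mult :: "'k::comm_ring_1 oct \<Rightarrow> 'k oct \<Rightarrow> 'k oct" where
  "oct_mult (a, v, w, b) (a', v', w', b') =
     (a * a' + dot3 v w', a *s v' + b' *s v - vcross w w',
      a' *s w + b *s w' + vcross v v', b * b' + dot3 w v')"

fun oct_scale :: "'k::comm_ring_1 \<Rightarrow> 'k oct \<Rightarrow> 'k oct" where
  "oct_scale c (a, v, w, b) = (c * a, c *s v, c *s w, c * b)"

definition g2_lie :: "('k::field oct \<Rightarrow> 'k oct) set" where
  "g2_lie = {D. (\<forall>x y. D (x + y) = D x + D y) \<and> (\<forall>c x. D (oct_scale c x) = oct_scale c (D x)) \<and>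
     (\<forall>x y. D (oct_mult x y) = oct_mult (D x) y + oct_mult x (D y))}"

definition lie_bracket :: "('k::field oct \<Rightarrow> 'k oct) \<Rightarrow> ('k oct \<Rightarrow> 'k oct) \<Rightarrow> 'k oct \<Rightarrow> 'k oct" where
  "lie_bracket D E = (\<lambda>x. D (E x) - E (D x))"

definition nondegenerate_invariant_form ::
  "(('k::field oct \<Rightarrow> 'k oct) \<Rightarrow> ('k oct \<Rightarrow> 'k oct) \<Rightarrow> 'k) \<Rightarrow> bool" where
  "nondegenerate_invariant_form bil \<longleftrightarrow>
     (\<forall>D\<in>g2_lie. \<forall>E\<in>g2_lie. \<forall>D'\<in>g2_lie. bil (\<lambda>x. D x + E x) D' = bil D D' + bil E D') \<and>
     (\<forall>c. \<forall>D\<in>g2_lie. \<forall>D'\<in>g2_lie. bil (\<lambda>x. oct_scale c (D x)) D' = c * bil D D') \<and>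
     (\<forall>D\<in>g2_lie. \<forall>E\<in>g2_lie. bil D E = bil E D) \<and>
     (\<forall>D\<in>g2_lie. \<forall>E\<in>g2_lie. \<forall>D'\<in>g2_lie. bil (lie_bracket D E) D' = bil D (lie_bracket E D')) \<and>
     (\<forall>D\<in>g2_lie. (\<forall>E\<in>g2_lie. bil D E = 0) \<longrightarrow> D = (\<lambda>_. 0))"


section \<open>The apartment and the affine Weyl group\<close>

text \<open>A root \<open>(c\<^sub>1, c\<^sub>2)\<close> is $c_1\alpha_1 + c_2\alpha_2$ with $\alpha_1$ long and $\alpha_2$ short.
  The apartment is $X_*(A)_{\mathbb R}$ based at the special vertex of $G(k[[t^{-1}]])$, in the
  coordinates $x \mapsto (\alpha_1(x), \alpha_2(x))$. In type $G_2$ the cocharacter lattice is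
  the coweight lattice, so in these coordinates it is $\mathbb V^2$. A triple \<open>(c\<^sub>1, c\<^sub>2, n)\<close> is the
  affine function $c_1\alpha_1 + c_2\alpha_2 + n$.\<close>

type_synonym root = "int \<times> int"
type_synonym aff_root = "int \<times> int \<times> int"
type_synonym apt = "real \<times> real"

definition g2_roots :: "root set" where
  "g2_roots = {(1,0), (0,1), (1,1), (1,2), (1,3), (2,3),
               (-1,0), (0,-1), (-1,-1), (-1,-2), (-1,-3), (-2,-3)}"

abbreviation short_root :: root where "short_root \<equiv> (0, 1)"
abbreviation highest_root :: root where "highest_root \<equiv> (2, 3)"

fun aff_val :: "aff_root \<Rightarrow> apt \<Rightarrow> real" where
  "aff_val (c1, c2, n) (x1, x2) = of_int c1 * x1 + of_int c2 * x2 + of_int n"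

fun gradient :: "aff_root \<Rightarrow> root" where
  "gradient (c1, c2, n) = (c1, c2)"

definition real_aff_roots :: "aff_root set" where
  "real_aff_roots = {\<alpha>. gradient \<alpha> \<in> g2_roots}"

text \<open>A Weyl invariant inner product on the root lattice.\<close>

fun root_ip :: "root \<Rightarrow> root \<Rightarrow> int" where
  "root_ip (a1, a2) (b1, b2) = 6 * a1 * b1 - 3 * (a1 * b2 + a2 * b1) + 2 * a2 * b2"

definition coroot :: "root \<Rightarrow> apt" where
  "coroot c = (2 * of_int (root_ip (1,0) c) / of_int (root_ip c c),
               2 * of_int (root_ip (0,1) c) / of_int (root_ip c c))"

definition reflection :: "aff_root \<Rightarrow> apt \<Rightarrow> apt" where
  "reflection \<alpha> x = x - aff_val \<alpha> x *\<^sub>R coroot (gradient \<alpha>)"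

inductive_set refl_group :: "aff_root set \<Rightarrow> (apt \<Rightarrow> apt) set" for R :: "aff_root set" where
  "id \<in> refl_group R"
| "\<alpha> \<in> R \<Longrightarrow> w \<in> refl_group R \<Longrightarrow> reflection \<alpha> \<circ> w \<in> refl_group R"

definition weyl :: "(apt \<Rightarrow> apt) set" where
  "weyl = refl_group {(c1, c2, 0) | c1 c2. (c1, c2) \<in> g2_roots}"

definition ext_aff_weyl :: "(apt \<Rightarrow> apt) set" where
  "ext_aff_weyl = {\<lambda>x. w x + (of_int a, of_int b) | w a b. w \<in> weyl}"

definition simple_aff_roots :: "aff_root set" where
  "simple_aff_roots = {(-2,-3,1), (1,0,0), (0,1,0)}"

definition mark :: "aff_root \<Rightarrow> nat" where
  "mark \<alpha> = (if \<alpha> = (-2,-3,1) then 1 else if \<alpha> = (1,0,0) then 2 else 3)"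

lemma sum_mark_aff_val: "(\<Sum>\<alpha>\<in>simple_aff_roots. real (mark \<alpha>) * aff_val \<alpha> x) = 1"
  by (cases x) (simp add: simple_aff_roots_def mark_def)

definition alcove :: "apt set" where
  "alcove = {x. \<forall>\<alpha>\<in>simple_aff_roots. aff_val \<alpha> x > 0}"

definition Omega :: "(apt \<Rightarrow> apt) set" where
  "Omega = {w \<in> ext_aff_weyl. w ` alcove = alcove}"

definition is_facet :: "apt set \<Rightarrow> bool" where
  "is_facet F \<longleftrightarrow> (\<exists>x. F = {y. \<forall>\<alpha>\<in>real_aff_roots. sgn (aff_val \<alpha> y) = sgn (aff_val \<alpha> x)})"

definition barycenter :: "apt set \<Rightarrow> apt" where
  "barycenter F = (let V = {v. v extreme_point_of closure F} in (1 / real (card V)) *\<^sub>R (\<Sum>v\<in>V. v))"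

text \<open>The Weyl group of the Levi quotient of the parahoric of a facet containing \<open>x\<close>.\<close>

definition weyl_at :: "apt \<Rightarrow> (apt \<Rightarrow> apt) set" where
  "weyl_at x = refl_group {\<alpha> \<in> real_aff_roots. aff_val \<alpha> x = 0}"

text \<open>The facet of $\mathbf P_\infty$: the face of the alcove on which exactly the simple affine
  roots $\alpha_2$ and $1 - \eta$ vanish.\<close>

definition facet_P :: "apt set" where
  "facet_P = {x. aff_val (0,1,0) x = 0 \<and> aff_val (-2,-3,1) x = 0 \<and> aff_val (1,0,0) x > 0}"

definition aff_roots_off_P :: "aff_root set" where
  "aff_roots_off_P = {\<alpha> \<in> simple_aff_roots. \<exists>x\<in>facet_P. aff_val \<alpha> x \<noteq> 0}"

definition m_P :: nat where
  "m_P = (\<Sum>\<alpha>\<in>aff_roots_off_P. mark \<alpha>)"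

definition x_P :: apt where
  "x_P = (THE x. x \<in> facet_P \<and> (\<forall>\<alpha>\<in>aff_roots_off_P. aff_val \<alpha> x = 1 / real m_P))"

lemma facet_P_eq: "facet_P = {(1/2, 0)}"
  by (auto simp: facet_P_def)

lemma aff_roots_off_P_eq: "aff_roots_off_P = {(1,0,0)}"
  by (auto simp: aff_roots_off_P_def facet_P_eq simple_aff_roots_def)

lemma m_P_eq: "m_P = 2"
  by (simp add: m_P_def aff_roots_off_P_eq mark_def)

lemma x_P_eq: "x_P = (1/2, 0)"
  unfolding x_P_def by (rule the_equality) (auto simp: facet_P_eq aff_roots_off_P_eq m_P_eq)

text \<open>The roots of $L$ lying in the image of the parahoric of $G(F_0)$ for the facet of \<open>x\<close>.
  Because the apartment of $G(F_0)$ is identified with that of $G(F_\infty)$ by reversing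
  translations, the affine roots of that parahoric are those with $\alpha(x) \le 0$.\<close>

definition para_roots :: "apt \<Rightarrow> root set" where
  "para_roots x = gradient ` {\<alpha> \<in> real_aff_roots. aff_val \<alpha> x_P = 0 \<and> aff_val \<alpha> x \<le> 0}"

text \<open>\<open>F\<close> is the facet of $\mathbf Q_0$, the preimage in $\mathbf P_0$ of one of the two parabolics
  $Q \supset A$ for which $L/Q$ is the flag variety of the short root factor.\<close>

definition is_facet_Q :: "apt set \<Rightarrow> bool" where
  "is_facet_Q F \<longleftrightarrow> is_facet F \<and> x_P \<in> closure F \<and>
     (\<exists>\<epsilon>\<in>{short_root, - short_root}. \<forall>x\<in>F. para_roots x = {highest_root, - highest_root, \<epsilon>})"


section \<open>The Levi quotient $L$\<close>

text \<open>Group schemes and varieties over $k$ are represented by their points over an algebraically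
  closed field \<open>'a\<close>. $L$ is \<open>(SL\<^sub>2 \<times> SL\<^sub>2) / \<mu>\<^sub>2\<close> with the short root factor first; its points are
  the cosets \<open>{(g, h), (-g, -h)}\<close>.\<close>

type_synonym 'a mat2 = "'a^2^2"
type_synonym 'a levi = "('a mat2 \<times> 'a mat2) set"

definition mat2 :: "'a::field \<Rightarrow> 'a \<Rightarrow> 'a \<Rightarrow> 'a \<Rightarrow> 'a mat2" where
  "mat2 a b c d = vector [vector [a, b], vector [c, d]]"

definition SL2 :: "'a::field mat2 monoid" where
  "SL2 = \<lparr>carrier = {g. det g = 1}, monoid.mult = (**), one = mat 1\<rparr>"

definition SL2sq :: "('a::field mat2 \<times> 'a mat2) monoid" where
  "SL2sq = SL2 \<times>\<times> SL2"

definition mu2 :: "('a::field mat2 \<times> 'a mat2) set" where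
  "mu2 = {(mat 1, mat 1), (- mat 1, - mat 1)}"

definition Levi :: "'a::field levi monoid" where
  "Levi = SL2sq Mod mu2"

definition cls :: "'a::field mat2 \<times> 'a mat2 \<Rightarrow> 'a levi" where
  "cls x = mu2 #>\<^bsub>SL2sq\<^esub> x"

definition torus_elt :: "'a::field \<Rightarrow> 'a \<Rightarrow> 'a levi" where
  "torus_elt a b = cls (mat2 a 0 0 (inverse a), mat2 b 0 0 (inverse b))"

definition torus_A :: "'a::field levi set" where
  "torus_A = {torus_elt a b | a b. a \<noteq> 0 \<and> b \<noteq> 0}"

text \<open>The value at \<open>torus_elt a b\<close> of $c_1\alpha_1 + c_2\alpha_2$: here $\alpha_2 = a^2$ and
  $\eta = b^2$, hence $\alpha_1 = (\eta - 3\alpha_2)/2 = a^{-3} b$.\<close>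

definition root_char :: "root \<Rightarrow> 'a::field \<Rightarrow> 'a \<Rightarrow> 'a" where
  "root_char c a b = a powi (2 * snd c - 3 * fst c) * b powi fst c"

definition root_subgroup :: "root \<Rightarrow> 'a::field levi set" where
  "root_subgroup c =
    (if c = short_root then range (\<lambda>z. cls (mat2 1 z 0 1, mat 1))
     else if c = - short_root then range (\<lambda>z. cls (mat2 1 0 z 1, mat 1))
     else if c = highest_root then range (\<lambda>z. cls (mat 1, mat2 1 z 0 1))
     else if c = - highest_root then range (\<lambda>z. cls (mat 1, mat2 1 0 z 1))
     else {})"

lemma SL2sq_simps:
  "carrier SL2sq = {x. det (fst x) = 1 \<and> det (snd x) = 1}"
  "x \<otimes>\<^bsub>SL2sq\<^esub> y = (fst x ** fst y, snd x ** snd y)"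
  "\<one>\<^bsub>SL2sq\<^esub> = (mat 1, mat 1)"
  by (auto simp: SL2sq_def SL2_def DirProd_def case_prod_beta)

lemma group_SL2: "group (SL2 :: 'a::field mat2 monoid)"
proof (rule groupI)
  fix g :: "'a mat2" assume g: "g \<in> carrier SL2"
  let ?h = "mat2 (g$2$2) (- g$1$2) (- g$2$1) (g$1$1)"
  have "?h \<in> carrier SL2" "?h \<otimes>\<^bsub>SL2\<^esub> g = \<one>\<^bsub>SL2\<^esub>"
    using g by (auto simp: SL2_def mat2_def det_2 matrix_matrix_mult_def vec_eq_iff forall_2 sum_2
        mat_def algebra_simps)
  then show "\<exists>h\<in>carrier SL2. h \<otimes>\<^bsub>SL2\<^esub> g = \<one>\<^bsub>SL2\<^esub>" by blast
qed (auto simp: SL2_def det_mul matrix_mul_assoc)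

lemma group_SL2sq: "group (SL2sq :: ('a::field mat2 \<times> 'a mat2) monoid)"
  unfolding SL2sq_def by (intro DirProd_group group_SL2)

lemma minus_mat_1:
  "(- mat 1) ** g = - (g :: 'a::field mat2)" "g ** (- mat 1) = - g" "det (- g) = det g"
  by (auto simp: matrix_matrix_mult_def vec_eq_iff mat_def det_2 sum_2 forall_2)

lemma mu2_normal: "mu2 \<lhd> (SL2sq :: ('a::field mat2 \<times> 'a mat2) monoid)"
proof -
  interpret group "SL2sq :: ('a mat2 \<times> 'a mat2) monoid" by (rule group_SL2sq)
  have inv: "inv\<^bsub>SL2sq\<^esub> (- mat 1, - mat 1) = (- mat 1, - mat 1 :: 'a mat2)"
    by (rule inv_equality) (auto simp: SL2sq_simps minus_mat_1)
  have "subgroup mu2 (SL2sq :: ('a mat2 \<times> 'a mat2) monoid)"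
    by (rule subgroupI) (auto simp: mu2_def SL2sq_simps minus_mat_1 inv
        inv_one[unfolded SL2sq_simps])
  then show ?thesis
    by (rule normalI) (auto simp: r_coset_def l_coset_def mu2_def SL2sq_simps minus_mat_1)
qed

lemma group_Levi: "group (Levi :: 'a::field levi monoid)"
  unfolding Levi_def by (rule normal.factorgroup_is_group[OF mu2_normal])

lemma carrier_Levi: "carrier Levi = cls ` carrier SL2sq"
  by (auto simp: Levi_def FactGroup_def RCOSETS_def cls_def)

lemma cls_eq: "cls x = {x, - x}"
  by (cases x) (simp add: cls_def mu2_def r_coset_def SL2sq_simps minus_mat_1 insert_commute)

lemma cls_eqI: "x \<in> cls g \<Longrightarrow> cls g = cls x"
  unfolding cls_eq by (elim insertE emptyE) (simp_all add: insert_commute)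

lemma Levi_disjoint:
  "l \<in> carrier Levi \<Longrightarrow> l' \<in> carrier Levi \<Longrightarrow> x \<in> l \<Longrightarrow> x \<in> l' \<Longrightarrow> l = l'"
  unfolding carrier_Levi by (metis cls_eqI imageE)

text \<open>For a parabolic set \<open>R\<close> of roots of $L$, the parabolic containing $A$ with roots \<open>R\<close>.\<close>

definition parabolic :: "root set \<Rightarrow> 'a::field levi set" where
  "parabolic R = generate Levi (torus_A \<union> (\<Union>c\<in>R. root_subgroup c))"


section \<open>The Zariski topology on $L$\<close>

inductive_set poly_funs :: "('a::field mat2 \<times> 'a mat2 \<Rightarrow> 'a) set" where
  "(\<lambda>_. c) \<in> poly_funs"
| "(\<lambda>x. fst x $ i $ j) \<in> poly_funs"
| "(\<lambda>x. snd x $ i $ j) \<in> poly_funs"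
| "f \<in> poly_funs \<Longrightarrow> g \<in> poly_funs \<Longrightarrow> (\<lambda>x. f x + g x) \<in> poly_funs"
| "f \<in> poly_funs \<Longrightarrow> g \<in> poly_funs \<Longrightarrow> (\<lambda>x. f x * g x) \<in> poly_funs"

definition zariski_open_SL2sq :: "('a::field mat2 \<times> 'a mat2) set \<Rightarrow> bool" where
  "zariski_open_SL2sq U \<longleftrightarrow>
     (\<exists>S\<subseteq>poly_funs. U = {x \<in> carrier SL2sq. \<exists>f\<in>S. f x \<noteq> 0})"

definition zariski_Levi :: "'a::field levi topology" where
  "zariski_Levi = topology (\<lambda>U. U \<subseteq> carrier Levi \<and> zariski_open_SL2sq (\<Union>U))"

lemma zariski_open_Int:
  assumes UV: "U \<subseteq> carrier Levi" "V \<subseteq> carrier Levi"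
    and "zariski_open_SL2sq (\<Union>U)" "zariski_open_SL2sq (\<Union>V)"
  shows "zariski_open_SL2sq (\<Union>(U \<inter> V))"
proof -
  obtain S where S: "S \<subseteq> poly_funs" "\<Union>U = {x \<in> carrier SL2sq. \<exists>f\<in>S. f x \<noteq> 0}"
    using assms(3) unfolding zariski_open_SL2sq_def by (elim exE conjE)
  obtain T where T: "T \<subseteq> poly_funs" "\<Union>V = {x \<in> carrier SL2sq. \<exists>f\<in>T. f x \<noteq> 0}"
    using assms(4) unfolding zariski_open_SL2sq_def by (elim exE conjE)
  define P where "P = (\<lambda>(f, g) x. f x * g x) ` (S \<times> T)"
  have P: "P \<subseteq> poly_funs"
  proof
    fix h assume "h \<in> P"
    then obtain f g where "h = (\<lambda>x. f x * g x)" "f \<in> S" "g \<in> T" by (auto simp: P_def)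
    then show "h \<in> poly_funs" using S(1) T(1) by (simp only: poly_funs.intros(5) subsetD)
  qed
  have P_iff: "(\<exists>h\<in>P. h x \<noteq> 0) \<longleftrightarrow> (\<exists>f\<in>S. f x \<noteq> 0) \<and> (\<exists>g\<in>T. g x \<noteq> 0)" for x
    by (simp add: P_def)
  have "x \<in> \<Union>(U \<inter> V) \<longleftrightarrow> x \<in> \<Union>U \<and> x \<in> \<Union>V" for x
  proof
    assume "x \<in> \<Union>U \<and> x \<in> \<Union>V"
    then obtain l l' where l: "l \<in> U" "l' \<in> V" "x \<in> l" "x \<in> l'" by (elim conjE UnionE)
    then have "l = l'" using UV Levi_disjoint[of l l' x] by (simp add: subsetD)
    with l show "x \<in> \<Union>(U \<inter> V)" by auto
  qed auto
  then have "\<Union>(U \<inter> V) = {x \<in> carrier SL2sq. \<exists>h\<in>P. h x \<noteq> 0}"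
    unfolding S(2) T(2) P_iff by (simp add: set_eq_iff conj_ac)
  with P show ?thesis unfolding zariski_open_SL2sq_def by (intro exI[of _ P] conjI)
qed

lemma zariski_open_Union:
  assumes "\<And>U. U \<in> C \<Longrightarrow> zariski_open_SL2sq (\<Union>U)"
  shows "zariski_open_SL2sq (\<Union>(\<Union>C))"
proof -
  define S where "S = (\<lambda>U :: 'a levi set.
    SOME S. S \<subseteq> poly_funs \<and> \<Union>U = {x \<in> carrier SL2sq. \<exists>f\<in>S. f x \<noteq> (0::'a)})"
  have S: "S U \<subseteq> poly_funs \<and> \<Union>U = {x \<in> carrier SL2sq. \<exists>f\<in>S U. f x \<noteq> 0}" if "U \<in> C" for U
    unfolding S_def using assms[OF that] unfolding zariski_open_SL2sq_def by (rule someI_ex)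
  have iff: "x \<in> \<Union>U \<longleftrightarrow> x \<in> carrier SL2sq \<and> (\<exists>f\<in>S U. f x \<noteq> 0)" if "U \<in> C" for U x
    using conjunct2[OF S[OF that], THEN arg_cong, of "\<lambda>A. x \<in> A"] by (simp only: mem_Collect_eq)
  have "\<Union>(\<Union>C) = {x \<in> carrier SL2sq. \<exists>f\<in>\<Union>(S ` C). f x \<noteq> 0}"
  proof (intro equalityI subsetI)
    fix x assume "x \<in> \<Union>(\<Union>C)"
    then obtain U where U: "U \<in> C" "x \<in> \<Union>U" by auto
    with iff[OF U(1), of x] show "x \<in> {x \<in> carrier SL2sq. \<exists>f\<in>\<Union>(S ` C). f x \<noteq> 0}" by auto
  next
    fix x assume "x \<in> {x \<in> carrier SL2sq. \<exists>f\<in>\<Union>(S ` C). f x \<noteq> 0}"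
    then obtain U f where x: "x \<in> carrier SL2sq" "U \<in> C" "f \<in> S U" "f x \<noteq> 0" by auto
    then have "x \<in> \<Union>U" using iff[of U x] by auto
    with x(2) show "x \<in> \<Union>(\<Union>C)" by auto
  qed
  moreover have "\<Union>(S ` C) \<subseteq> poly_funs" using S by (simp add: UN_least)
  ultimately show ?thesis
    unfolding zariski_open_SL2sq_def by (intro exI[of _ "\<Union>(S ` C)"] conjI)
qed

lemma istopology_zariski_Levi:
  "istopology (\<lambda>U. U \<subseteq> carrier Levi \<and> zariski_open_SL2sq (\<Union>U))"
  unfolding istopology_def
  by (intro conjI allI impI Union_least zariski_open_Int zariski_open_Union) auto

lemma openin_zariski_Levi:
  "openin zariski_Levi U \<longleftrightarrow> U \<subseteq> carrier Levi \<and> zariski_open_SL2sq (\<Union>U)"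
  unfolding zariski_Levi_def by (simp add: istopology_zariski_Levi)

definition identity_component :: "'a::field levi set \<Rightarrow> 'a levi set" where
  "identity_component H = connected_component_of_set (subtopology zariski_Levi H) \<one>\<^bsub>Levi\<^esub>"

definition closed_conn_solvable :: "'a::field levi set \<Rightarrow> bool" where
  "closed_conn_solvable B \<longleftrightarrow> subgroup B Levi \<and> closedin zariski_Levi B \<and>
     connectedin zariski_Levi B \<and> solvable (Levi\<lparr>carrier := B\<rparr>)"

definition is_borel :: "'a::field levi set \<Rightarrow> 'a levi set \<Rightarrow> bool" where
  "is_borel B H \<longleftrightarrow> B \<subseteq> H \<and> closed_conn_solvable B \<and>
     (\<forall>B'. B' \<subseteq> H \<longrightarrow> closed_conn_solvable B' \<longrightarrow> B \<subseteq> B' \<longrightarrow> B' = B)"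

text \<open>A torus in $L$ is the image of a closed immersion of groups $\mathbb G_m^n \to L$.\<close>

definition gm_power :: "nat \<Rightarrow> (nat \<Rightarrow> 'a::field) set" where
  "gm_power n = {z. (\<forall>i<n. z i \<noteq> 0) \<and> (\<forall>i\<ge>n. z i = 1)}"

inductive_set laurent_funs :: "nat \<Rightarrow> ((nat \<Rightarrow> 'a::field) \<Rightarrow> 'a) set" for n :: nat where
  "(\<lambda>_. c) \<in> laurent_funs n"
| "i < n \<Longrightarrow> (\<lambda>z. z i) \<in> laurent_funs n"
| "i < n \<Longrightarrow> (\<lambda>z. inverse (z i)) \<in> laurent_funs n"
| "f \<in> laurent_funs n \<Longrightarrow> g \<in> laurent_funs n \<Longrightarrow> (\<lambda>z. f z + g z) \<in> laurent_funs n"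
| "f \<in> laurent_funs n \<Longrightarrow> g \<in> laurent_funs n \<Longrightarrow> (\<lambda>z. f z * g z) \<in> laurent_funs n"

definition Levi_regular :: "('a::field levi \<Rightarrow> 'a) \<Rightarrow> bool" where
  "Levi_regular F \<longleftrightarrow> (\<exists>f\<in>poly_funs. \<forall>x\<in>carrier SL2sq. F (cls x) = f x)"

definition is_torus :: "'a::field levi set \<Rightarrow> bool" where
  "is_torus S \<longleftrightarrow> (\<exists>n \<phi>. bij_betw \<phi> (gm_power n) S \<and> S \<subseteq> carrier Levi \<and>
     (\<forall>z\<in>gm_power n. \<forall>z'\<in>gm_power n. \<phi> (\<lambda>i. z i * z' i) = \<phi> z \<otimes>\<^bsub>Levi\<^esub> \<phi> z') \<and>
     (\<forall>F. Levi_regular F \<longrightarrow> (\<exists>g\<in>laurent_funs n. \<forall>z\<in>gm_power n. F (\<phi> z) = g z)) \<and>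
     (\<forall>i<n. \<exists>F. Levi_regular F \<and> (\<forall>z\<in>gm_power n. F (\<phi> z) = z i)))"

text \<open>The Lie algebra of a closed subgroup \<open>H\<close>, computed on its preimage in \<open>SL\<^sub>2 \<times> SL\<^sub>2\<close>
  (which is an etale cover, as the characteristic is not 2): the tangent vectors at the identity
  along which the differentials of all polynomials vanishing on \<open>H\<close> are zero. The polynomial \<open>q\<close> is
  unique since the field is infinite, and \<open>poly.coeff q 1\<close> is the differential.\<close>

definition lie_of :: "'a::field levi set \<Rightarrow> ('a mat2 \<times> 'a mat2) set" where
  "lie_of H = {d. \<forall>f\<in>poly_funs. (\<forall>x\<in>\<Union>H. f x = 0) \<longrightarrow>
     (\<exists>q. poly.coeff q 1 = 0 \<and>
       (\<forall>s. poly q s = f (mat 1 + map_matrix ((*) s) (fst d), mat 1 + map_matrix ((*) s) (snd d))))}"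


section \<open>The representations $V_{\mathbf P}$ and $V_{\mathbf P}^*$\<close>

text \<open>$V_{\mathbf P}^*$ consists of the forms \<open>f ((x, y), (u, v))\<close>, cubic in \<open>(x, y)\<close> and linear in
  \<open>(u, v)\<close>, regarded as functions; nothing is lost as the field is infinite. The group acts by
  substitution, so that \<open>diag(s, 1/s)\<close> in the short root factor sends \<open>x, y\<close> to \<open>sx, y/s\<close>.\<close>

type_synonym 'a form = "('a^2) \<times> ('a^2) \<Rightarrow> 'a"

definition V_dual :: "'a::field form set" where
  "V_dual = {f. \<exists>c :: nat \<Rightarrow> nat \<Rightarrow> 'a. f = (\<lambda>(p, r).
     \<Sum>i\<le>3. \<Sum>j\<le>1. c i j * (p$1)^(3 - i) * (p$2)^i * (r$1)^(1 - j) * (r$2)^j)}"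

definition subst :: "'a::field mat2 \<times> 'a mat2 \<Rightarrow> 'a form \<Rightarrow> 'a form" where
  "subst g f = (\<lambda>(p, r). f (p v* fst g, r v* snd g))"

definition act :: "'a::field levi \<Rightarrow> 'a form \<Rightarrow> 'a form" where
  "act l f = subst (SOME g. g \<in> l) f"

lemma subst_uminus:
  assumes "f \<in> V_dual" shows "subst (- g) f = subst g f"
proof -
  have neg: "v v* (- A) = - (v v* A)" for v :: "'a^2" and A :: "'a mat2"
    by (simp add: vector_matrix_mult_def vec_eq_iff sum_negf)
  have "f (- p, - r) = f (p, r)" for p r
  proof -
    obtain c where f: "f = (\<lambda>(p, r).
        \<Sum>i\<le>3. \<Sum>j\<le>1. c i j * (p$1)^(3 - i) * (p$2)^i * (r$1)^(1 - j) * (r$2)^j)"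
      using assms unfolding V_dual_def by blast
    show ?thesis
      by (simp add: f numeral_3_eq_3)
  qed
  then show ?thesis by (simp add: subst_def fun_eq_iff neg)
qed

lemma act_cls:
  assumes "f \<in> V_dual" shows "act (cls g) f = subst g f"
proof -
  have "(SOME h. h \<in> cls g) \<in> cls g" by (rule someI[of _ g]) (simp add: cls_eq)
  then consider "(SOME h. h \<in> cls g) = g" | "(SOME h. h \<in> cls g) = - g" by (auto simp: cls_eq)
  then show ?thesis using subst_uminus[OF assms] unfolding act_def by cases auto
qed

definition psi :: "'a::field form" where
  "psi = (\<lambda>(p, r). (p$1)^3 * r$1 + (p$2)^3 * r$2)"

lemma psi_in_V_dual: "psi \<in> V_dual"
  unfolding V_dual_def psi_def mem_Collect_eq
  by (rule exI[of _ "\<lambda>i j. if (i, j) = (0, 0) \<or> (i, j) = (3, 1) then 1 else 0"])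
     (simp add: fun_eq_iff numeral_3_eq_3)

text \<open>$V_{\mathbf P}$ is the dual of $V_{\mathbf P}^*$, with the contragredient action. The affine
  root space $V_{\mathbf P}(\alpha)$, for $\alpha(x_{\mathbf P}) = 1/m$, is the weight space of the
  gradient of $\alpha$.\<close>

definition V_P :: "('a::field form \<Rightarrow> 'a) set" where
  "V_P = {\<phi>. (\<forall>f\<in>V_dual. \<forall>g\<in>V_dual. \<phi> (\<lambda>z. f z + g z) = \<phi> f + \<phi> g) \<and>
     (\<forall>c. \<forall>f\<in>V_dual. \<phi> (\<lambda>z. c * f z) = c * \<phi> f) \<and> (\<forall>f. f \<notin> V_dual \<longrightarrow> \<phi> f = 0)}"

definition V_P_space :: "aff_root \<Rightarrow> ('a::field form \<Rightarrow> 'a) set" where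
  "V_P_space \<alpha> = {\<phi> \<in> V_P. \<forall>a b. a \<noteq> 0 \<longrightarrow> b \<noteq> 0 \<longrightarrow> (\<forall>f\<in>V_dual.
     \<phi> (act (inv\<^bsub>Levi\<^esub> (torus_elt a b)) f) = root_char (gradient \<alpha>) a b * \<phi> f)}"


section \<open>The varieties $Y_w$\<close>

definition Q_sub :: "apt \<Rightarrow> (apt \<Rightarrow> apt) \<Rightarrow> 'a::field levi set" where
  "Q_sub xQ w = parabolic (para_roots (w xQ))"

definition V_sub :: "apt \<Rightarrow> (apt \<Rightarrow> apt) \<Rightarrow> ('a::field form \<Rightarrow> 'a) set" where
  "V_sub xQ w =
    (let S = {\<alpha> \<in> real_aff_roots. aff_val \<alpha> x_P = 1 / real m_P \<and> aff_val \<alpha> (w xQ) \<le> 0}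
     in {\<lambda>f. \<Sum>\<alpha>\<in>S. v \<alpha> f | v. \<forall>\<alpha>\<in>S. v \<alpha> \<in> V_P_space \<alpha>})"

definition V_perp :: "apt \<Rightarrow> (apt \<Rightarrow> apt) \<Rightarrow> 'a::field form set" where
  "V_perp xQ w = {f \<in> V_dual. \<forall>\<phi>\<in>V_sub xQ w. \<phi> f = 0}"

text \<open>Points of flag varieties are left cosets, i.e. subsets of $L$.\<close>

definition flags :: "apt \<Rightarrow> (apt \<Rightarrow> apt) \<Rightarrow> 'a::field levi set set" where
  "flags xQ w = {l <#\<^bsub>Levi\<^esub> Q_sub xQ w | l. l \<in> carrier Levi}"

definition Y_var :: "apt \<Rightarrow> (apt \<Rightarrow> apt) \<Rightarrow> 'a::field levi set set" where
  "Y_var xQ w = {l <#\<^bsub>Levi\<^esub> Q_sub xQ w | l.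
     l \<in> carrier Levi \<and> act (inv\<^bsub>Levi\<^esub> l) psi \<in> V_perp xQ w}"

definition flag_stab :: "'a::field levi set \<Rightarrow> 'a levi set \<Rightarrow> 'a levi set" where
  "flag_stab B y = {b \<in> B. b <#\<^bsub>Levi\<^esub> y = y}"

definition flag_orbit :: "'a::field levi set \<Rightarrow> 'a levi set \<Rightarrow> 'a levi set set" where
  "flag_orbit B y = {b <#\<^bsub>Levi\<^esub> y | b. b \<in> B}"

text \<open>Openness inside a subvariety \<open>V\<close> of a flag variety, tested on preimages in $L$ (the quotient
  map $L \to L/Q_w$ is open and surjective).\<close>

definition is_open_orbit :: "'a::field levi set \<Rightarrow> 'a levi set set \<Rightarrow> 'a levi set set \<Rightarrow> bool" where
  "is_open_orbit B V Orb \<longleftrightarrow>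
     (\<exists>y\<in>V. Orb = flag_orbit B y) \<and> Orb \<subseteq> V \<and> openin (subtopology zariski_Levi (\<Union>V)) (\<Union>Orb)"

definition spectrally_meager :: "'a::field levi set \<Rightarrow> 'a levi set set \<Rightarrow> bool" where
  "spectrally_meager H V \<longleftrightarrow>
     (\<forall>B. is_borel B H \<longrightarrow> (\<forall>y\<in>V. \<exists>S. is_torus S \<and> S \<noteq> {\<one>\<^bsub>Levi\<^esub>} \<and> S \<subseteq> flag_stab B y))"


section \<open>The stabilizer of \<open>\<psi>\<close> and Kummer local systems\<close>

definition L_psi :: "'a::field levi set" where
  "L_psi = {l \<in> carrier Levi. act l psi = psi}"

text \<open>$T_\psi$ is a subgroup of $L$, the quotient of the \<open>s\<close>-line \<open>\<bbbG>\<^sub>m\<close> by \<open>s = -1\<close>.\<close>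

definition T_psi :: "'a::field levi set" where
  "T_psi = {torus_elt s (inverse (s^3)) | s. s \<noteq> 0}"

definition frob :: "'k::finite_field alg_closure levi \<Rightarrow> 'k alg_closure levi" where
  "frob l = (\<lambda>g. (map_matrix (\<lambda>x. x ^ CARD('k)) (fst g), map_matrix (\<lambda>x. x ^ CARD('k)) (snd g))) ` l"

definition T_psi_k :: "'k::finite_field alg_closure levi set" where
  "T_psi_k = {t \<in> T_psi. frob t = t}"

definition T_character :: "('k::finite_field alg_closure levi \<Rightarrow> 'e::field) \<Rightarrow> bool" where
  "T_character chi \<longleftrightarrow> (\<forall>t\<in>T_psi_k. chi t \<noteq> 0) \<and>
     (\<forall>t\<in>T_psi_k. \<forall>t'\<in>T_psi_k. chi (t \<otimes>\<^bsub>Levi\<^esub> t') = chi t * chi t')"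

definition lang_preimage :: "'k::finite_field alg_closure levi set \<Rightarrow> 'k alg_closure levi set" where
  "lang_preimage S = {t \<in> T_psi. frob t \<otimes>\<^bsub>Levi\<^esub> inv\<^bsub>Levi\<^esub> t \<in> S}"

text \<open>The Kummer local system \<open>\<K>\<^sub>\<chi>\<close> is the \<open>\<chi>\<close>-isotypic part of the direct image of the constant
  sheaf under the Lang map \<open>t \<mapsto> Frob(t) t\<^sup>-\<^sup>1\<close> of $T_\psi$. Its sections over \<open>S\<close> are the locally
  constant \<open>\<chi>\<close>-equivariant functions on the Lang preimage of \<open>S\<close>; the restriction to \<open>S\<close>, having
  rank one, is trivial iff there is a nowhere vanishing section.\<close>

definition kummer_sections :: "('k::finite_field alg_closure levi \<Rightarrow> 'e::field) \<Rightarrow>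
    'k alg_closure levi set \<Rightarrow> ('k alg_closure levi \<Rightarrow> 'e) set" where
  "kummer_sections chi S = {f.
     continuous_map (subtopology zariski_Levi (lang_preimage S)) (discrete_topology UNIV) f \<and>
     (\<forall>a\<in>T_psi_k. \<forall>t\<in>lang_preimage S. f (a \<otimes>\<^bsub>Levi\<^esub> t) = chi a * f t)}"

definition kummer_trivial :: "('k::finite_field alg_closure levi \<Rightarrow> 'e::field) \<Rightarrow>
    'k alg_closure levi set \<Rightarrow> bool" where
  "kummer_trivial chi S \<longleftrightarrow> (\<exists>f\<in>kummer_sections chi S. \<forall>t\<in>lang_preimage S. f t \<noteq> 0)"


section \<open>Euphotic and strict data\<close>

text \<open>$L_\psi^\circ$ is a torus, hence equal to each of its Borel subgroups and to its universal
  Cartan, so the images in the universal Cartan of subgroups of \<open>B\<close> are these subgroups.\<close>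

definition stab_components :: "'a::field levi set \<Rightarrow> 'a levi set set \<Rightarrow> 'a levi set set" where
  "stab_components B V = {identity_component (flag_stab B y) | y. y \<in> V}"

definition nonrelevant :: "apt \<Rightarrow> (apt \<Rightarrow> apt) set" where
  "nonrelevant xQ =
     ext_aff_weyl - {p \<circ> o' \<circ> q | p o' q. p \<in> weyl_at x_P \<and> o' \<in> Omega \<and> q \<in> weyl_at xQ}"

definition euphotic :: "apt \<Rightarrow> ('k::finite_field alg_closure levi \<Rightarrow> 'e::field) \<Rightarrow> bool" where
  "euphotic xQ chi \<longleftrightarrow>
     (\<forall>w\<in>Omega. \<forall>B :: 'k alg_closure levi set. is_borel B (identity_component L_psi) \<longrightarrow>
        (\<exists>Orb. is_open_orbit B (Y_var xQ w) Orb \<and> (\<forall>y\<in>Orb. finite (flag_stab B y)))) \<and>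
     (\<forall>w\<in>nonrelevant xQ.
        spectrally_meager (identity_component L_psi :: 'k alg_closure levi set) (Y_var xQ w)) \<and>
     (\<forall>w\<in>nonrelevant xQ. \<forall>B. is_borel B (identity_component L_psi) \<longrightarrow>
        (\<forall>S\<in>stab_components B (Y_var xQ w). \<not> kummer_trivial chi S))"

text \<open>Triviality of the scheme-theoretic stabilizer of a point \<open>y\<close> in \<open>B\<close> means that it has no
  nontrivial points and that its Lie algebra, the intersection of those of \<open>B\<close> and of the stabilizer
  of \<open>y\<close> in $L$, is zero. The center of $G$ is trivial.\<close>

definition is_strict :: "apt \<Rightarrow> ('k::finite_field alg_closure levi \<Rightarrow> 'e::field) \<Rightarrow> bool" where
  "is_strict xQ chi \<longleftrightarrow>
     (\<forall>w\<in>Omega. \<forall>B :: 'k alg_closure levi set. is_borel B (identity_component L_psi) \<longrightarrow>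
        (\<exists>Orb. is_open_orbit B (flags xQ w) Orb \<and>
           (\<forall>x\<in>flags xQ w - Orb. \<not> kummer_trivial chi (identity_component (flag_stab B x))) \<and>
           (\<forall>x\<in>Orb. flag_stab B x = {\<one>\<^bsub>Levi\<^esub>} \<and> lie_of B \<inter> lie_of (flag_stab (carrier Levi) x) = {0})))"

end

theory Submission
  imports Defs
begin

text \<open>A nondegenerate invariant form excludes characteristic 3: there the scalar matrix \<open>1\<close> lies in
  \<open>sl\<^sub>3\<close>, and the corresponding derivation \<open>Z\<close> of the octonions is orthogonal to everything, since
  every derivation is the sum of some \<open>[Z, E]\<close> and of commutators of derivations commuting with \<open>Z\<close>.
  So 6 is invertible, $L_\psi^\circ = T_\psi$, and $T_\psi$ is its own Borel subgroup.

  For a translate \<open>w\<close> write \<open>(t, r)\<close> for the values of $\alpha_2$ and $\eta - 1$ at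
  $w x_{\mathbf Q}$. Annihilating $V_w$ means that in ${}^{\ell^{-1}}\psi$ the coefficients of
  $x^{3-i} y^i v$ with $(2i - 3) t + r \le -1$ and of $x^{3-i} y^i u$ with $(2i - 3) t - r \le -1$
  vanish. If \<open>w\<close> is relevant there is no condition, and $Y_w = \mathbb P^1$ on which $T_\psi$ acts
  simply transitively off \<open>0, \<infinity>\<close>. If \<open>w\<close> is not relevant, the positions of the translates of
  $x_{\mathbf Q}$ leave two cases: either both coefficients of \<open>x\<^sup>3\<close> (or of \<open>y\<^sup>3\<close>) vanish, which is
  impossible, or those of \<open>x\<^sup>3u\<close> and \<open>x\<^sup>2yu\<close> do (up to exchanging \<open>x, y\<close> and \<open>u, v\<close>), which forces
  both flag coordinates to be fixed by $T_\psi$. All stabilizers that occur are therefore trivial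
  or $T_\psi$ itself, and on the connected group $T_\psi$ a nontrivial \<open>\<chi>\<close> gives a nontrivial
  Kummer local system.\<close>

section \<open>Characteristic 3 and derivations of the octonions\<close>

text \<open>Only 2 and 3 have to be invertible: 3 is the binomial coefficient of the inner monomials
  of a cubic, and 2 separates the signs of the \<open>mu2\<close> cosets. The second is m itself;
  the first must be read off from an arbitrary form, so one exhibits an element lying in the radical
  of every invariant form. The candidate is the center of the long root sl_3, which consists of
  traceless matrices exactly in characteristic 3. Infinitely many translates are controlled because
  twelve times the position (t, r) is integral and t never vanishes. Once |t| or |r| reaches 1 the
  required inequalities hold for reasons of size; only the open box |t|, |r| < 1 needs a finite
  check, and it is there that the four elements of W_P must be excluded. Since strictness concerns
  scheme-theoretic stabilizers, counting points is not enough: the Lie algebras are compared as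
  well, and there 2 is needed again, because T_psi scales the flag coordinate by s^2.\<close>

definition sl3_der :: "'k::field^3^3 \<Rightarrow> 'k oct \<Rightarrow> 'k oct" where
  "sl3_der A = (\<lambda>(a, v, w, b). (0, A *v v, - (transpose A *v w), 0))"

lemmas vec3_simps = vec_eq_iff forall_3 sum_3 dot3_def vcross_def matrix_vector_mult_def
  matrix_matrix_mult_def transpose_def vector_scalar_mult_def mat_def trace_def

text \<open>The pairing \<open>dot3\<close> of the slots \<open>v\<close> and \<open>w\<close> is
  invariant under every \<open>A\<close>, but \<open>vcross\<close> identifies the exterior square
  of one slot with the other only up to the determinant; the trace is that obstruction. This is the
  subalgebra spanned by the torus and the long roots.\<close>

lemma sl3_der_derivation:
  assumes "trace A = 0"
  shows "sl3_der A \<in> (g2_lie :: ('k::field oct \<Rightarrow> 'k oct) set)"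
proof -
  have tr: "A$3$3 = - A$1$1 - A$2$2"
    using assms by (simp add: trace_def sum_3 algebra_simps eq_neg_iff_add_eq_0)
  have "sl3_der A (oct_mult x y) = oct_mult (sl3_der A x) y + oct_mult x (sl3_der A y)" for x y
    by (cases x; cases y) (simp add: sl3_der_def vec3_simps tr algebra_simps)
  moreover have "sl3_der A (x + y) = sl3_der A x + sl3_der A y" for x y
    by (cases x; cases y) (simp add: sl3_der_def vec3_simps algebra_simps)
  moreover have "sl3_der A (oct_scale c x) = oct_scale c (sl3_der A x)" for c x
    by (cases x) (simp add: sl3_der_def vec3_simps algebra_simps)
  ultimately show ?thesis unfolding g2_lie_def by blast
qed

lemma vcross_0 [simp]: "vcross 0 w = 0" "vcross v 0 = 0"
  by (simp_all add: vcross_def vec_eq_iff forall_3)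

lemma dot3_0 [simp]: "dot3 0 w = 0" "dot3 v 0 = 0"
  by (simp_all add: dot3_def)

lemma oct_scale_diff: "oct_scale c (x - y) = oct_scale c x - oct_scale c y"
  by (cases x; cases y) (simp add: vec3_simps algebra_simps)

lemma oct_mult_diff:
  "oct_mult (x - x') y = oct_mult x y - oct_mult x' y"
  "oct_mult y (x - x') = oct_mult y x - oct_mult y x'"
  by (cases x; cases x'; cases y; simp add: vec3_simps algebra_simps)+

lemma g2_lieD:
  assumes "D \<in> g2_lie"
  shows "D (x + y) = D x + D y" "D (oct_scale c x) = oct_scale c (D x)"
    "D (oct_mult x y) = oct_mult (D x) y + oct_mult x (D y)" "D (x - y) = D x - D y"
proof -
  show add: "D (x + y) = D x + D y" for x y
    using assms unfolding g2_lie_def by blast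
  show "D (oct_scale c x) = oct_scale c (D x)"
    "D (oct_mult x y) = oct_mult (D x) y + oct_mult x (D y)"
    using assms unfolding g2_lie_def by blast+
  show "D (x - y) = D x - D y"
    using add[of "x - y" y] by (simp only: diff_add_cancel eq_diff_eq)
qed

lemma g2_lie_diff:
  assumes "D \<in> g2_lie" "E \<in> g2_lie"
  shows "(\<lambda>x. D x - E x) \<in> (g2_lie :: ('k::field oct \<Rightarrow> 'k oct) set)"
  unfolding g2_lie_def mem_Collect_eq
  using g2_lieD[OF assms(1)] g2_lieD[OF assms(2)]
  by (intro conjI allI) (simp_all only: oct_scale_diff oct_mult_diff, simp_all add: algebra_simps)

lemma sl3_der_add: "sl3_der (A + B) = (\<lambda>x. sl3_der A x + sl3_der B x)"
  by (auto simp: sl3_der_def fun_eq_iff vec3_simps algebra_simps)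

lemma lie_bracket_sl3_der:
  "lie_bracket (sl3_der A) (sl3_der B) = sl3_der (A ** B - B ** A)"
  by (auto simp: lie_bracket_def sl3_der_def fun_eq_iff vec3_simps algebra_simps)

lemma lie_bracket_in_g2_lie:
  assumes "D \<in> g2_lie" "E \<in> g2_lie"
  shows "lie_bracket D E \<in> (g2_lie :: ('k::field oct \<Rightarrow> 'k oct) set)"
  unfolding g2_lie_def mem_Collect_eq lie_bracket_def
  using g2_lieD[OF assms(1)] g2_lieD[OF assms(2)]
  by (intro conjI allI) (simp_all only: oct_scale_diff oct_mult_diff, simp_all add: algebra_simps)

text \<open>A bracket with a diagonal matrix with distinct entries rescales each off-diagonal
  position by a unit, which accounts for the off-diagonal part; the second bracket supplies the
  diagonal. In particular the scalar matrix 1 is covered.\<close>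

lemma traceless_char_3_commutators:
  fixes A :: "'k::field^3^3"
  assumes "(3::'k) = 0" "trace A = 0"
  shows "\<exists>M D M' Y. trace M = 0 \<and> trace D = 0 \<and> trace M' = 0 \<and> trace Y = 0 \<and>
    A = (D ** M - M ** D) + (M' ** Y - Y ** M')"
proof -
  have tr: "A$3$3 = - A$1$1 - A$2$2"
    using assms by (simp add: trace_def sum_3 algebra_simps eq_neg_iff_add_eq_0)
  \<comment> \<open>The entries 0, 1, -1 have trace 0 and their differences are 1 or -1 modulo 3,
    which explains the signs in \<open>?M\<close>.\<close>
  let ?D = "vector [vector [0,0,0], vector [0,1,0], vector [0,0,-1]] :: 'k^3^3"
  let ?M = "vector [vector [0, - A$1$2, A$1$3], vector [A$2$1, 0, - A$2$3],
     vector [- A$3$1, A$3$2, 0]] :: 'k^3^3"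
  \<comment> \<open>The superdiagonal holds the partial sums of the diagonal of \<open>A\<close>;
    the bracket with the cyclic permutation takes their successive differences.\<close>
  let ?M' = "vector [vector [0, A$1$1, 0], vector [0, 0, A$1$1 + A$2$2], vector [0,0,0]] :: 'k^3^3"
  let ?Y = "vector [vector [0,0,1], vector [1,0,0], vector [0,1,0]] :: 'k^3^3"
  have "trace ?M = 0" "trace ?D = 0" "trace ?M' = 0" "trace ?Y = 0"
    by (simp_all add: trace_def sum_3)
  moreover have "- x - x = x" for x :: 'k
  proof -
    have "x + x + x = 3 * x" by (simp add: algebra_simps)
    then have "x + x + x = 0" by (simp add: assms(1))
    moreover have "x = (x + x + x) + (- x - x)" by simp
    ultimately show ?thesis by simp
  qed
  then have "A = (?D ** ?M - ?M ** ?D) + (?M' ** ?Y - ?Y ** ?M')"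
    by (simp add: vec3_simps tr)
  ultimately show ?thesis by blast
qed

text \<open>The eigenvalues of \<open>sl3_der (mat 1)\<close> are 0 on the diagonal, 1 on the slot
  \<open>v\<close> and -1 on the slot \<open>w\<close>. They are distinct as 2 is nonzero, so
  \<open>E\<close> preserves the three parts. It kills the idempotents, acts on \<open>w\<close>
  dually to \<open>v\<close> by invariance of \<open>dot3\<close>, and is traceless because of
  \<open>vcross\<close>.\<close>

lemma commuting_derivation_char_3:
  fixes E :: "'k::field oct \<Rightarrow> 'k oct"
  assumes "(2::'k) \<noteq> 0" and E: "E \<in> g2_lie"
    and comm: "\<And>x. sl3_der (mat 1) (E x) = E (sl3_der (mat 1) x)"
  shows "\<exists>A. trace A = 0 \<and> E = sl3_der A"
proof -
  note add = g2_lieD(1)[OF E] and scale = g2_lieD(2)[OF E] and mult = g2_lieD(3)[OF E]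
  have Z: "sl3_der (mat 1) (a, v, w, b) = (0, v, - w, 0 :: 'k)" for a v w b
    by (simp add: sl3_der_def vec3_simps)
  have E0: "E 0 = 0" using add[of 0 0] by simp
  have two_ne_1: "(2::'k) \<noteq> 1" using one_add_one[where 'a = 'k] add_cancel_right_right[of 1 "1::'k"] by simp
  have "x = - x \<longleftrightarrow> x = 0" for x :: 'k
  proof -
    have "x = - x \<longleftrightarrow> 2 * x = 0" unfolding mult_2 by (simp add: eq_neg_iff_add_eq_0)
    then show ?thesis using assms(1) by simp
  qed
  then have neg: "v = - v \<longleftrightarrow> v = 0" "- v = v \<longleftrightarrow> v = 0" for v :: "'k^3"
    by (simp_all add: vec_eq_iff eq_commute[of "- _"])
  have diag: "E (a, 0, 0, b) = 0" for a b
  proof -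
    obtain c v w d where Ec: "E (1, 0, 0, 0) = (c, v, w, d)" by (metis prod_cases4)
    have "v = 0" "w = 0"
      using comm[of "(1,0,0,0)"] E0 by (auto simp: Ec Z zero_prod_def)
    \<comment> \<open>For an idempotent the Leibniz rule doubles the first entry of its image and
      kills the last one, so both are zero.\<close>
    with mult[of "(1,0,0,0)" "(1,0,0,0)"] have 1: "E (1,0,0,0) = 0"
      by (auto simp: Ec zero_prod_def two_ne_1)
    obtain c v w d where Ed: "E (0, 0, 0, 1) = (c, v, w, d)" by (metis prod_cases4)
    have "v = 0" "w = 0"
      using comm[of "(0,0,0,1)"] E0 by (auto simp: Ed Z zero_prod_def)
    with mult[of "(0,0,0,1)" "(0,0,0,1)"] have 2: "E (0,0,0,1) = 0"
      by (auto simp: Ed zero_prod_def two_ne_1)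
    have "(a, 0, 0, b) = oct_scale a (1,0,0,0) + oct_scale b (0,0,0,1 :: 'k)" 
      by (simp add: vec_eq_iff)
    then show ?thesis by (simp only: add scale 1 2) (simp add: zero_prod_def)
  qed
  define f where "f v = fst (snd (E (0, v, 0, 0)))" for v
  define g where "g w = fst (snd (snd (E (0, 0, w, 0))))" for w
  have f: "E (0, v, 0, 0) = (0, f v, 0, 0)" for v
    using comm[of "(0,v,0,0)"] unfolding f_def Z by (cases "E (0, v, 0, 0)") (auto simp: Z neg)
  have minus: "E (0,0,- w,0) = - E (0,0,w,0)" for w
  proof -
    have "E (0,0,-w,0) + E (0,0,w,0) = 0" unfolding add[symmetric] using E0 by (simp add: zero_prod_def)
    then show ?thesis by (simp add: eq_neg_iff_add_eq_0)
  qed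
  have g: "E (0, 0, w, 0) = (0, 0, g w, 0)" for w
    using comm[of "(0,0,w,0)"] unfolding g_def Z by (cases "E (0, 0, w, 0)") (auto simp: Z minus neg)
  have fadd: "f (v + v') = f v + f v'" and gadd: "g (v + v') = g v + g v'" for v v'
    using add[of "(0,v,0,0)" "(0,v',0,0)"] add[of "(0,0,v,0)" "(0,0,v',0)"] by (simp_all add: f g)
  have fsc: "f (c *s v) = c *s f v" and gsc: "g (c *s v) = c *s g v" for c v
    using scale[of c "(0,v,0,0)"] scale[of c "(0,0,v,0)"] by (simp_all add: f g)
  have dual: "dot3 (f v) w + dot3 v (g w) = 0" for v w
    using mult[of "(0,v,0,0)" "(0,0,w,0)"] diag[of "dot3 v w" 0]
    by (simp add: f g zero_prod_def)
  have cross: "g (vcross v v') = vcross (f v) v' + vcross v (f v')" for v v'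
    using mult[of "(0,v,0,0)" "(0,v',0,0)"]
    by (simp add: f g)
  define A where "A = (\<chi> i j. f (axis j 1) $ i)"
  have fA: "f v = A *v v" for v
  proof -
    have "v = v$1 *s axis 1 1 + v$2 *s axis 2 1 + v$3 *s axis 3 1"
      by (simp add: vec_eq_iff forall_3 axis_def)
    then have "f v = v$1 *s f (axis 1 1) + v$2 *s f (axis 2 1) + v$3 *s f (axis 3 1)"
      by (metis fadd fsc)
    then show ?thesis by (simp add: A_def vec3_simps mult.commute)
  qed
  have gA: "g w = - (transpose A *v w)" for w
  proof -
    have "axis i (1::'k) $ j = (if i = j then 1 else 0)" for i j :: 3 by (simp add: axis_def)
    then have "(\<Sum>j\<in>UNIV. f (axis i 1) $ j * w $ j) + g w $ i = 0" for i
      using dual[of "axis i 1" w] exhaust_3[of i] by (auto simp: dot3_def sum_3)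
    then have "g w $ i = - (\<Sum>j\<in>UNIV. f (axis i 1) $ j * w $ j)" for i
      by (simp only: add_eq_0_iff)
    then show ?thesis by (simp add: A_def vec3_simps)
  qed
  \<comment> \<open>The third coordinate of the image of e_1 x e_2 = e_3 is the trace
    condition.\<close>
  have "vcross (axis 1 1) (axis 2 1) = (axis 3 1 :: 'k^3)"
    by (simp add: vcross_def axis_def vec_eq_iff forall_3)
  then have "g (axis 3 1) $ 3 = (vcross (f (axis 1 1)) (axis 2 1) + vcross (axis 1 1) (f (axis 2 1))) $ 3"
    using cross[of "axis 1 1" "axis 2 1"] by simp
  then have "- A$3$3 = A$1$1 + A$2$2"
    by (simp add: gA fA vcross_def axis_def sum_3 matrix_vector_mult_def transpose_def)
  then have "trace A = 0" by (simp add: trace_def sum_3) (metis add.right_inverse add.inverse_inverse add.commute)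
  moreover have "E x = sl3_der A x" for x
  proof -
    obtain a v w b where x: "x = (a, v, w, b)" by (metis prod_cases4)
    have "x = (a, 0, 0, b) + (0, v, 0, 0) + (0, 0, w, 0)" by (simp add: x)
    then have "E x = E (a, 0, 0, b) + E (0, v, 0, 0) + E (0, 0, w, 0)" by (simp only: add)
    then show ?thesis by (simp add: diag f g fA gA x sl3_der_def zero_prod_def)
  qed
  ultimately show ?thesis by blast
qed

lemma no_nondegenerate_form_char_3:
  assumes nf: "nondegenerate_invariant_form (bil :: ('k::field oct \<Rightarrow> 'k oct) \<Rightarrow> ('k oct \<Rightarrow> 'k oct) \<Rightarrow> 'k)"
  shows "(3::'k) \<noteq> 0"
proof
  assume three: "(3::'k) = 0"
  have two: "(2::'k) \<noteq> 0" 
  proof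
    assume "(2::'k) = 0"
    with three have "(3::'k) - 2 = 0" by simp
    then show False by simp
  qed
  define Z where "Z = sl3_der (mat 1 :: 'k^3^3)"
  have bil_add: "bil (\<lambda>x. D x + E x) D' = bil D D' + bil E D'"
    if "D \<in> g2_lie" "E \<in> g2_lie" "D' \<in> g2_lie" for D E D'
    using nf that unfolding nondegenerate_invariant_form_def by blast
  have bil_sym: "bil D E = bil E D" if "D \<in> g2_lie" "E \<in> g2_lie" for D E
    using nf that unfolding nondegenerate_invariant_form_def by blast
  have bil_inv: "bil (lie_bracket D E) D' = bil D (lie_bracket E D')"
    if "D \<in> g2_lie" "E \<in> g2_lie" "D' \<in> g2_lie" for D E D'
    using nf that unfolding nondegenerate_invariant_form_def by blast
  have Z: "Z \<in> g2_lie"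
    unfolding Z_def by (rule sl3_der_derivation) (use three in \<open>simp add: trace_def mat_def\<close>)
  have zero: "(\<lambda>_. 0) \<in> (g2_lie :: ('k oct \<Rightarrow> 'k oct) set)"
  proof -
    have "sl3_der (0::'k^3^3) = (\<lambda>_. 0)"
      by (auto simp: sl3_der_def fun_eq_iff vec3_simps zero_prod_def)
    with sl3_der_derivation[of "0::'k^3^3"] show ?thesis by (simp add: trace_def)
  qed
  have bil_0: "bil (\<lambda>_. 0) E = 0" if "E \<in> g2_lie" for E
    using bil_add[OF zero zero that] by (metis add_cancel_right_right add_0)
  \<comment> \<open>Invariance moves the bracket over: the form of Z with [M, Y] is that of [Z, M]
    with Y.\<close>
  have bracket0: "bil Z (lie_bracket M Y) = 0"
    if "M \<in> g2_lie" "Y \<in> g2_lie" "\<And>x. Z (M x) = M (Z x)" for M Y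
  proof -
    have "lie_bracket Z M = (\<lambda>_. 0)" using that(3) by (simp add: lie_bracket_def)
    then show ?thesis using bil_inv[OF Z that(1,2)] bil_0[OF that(2)] by simp
  qed
  have add_r: "bil Z (\<lambda>x. D x + E x) = bil Z D + bil Z E"
    if "D \<in> g2_lie" "E \<in> g2_lie" "(\<lambda>x. D x + E x) \<in> g2_lie" for D E
    using bil_add[OF that(1,2) Z] bil_sym that Z by simp
  have sl3: "bil Z (sl3_der A) = 0" if A: "trace A = 0" for A
  proof -
    obtain M D M' Y where tr: "trace M = 0" "trace D = 0" "trace M' = 0" "trace Y = 0"
      and A_eq: "A = (D ** M - M ** D) + (M' ** Y - Y ** M')"
      using traceless_char_3_commutators[OF three A] by blast
    have comm: "Z (sl3_der B x) = sl3_der B (Z x)" for B x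
      by (cases x) (simp add: Z_def sl3_der_def vec3_simps)
    have eq: "sl3_der A = (\<lambda>x. lie_bracket (sl3_der D) (sl3_der M) x + lie_bracket (sl3_der M') (sl3_der Y) x)"
      unfolding lie_bracket_sl3_der A_eq sl3_der_add ..
    note in_g2 = tr[THEN sl3_der_derivation]
    have "bil Z (lie_bracket (sl3_der D) (sl3_der M)) = 0"
      "bil Z (lie_bracket (sl3_der M') (sl3_der Y)) = 0"
      by (intro bracket0 in_g2 comm)+
    then show ?thesis
      using sl3_der_derivation[OF A] unfolding eq
      by (subst add_r) (auto intro!: lie_bracket_in_g2_lie in_g2)
  qed
  have "bil Z E = 0" if E: "E \<in> g2_lie" for E
  proof -
    \<comment> \<open>Since Z^3 = Z, in characteristic 3 the operator ad Z also equals its cube. So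
      (ad Z)^2 projects onto the part of nonzero weight, and the difference \<open>E0\<close> is the
      part commuting with Z.\<close>
    let ?E2 = "lie_bracket Z (lie_bracket Z E)"
    have E2: "?E2 \<in> g2_lie" by (intro lie_bracket_in_g2_lie Z E)
    define E0 where "E0 = (\<lambda>x. E x - ?E2 x)"
    note Zadd = g2_lieD(1)[OF Z] and Zdiff = g2_lieD(4)[OF Z] and Ediff = g2_lieD(4)[OF E]
    have Z3: "Z (Z (Z x)) = Z x" for x
      by (cases x) (simp add: Z_def sl3_der_def vec3_simps)
    have tripled: "x + x + x = 0" for x :: "'k oct"
    proof -
      have "y + y + y = 0" for y :: 'k
        using arg_cong[OF three, of "\<lambda>c. c * y"] by (simp add: algebra_simps)
      then show ?thesis by (cases x) (simp add: zero_prod_def vec_eq_iff)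
    qed
    have neg2: "- x - x = x" for x :: "'k oct"
    proof -
      have "x = (x + x + x) + (- x - x)" by simp
      then show ?thesis unfolding tripled by simp
    qed
    \<comment> \<open>Because -2 = 1, the square of ad Z becomes the symmetric sum of all Z^i E Z^j
      with i + j = 2, whose commutator with Z telescopes to [Z^3, E].\<close>
    have E2_eq: "?E2 x = Z (Z (E x)) + Z (E (Z x)) + E (Z (Z x))" for x
    proof -
      have "?E2 x = Z (Z (E x)) + (- Z (E (Z x)) - Z (E (Z x))) + E (Z (Z x))"
        by (simp add: lie_bracket_def Zdiff Ediff)
      then show ?thesis by (simp only: neg2)
    qed
    have E0_comm: "Z (E0 x) = E0 (Z x)" for x
      unfolding E0_def E2_eq Zdiff Zadd Z3 by (simp add: algebra_simps)
    have E0: "E0 \<in> g2_lie" unfolding E0_def by (rule g2_lie_diff[OF E E2])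
    obtain A where "trace A = 0" "E0 = sl3_der A"
      using commuting_derivation_char_3[OF two E0] E0_comm unfolding Z_def by metis
    then have "bil Z E0 = 0" using sl3 by simp
    moreover have "E = (\<lambda>x. E0 x + ?E2 x)" by (simp add: E0_def)
    then have "bil Z E = bil Z E0 + bil Z ?E2" using add_r[OF E0 E2] E by simp
    moreover have "bil Z ?E2 = 0"
      using bracket0[OF Z lie_bracket_in_g2_lie[OF Z E]] by simp
    ultimately show ?thesis by simp
  qed
  then have "Z = (\<lambda>_. 0)"
    using nf Z unfolding nondegenerate_invariant_form_def by blast
  from fun_cong[OF this, of "(0, 1, 0, 0)"] show False
    by (simp add: Z_def sl3_der_def zero_prod_def)
qed

section \<open>The apartment\<close>

lemma g2_root_cases:
  "c \<in> g2_roots \<longleftrightarrow> c = (1,0) \<or> c = (0,1) \<or> c = (1,1) \<or> c = (1,2) \<or> c = (1,3) \<or> c = (2,3) \<or>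
    c = (-1,0) \<or> c = (0,-1) \<or> c = (-1,-1) \<or> c = (-1,-2) \<or> c = (-1,-3) \<or> c = (-2,-3)"
  by (auto simp: g2_roots_def)

lemma real_aff_roots_iff: "(c1, c2, n) \<in> real_aff_roots \<longleftrightarrow> (c1, c2) \<in> g2_roots"
  by (simp add: real_aff_roots_def)

lemma aff_roots_vanishing_at_x_P:
  "{\<alpha> \<in> real_aff_roots. aff_val \<alpha> x_P = 0} = {(0,1,0), (0,-1,0), (2,3,-1), (-2,-3,1)}"
proof -
  have "aff_val (c1, c2, n) x_P = of_int (c1 + 2 * n) / 2" for c1 c2 n
    by (simp add: x_P_eq)
  then have "aff_val (c1, c2, n) x_P = 0 \<longleftrightarrow> c1 + 2 * n = 0" for c1 c2 n
    by (simp only: divide_eq_0_iff of_int_eq_0_iff) simp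
  moreover have "(c1, c2) \<in> g2_roots \<and> c1 + 2 * n = 0 \<longleftrightarrow>
      (c1, c2, n) \<in> {(0,1,0), (0,-1,0), (2,3,-1), (-2,-3,1)}" for c1 c2 n
  proof
    assume "(c1, c2) \<in> g2_roots \<and> c1 + 2 * n = 0"
    then have "(c1, c2) \<in> g2_roots" "c1 + 2 * n = 0" by auto
    then show "(c1, c2, n) \<in> {(0,1,0), (0,-1,0), (2,3,-1), (-2,-3,1)}"
      unfolding g2_root_cases by (elim disjE; simp; presburger)
  qed (auto simp: g2_root_cases)
  ultimately show ?thesis by (simp add: set_eq_iff split_paired_all real_aff_roots_iff)
qed

lemma para_roots_eq:
  "para_roots (z1, z2) =
     (if z2 \<le> 0 then {short_root} else {}) \<union> (if 0 \<le> z2 then {- short_root} else {}) \<union>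
     (if 2 * z1 + 3 * z2 \<le> 1 then {highest_root} else {}) \<union>
     (if 1 \<le> 2 * z1 + 3 * z2 then {- highest_root} else {})"
proof -
  have "{\<alpha> \<in> real_aff_roots. aff_val \<alpha> x_P = 0 \<and> aff_val \<alpha> z \<le> 0} =
      {\<alpha> \<in> {(0,1,0), (0,-1,0), (2,3,-1), (-2,-3,1)}. aff_val \<alpha> z \<le> 0}" for z
    unfolding aff_roots_vanishing_at_x_P[symmetric] by blast
  then have "c \<in> para_roots z \<longleftrightarrow>
      (\<exists>\<alpha>\<in>{(0,1,0), (0,-1,0), (2,3,-1), (-2,-3,1)}. aff_val \<alpha> z \<le> 0 \<and> c = gradient \<alpha>)" for c z
    unfolding para_roots_def by (auto simp only: image_iff mem_Collect_eq)
  then show ?thesis by (simp add: set_eq_iff)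
qed

lemma para_roots_iff:
  "short_root \<in> para_roots z \<longleftrightarrow> snd z \<le> 0"
  "- short_root \<in> para_roots z \<longleftrightarrow> 0 \<le> snd z"
  "highest_root \<in> para_roots z \<longleftrightarrow> 2 * fst z + 3 * snd z \<le> 1"
  "- highest_root \<in> para_roots z \<longleftrightarrow> 1 \<le> 2 * fst z + 3 * snd z"
  by (cases z; simp add: para_roots_eq)+

section \<open>Edges issuing from \<open>x_P\<close> and the barycenter of the facet of Q_0\<close>

lemma sgn_add_of_int:
  fixes x :: real
  shows "0 < x \<Longrightarrow> x < 1 \<Longrightarrow> sgn (x + of_int n) = (if n \<ge> 0 then 1 else -1)"
    "-1 < x \<Longrightarrow> x < 0 \<Longrightarrow> sgn (x + of_int n) = (if n \<ge> 1 then 1 else -1)"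
  by (auto simp: sgn_if not_le int_one_le_iff_zero_less[symmetric] dest!: zless_imp_add1_zle)

text \<open>These are the two open edges at \<open>x_P\<close> on the wall \<eta> = 1. On each of
  them every root is constant or stays strictly between 0 and 1, or between -1 and 0, so no integral
  translate of it changes sign.\<close>

lemma sgn_aff_val_segment:
  assumes "\<alpha> \<in> real_aff_roots" "0 < u" "u < 1" "0 < v" "v < 1"
  shows "sgn (aff_val \<alpha> ((1 - u) / 2, u / 3)) = sgn (aff_val \<alpha> ((1 - v) / 2, v / 3))"
    and "sgn (aff_val \<alpha> ((1 + u) / 2, - u / 3)) = sgn (aff_val \<alpha> ((1 + v) / 2, - v / 3))"
proof -
  obtain c1 c2 n where \<alpha>: "\<alpha> = (c1, c2, n)" by (metis prod_cases3)
  define f where "f u = of_int c1 * ((1 - u) / 2) + of_int c2 * (u / 3)" for u :: real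
  define g where "g u = of_int c1 * ((1 + u) / 2) + of_int c2 * (- u / 3)" for u :: real
  have c: "(c1, c2) \<in> g2_roots" using assms(1) by (simp add: \<alpha> real_aff_roots_iff)
  have "f u = f v \<or> (0 < f u \<and> f u < 1 \<and> 0 < f v \<and> f v < 1) \<or> (-1 < f u \<and> f u < 0 \<and> -1 < f v \<and> f v < 0)"
    using c assms(2-) unfolding g2_root_cases f_def by (elim disjE) (simp_all add: field_simps)
  then have "sgn (f u + of_int n) = sgn (f v + of_int n)"
    by (auto simp: sgn_add_of_int)
  then show "sgn (aff_val \<alpha> ((1 - u) / 2, u / 3)) = sgn (aff_val \<alpha> ((1 - v) / 2, v / 3))"
    by (simp add: \<alpha> f_def)
  have "g u = g v \<or> (0 < g u \<and> g u < 1 \<and> 0 < g v \<and> g v < 1) \<or> (-1 < g u \<and> g u < 0 \<and> -1 < g v \<and> g v < 0)"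
    using c assms(2-) unfolding g2_root_cases g_def by (elim disjE) (simp_all add: field_simps)
  then have "sgn (g u + of_int n) = sgn (g v + of_int n)"
    by (auto simp: sgn_add_of_int)
  then show "sgn (aff_val \<alpha> ((1 + u) / 2, - u / 3)) = sgn (aff_val \<alpha> ((1 + v) / 2, - v / 3))"
    by (simp add: \<alpha> g_def)
qed

lemma barycenter_open_segment:
  fixes a b :: apt
  assumes "a \<noteq> b"
  shows "barycenter (open_segment a b) = (1 / 2) *\<^sub>R (a + b)"
proof -
  have "{v. v extreme_point_of closure (open_segment a b)} = {a, b}"
    using assms by (auto simp: extreme_point_of_segment)
  then show ?thesis using assms by (simp add: barycenter_def)
qed

text \<open>Having both \<eta> and -\<eta> puts the facet on the wall \<eta> = 1; missing one short
  root keeps it off \<alpha>_2 = 0. The closure condition then leaves the two edges ending at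
  \<open>x_P\<close>, and the values are their midpoints.\<close>

lemma barycenter_facet_Q:
  assumes "is_facet_Q F"
  shows "barycenter F = (1/4, 1/6) \<or> barycenter F = (3/4, -1/6)"
proof -
  obtain x where F: "F = {y. \<forall>\<alpha>\<in>real_aff_roots. sgn (aff_val \<alpha> y) = sgn (aff_val \<alpha> x)}"
    using assms unfolding is_facet_Q_def is_facet_def by auto
  have cl: "x_P \<in> closure F" using assms by (simp add: is_facet_Q_def)
  obtain x1 x2 where x: "x = (x1, x2)" by fastforce
  have "x \<in> F" by (simp add: F)
  then have "para_roots x = {highest_root, - highest_root, short_root} \<or>
      para_roots x = {highest_root, - highest_root, - short_root}"
    using assms unfolding is_facet_Q_def by auto
  then have "highest_root \<in> para_roots x" "- highest_root \<in> para_roots x"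
    "short_root \<notin> para_roots x \<or> - short_root \<notin> para_roots x" by auto
  then have on_wall: "2 * x1 + 3 * x2 = 1" and off: "x2 \<noteq> 0"
    unfolding x para_roots_iff by auto
  have signs: "sgn (aff_val (c1, c2, n) (y1, y2)) = sgn (aff_val (c1, c2, n) (x1, x2))"
    if "(y1, y2) \<in> F" "(c1, c2) \<in> g2_roots" for y1 y2 c1 c2 n
    using that(1) real_aff_roots_iff[THEN iffD2, OF that(2), of n] unfolding F mem_Collect_eq x by (rule bspec)
  have sgns: "sgn y1 = sgn x1" "sgn y2 = sgn x2" "sgn (y1 + 3 * y2) = sgn (x1 + 3 * x2)" "2 * y1 + 3 * y2 = 1"
    if "(y1, y2) \<in> F" for y1 y2
    using signs[OF that, of 1 0 0] signs[OF that, of 0 1 0] signs[OF that, of 1 3 0]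
      signs[OF that, of 2 3 "-1"] on_wall
    by (simp_all add: g2_roots_def sgn_0_0)
  show ?thesis
  proof (cases "x2 > 0")
    case True
    \<comment> \<open>If \<alpha>_1 were nonpositive on F, so it would be on the closure, but it is
      1/2 at \<open>x_P\<close>.\<close>
    have "x1 > 0"
    proof (rule ccontr)
      assume "\<not> x1 > 0"
      then have "sgn x1 \<noteq> 1" by (simp add: sgn_1_pos)
      then have "\<not> fst y > 0" if "y \<in> F" for y
        using sgns(1)[of "fst y" "snd y"] that by (auto simp: sgn_1_pos)
      then have "F \<subseteq> {y. fst y \<le> 0}" by (auto simp: not_less)
      moreover have "closed {y :: apt. fst y \<le> 0}" by (intro closed_Collect_le continuous_intros)
      ultimately show False using cl closure_minimal[of F "{y. fst y \<le> 0}"] by (auto simp: x_P_eq)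
    qed
    have "F = open_segment (1/2, 0) (0, 1/3)"
    proof (intro equalityI subsetI)
      fix y assume y: "y \<in> F"
      obtain y1 y2 where y_eq: "y = (y1, y2)" by fastforce
      have "sgn y1 = 1" "sgn y2 = 1"
        using sgns[of y1 y2] y True \<open>x1 > 0\<close> by (auto simp: y_eq)
      then have "0 < y1" "0 < y2" by (simp_all add: sgn_1_pos)
      then show "y \<in> open_segment (1/2, 0) (0, 1/3)"
        using sgns(4)[of y1 y2] y unfolding y_eq in_segment by (intro conjI exI[of _ "3 * y2"]) auto
    next
      fix y :: apt assume "y \<in> open_segment (1/2, 0) (0, 1/3)"
      then obtain u where u: "0 < u" "u < 1" "y = ((1 - u) / 2, u / 3)" unfolding in_segment by auto
      have x': "x = ((1 - 3 * x2) / 2, 3 * x2 / 3)" "0 < 3 * x2" "3 * x2 < 1"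
        using on_wall True \<open>x1 > 0\<close> by (auto simp: x)
      show "y \<in> F" unfolding F u(3) x'(1) mem_Collect_eq
        by (intro ballI sgn_aff_val_segment(1) u(1,2) x'(2,3))
    qed
    then show ?thesis by (simp add: barycenter_open_segment)
  next
    case False
    with off have neg: "x2 < 0" by simp
    \<comment> \<open>The far end of this edge is cut out by \<alpha>_1 + 3 \<alpha>_2, the image of
      \<alpha>_1 under the reflection in \<alpha>_2.\<close>
    have "x1 + 3 * x2 > 0"
    proof (rule ccontr)
      assume "\<not> x1 + 3 * x2 > 0"
      then have "sgn (x1 + 3 * x2) \<noteq> 1" by (simp add: sgn_1_pos)
      then have "\<not> fst y + 3 * snd y > 0" if "y \<in> F" for y
        using sgns(3)[of "fst y" "snd y"] that by (auto simp: sgn_1_pos)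
      then have "F \<subseteq> {y. fst y + 3 * snd y \<le> 0}" by (auto simp: not_less)
      moreover have "closed {y :: apt. fst y + 3 * snd y \<le> 0}" by (intro closed_Collect_le continuous_intros)
      ultimately show False using cl closure_minimal[of F "{y. fst y + 3 * snd y \<le> 0}"] by (auto simp: x_P_eq)
    qed
    have "F = open_segment (1/2, 0) (1, - 1/3)"
    proof (intro equalityI subsetI)
      fix y assume y: "y \<in> F"
      obtain y1 y2 where y_eq: "y = (y1, y2)" by fastforce
      have "sgn (y1 + 3 * y2) = 1" "sgn y2 = -1"
        using sgns[of y1 y2] y neg \<open>x1 + 3 * x2 > 0\<close> by (auto simp: y_eq)
      then have "0 < y1 + 3 * y2" "y2 < 0" by (simp_all add: sgn_1_pos sgn_1_neg)
      then show "y \<in> open_segment (1/2, 0) (1, - 1/3)"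
        using sgns(4)[of y1 y2] y unfolding y_eq in_segment by (intro conjI exI[of _ "- 3 * y2"]) auto
    next
      fix y :: apt assume "y \<in> open_segment (1/2, 0) (1, - 1/3)"
      then obtain u where u: "0 < u" "u < 1" "y = (1 - u) *\<^sub>R (1/2, 0) + u *\<^sub>R (1, - 1/3)"
        unfolding in_segment by blast
      then have u': "y = ((1 + u) / 2, - u / 3)" by (simp add: field_simps)
      have x': "x = ((1 + (- 3 * x2)) / 2, - (- 3 * x2) / 3)" "0 < - 3 * x2" "- 3 * x2 < 1"
        using on_wall neg \<open>x1 + 3 * x2 > 0\<close> by (auto simp: x)
      show "y \<in> F" unfolding F u' x'(1) mem_Collect_eq
        by (intro ballI sgn_aff_val_segment(2) u(1,2) x'(2,3))
    qed
    then show ?thesis by (simp add: barycenter_open_segment)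
  qed
qed

section \<open>The extended affine Weyl group as integral affine maps\<close>

fun aff_map :: "int \<times> int \<times> int \<times> int \<Rightarrow> int \<Rightarrow> int \<Rightarrow> apt \<Rightarrow> apt" where
  "aff_map (m11, m12, m21, m22) a b (x1, x2) =
     (of_int m11 * x1 + of_int m12 * x2 + of_int a, of_int m21 * x1 + of_int m22 * x2 + of_int b)"

definition weyl_mats :: "(int \<times> int \<times> int \<times> int) set" where
  "weyl_mats = {(-2, -3, 1, 1), (-2, -3, 1, 2), (-1, -3, 0, 1), (-1, -3, 1, 2), (-1, 0, 0, -1),
     (-1, 0, 1, 1), (1, 0, -1, -1), (1, 0, 0, 1), (1, 3, -1, -2), (1, 3, 0, -1), (2, 3, -1, -2),
     (2, 3, -1, -1)}"

fun mat_prod :: "int \<times> int \<times> int \<times> int \<Rightarrow> int \<times> int \<times> int \<times> int \<Rightarrow> int \<times> int \<times> int \<times> int" where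
  "mat_prod (a, b, c, d) (p, q, r, s) = (a * p + b * r, a * q + b * s, c * p + d * r, c * q + d * s)"

text \<open>The six matrices are the reflections. As \<open>refl_group\<close> grows by composition
  on the left, stability under left multiplication confines the Weyl group to the list.\<close>

lemma weyl_mats_refl:
  assumes "N \<in> {(-1, 0, 1, 1), (1, 3, 0, -1), (-2, -3, 1, 2), (1, 0, -1, -1), (2, 3, -1, -2), (-1, -3, 0, 1)}"
  shows "mat_prod N ` weyl_mats \<subseteq> weyl_mats"
proof -
  have "mat_prod (-1, 0, 1, 1) ` weyl_mats \<subseteq> weyl_mats" "mat_prod (1, 3, 0, -1) ` weyl_mats \<subseteq> weyl_mats"
    "mat_prod (-2, -3, 1, 2) ` weyl_mats \<subseteq> weyl_mats" "mat_prod (1, 0, -1, -1) ` weyl_mats \<subseteq> weyl_mats"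
    "mat_prod (2, 3, -1, -2) ` weyl_mats \<subseteq> weyl_mats" "mat_prod (-1, -3, 0, 1) ` weyl_mats \<subseteq> weyl_mats"
    unfolding weyl_mats_def image_insert image_empty mat_prod.simps by simp_all
  with assms show ?thesis unfolding insert_iff empty_iff by (elim disjE FalseE) (simp_all only:)
qed

lemma weyl_aff_map:
  assumes "w \<in> weyl"
  shows "\<exists>M\<in>weyl_mats. w = aff_map M 0 0"
proof -
  have "w \<in> refl_group {(c1, c2, 0) | c1 c2. (c1, c2) \<in> g2_roots} \<Longrightarrow> ?thesis"
  proof (induction rule: refl_group.induct)
    case 1
    have "id = aff_map (1, 0, 0, 1) 0 0" by (auto simp: fun_eq_iff)
    then show ?case by (auto simp: weyl_mats_def)
  next
    case (2 \<alpha> w)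
    then obtain M where M: "M \<in> weyl_mats" "w = aff_map M 0 0" by blast
    from 2(1) obtain c1 c2 where \<alpha>: "\<alpha> = (c1, c2, 0)" and c: "(c1, c2) \<in> g2_roots" by blast
    have *: "reflection (1,0,0) = aff_map (-1, 0, 1, 1) 0 0" "reflection (-1,0,0) = aff_map (-1, 0, 1, 1) 0 0"
      "reflection (0,1,0) = aff_map (1, 3, 0, -1) 0 0" "reflection (0,-1,0) = aff_map (1, 3, 0, -1) 0 0"
      "reflection (1,1,0) = aff_map (-2, -3, 1, 2) 0 0" "reflection (-1,-1,0) = aff_map (-2, -3, 1, 2) 0 0"
      "reflection (1,2,0) = aff_map (1, 0, -1, -1) 0 0" "reflection (-1,-2,0) = aff_map (1, 0, -1, -1) 0 0"
      "reflection (1,3,0) = aff_map (2, 3, -1, -2) 0 0" "reflection (-1,-3,0) = aff_map (2, 3, -1, -2) 0 0"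
      "reflection (2,3,0) = aff_map (-1, -3, 0, 1) 0 0" "reflection (-2,-3,0) = aff_map (-1, -3, 0, 1) 0 0"
      by (auto simp: fun_eq_iff reflection_def coroot_def algebra_simps)
    have "\<exists>N\<in>{(-1, 0, 1, 1), (1, 3, 0, -1), (-2, -3, 1, 2), (1, 0, -1, -1), (2, 3, -1, -2), (-1, -3, 0, 1)}.
        reflection \<alpha> = aff_map N 0 0"
      using c unfolding g2_root_cases \<alpha> prod.inject
      by (elim disjE conjE; hypsubst) (unfold *, blast+)
    then obtain N where N: "reflection \<alpha> = aff_map N 0 0"
      "N \<in> {(-1, 0, 1, 1), (1, 3, 0, -1), (-2, -3, 1, 2), (1, 0, -1, -1), (2, 3, -1, -2), (-1, -3, 0, 1)}"
      by blast
    have "aff_map N 0 0 \<circ> aff_map M 0 0 = aff_map (mat_prod N M) 0 0"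
      by (cases N; cases M) (auto simp: fun_eq_iff algebra_simps)
    moreover have "mat_prod N M \<in> weyl_mats"
      using weyl_mats_refl N(2) M(1) by blast
    ultimately show ?case using N(1) M(2) by metis
  qed
  then show ?thesis using assms by (simp add: weyl_def)
qed

lemma ext_aff_weyl_aff_map:
  assumes "w \<in> ext_aff_weyl"
  shows "\<exists>M\<in>weyl_mats. \<exists>a b. w = aff_map M a b"
proof -
  obtain w' a b where w: "w = (\<lambda>x. w' x + (of_int a, of_int b))" "w' \<in> weyl"
    using assms unfolding ext_aff_weyl_def by blast
  obtain M where M: "M \<in> weyl_mats" "w' = aff_map M 0 0" using weyl_aff_map[OF w(2)] by blast
  have "w = aff_map M a b" unfolding w(1) M(2) by (cases M) (auto simp: fun_eq_iff)
  with M(1) show ?thesis by blast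
qed

lemma id_in_ext_aff_weyl: "id \<in> ext_aff_weyl"
  unfolding ext_aff_weyl_def weyl_def mem_Collect_eq
  by (rule exI[of _ id], rule exI[of _ 0], rule exI[of _ 0])
     (auto simp: refl_group.intros fun_eq_iff zero_prod_def)

lemma Omega_eq: "Omega = {id}"
proof -
  have "w = id" if w: "w \<in> ext_aff_weyl" "w ` alcove = alcove" for w
  proof -
    obtain M a b where M: "M \<in> weyl_mats" "w = aff_map M a b"
      using ext_aff_weyl_aff_map[OF w(1)] by blast
    \<comment> \<open>A point of the alcove close to the special vertex: row sums of the matrices
      are at most 5 in absolute value, too small against 100 to compensate a translation. Then only
      the identity matrix keeps both simple roots positive.\<close>
    have "(1/100, 1/100) \<in> alcove" by (simp add: alcove_def simple_aff_roots_def)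
    with w(2) have "aff_map M a b (1/100, 1/100) \<in> alcove" unfolding M(2) by blast
    moreover obtain m11 m12 m21 m22 where m: "M = (m11, m12, m21, m22)" by (metis prod_cases4)
    ultimately have "0 < real_of_int (m11 + m12 + 100 * a)" "0 < real_of_int (m21 + m22 + 100 * b)"
      "real_of_int (2 * (m11 + m12) + 3 * (m21 + m22) + 200 * a + 300 * b) < real_of_int 100"
      by (simp_all add: alcove_def simple_aff_roots_def)
    then have pos: "0 < m11 + m12 + 100 * a" "0 < m21 + m22 + 100 * b"
      "2 * (m11 + m12) + 3 * (m21 + m22) + 200 * a + 300 * b < 100"
      by (simp_all only: of_int_0_less_iff of_int_less_iff)
    have sums: "- 5 \<le> m11 + m12" "m11 + m12 \<le> 5" "- 3 \<le> m21 + m22" "m21 + m22 \<le> 3"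
      using M(1) unfolding m weyl_mats_def insert_iff empty_iff prod.inject
      by (elim disjE FalseE conjE; simp)+
    have "0 \<le> a" using pos(1) sums(2) by linarith
    moreover have "0 \<le> b" using pos(2) sums(4) by linarith
    moreover have "200 * a + 300 * b < 200" using pos(3) sums(1,3) by (simp add: distrib_left)
    ultimately have 0: "a = 0" "b = 0" by linarith+
    have "M = (1, 0, 0, 1)"
      using M(1) pos(1,2) unfolding 0 m weyl_mats_def insert_iff empty_iff prod.inject
      by (elim disjE FalseE conjE; simp)
    then have "M = (1, 0, 0, 1) \<and> a = 0 \<and> b = 0" using 0 by simp
    then show ?thesis by (auto simp: M fun_eq_iff)
  qed
  then show ?thesis unfolding Omega_def using id_in_ext_aff_weyl by auto
qed

text \<open>In the coordinates (t, r) these are the four sign changes, generated by the reflections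
  in \<alpha>_2 and \<eta> - 1.\<close>

lemma weyl_at_x_P:
  "id \<in> weyl_at x_P" "aff_map (1, 3, 0, -1) 0 0 \<in> weyl_at x_P"
  "aff_map (-1, -3, 0, 1) 1 0 \<in> weyl_at x_P" "aff_map (-1, 0, 0, -1) 1 0 \<in> weyl_at x_P"
proof -
  have r: "reflection (0,1,0) = aff_map (1, 3, 0, -1) 0 0" "reflection (2,3,-1) = aff_map (-1, -3, 0, 1) 1 0"
    by (auto simp: fun_eq_iff reflection_def coroot_def algebra_simps)
  have refl: "reflection \<alpha> \<circ> w \<in> weyl_at x_P" if "\<alpha> \<in> {(0,1,0), (2,3,-1)}" "w \<in> weyl_at x_P" for \<alpha> w
    using that unfolding weyl_at_def aff_roots_vanishing_at_x_P by (auto intro: refl_group.intros)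
  show id: "id \<in> weyl_at x_P" unfolding weyl_at_def by (rule refl_group.intros)
  show 1: "aff_map (1, 3, 0, -1) 0 0 \<in> weyl_at x_P" using refl[OF _ id, of "(0,1,0)"] by (simp add: r)
  show "aff_map (-1, -3, 0, 1) 1 0 \<in> weyl_at x_P" using refl[OF _ id, of "(2,3,-1)"] by (simp add: r)
  have "aff_map (-1, -3, 0, 1) 1 0 \<circ> aff_map (1, 3, 0, -1) 0 0 = aff_map (-1, 0, 0, -1) 1 0"
    by (auto simp: fun_eq_iff)
  then show "aff_map (-1, 0, 0, -1) 1 0 \<in> weyl_at x_P" using refl[OF _ 1, of "(2,3,-1)"] by (simp add: r)
qed

text \<open>The first alternative makes both outer coefficients of the cubic vanish, the second an
  outer and an inner one. Excluding the stabilizer of \<open>x_P\<close> removes the positions with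
  |t| = 1/6 and r = 0, where both alternatives fail.\<close>

lemma translate_position:
  assumes "w \<in> ext_aff_weyl" "w \<notin> weyl_at x_P" "x = (1/4, 1/6) \<or> x = (3/4, -1/6)"
  obtains t r where "w x = ((1 + r - 3 * t) / 2, t)" "t \<noteq> 0"
    "3 * \<bar>t\<bar> - \<bar>r\<bar> \<ge> 1 \<or> (r \<noteq> 0 \<and> 3 * \<bar>t\<bar> + \<bar>r\<bar> \<ge> 1 \<and> \<bar>t\<bar> + \<bar>r\<bar> \<ge> 1)"
proof -
  obtain M a b where M: "M \<in> weyl_mats" "w = aff_map M a b"
    using ext_aff_weyl_aff_map[OF assms(1)] by blast
  obtain m11 m12 m21 m22 where m: "M = (m11, m12, m21, m22)" by (metis prod_cases4)
  have excl: "(M, a, b) \<noteq> ((1, 0, 0, 1), 0, 0)" "(M, a, b) \<noteq> ((1, 3, 0, -1), 0, 0)"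
    "(M, a, b) \<noteq> ((-1, -3, 0, 1), 1, 0)" "(M, a, b) \<noteq> ((-1, 0, 0, -1), 1, 0)"
  proof -
    have "aff_map (1, 0, 0, 1) 0 0 = id" by (auto simp: fun_eq_iff)
    then show "(M, a, b) \<noteq> ((1, 0, 0, 1), 0, 0)" "(M, a, b) \<noteq> ((1, 3, 0, -1), 0, 0)"
      "(M, a, b) \<noteq> ((-1, -3, 0, 1), 1, 0)" "(M, a, b) \<noteq> ((-1, 0, 0, -1), 1, 0)"
      using assms(2) weyl_at_x_P M(2) by (metis prod.inject)+
  qed
  obtain e d where x: "x = (of_int e / 12, of_int d / 12)" and ed: "(e = 3 \<and> d = 2) \<or> (e = 9 \<and> d = - 2)"
    using assms(3) by (elim disjE) (force intro!: that[of 3 2], force intro!: that[of 9 "-2"])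
  \<comment> \<open>Twelve clears the denominators 4 and 6; \<open>T\<close> and \<open>R\<close>
    are 12 t and 12 r.\<close>
  define T where "T = m21 * e + m22 * d + 12 * b"
  define R where "R = 2 * (m11 * e + m12 * d + 12 * a) + 3 * T - 12"
  define c where "c = m11 * e + m12 * d"
  define c' where "c' = m21 * e + m22 * d"
  \<comment> \<open>Images of the barycenter under the linear parts. The pairs with a condition on
    the translation come from the linear parts of the four elements of
    \<open>weyl_at x_P\<close>.\<close>
  have pairs: "(c, c') \<in> {(-12, 5), (-12, 7), (-9, 7), (-3, 5), (3, -5), (9, -7), (12, -7), (12, -5)} \<or>
      (c, c') \<in> {(3, 2), (9, -2)} \<and> \<not> (a = 0 \<and> b = 0) \<or>
      (c, c') \<in> {(-9, 2), (-3, -2)} \<and> \<not> (a = 1 \<and> b = 0)"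
    using M(1) ed excl unfolding c_def c'_def m weyl_mats_def insert_iff empty_iff prod.inject
    by (elim disjE FalseE conjE; simp)
  then have bounds: "c' \<noteq> 0" "\<bar>c'\<bar> < 12" "\<bar>c\<bar> \<le> 12" by auto
  have T: "T = c' + 12 * b" and R: "R = 2 * c + 24 * a + 3 * T - 12"
    by (simp_all add: T_def R_def c_def c'_def)
  have "T \<noteq> 0" using bounds(1,2) unfolding T by presburger
  \<comment> \<open>The finite check: inside this box only a few translations remain, and all of
    them satisfy the first alternative.\<close>
  moreover have "3 * \<bar>T\<bar> - \<bar>R\<bar> \<ge> 12" if "\<bar>T\<bar> < 12" "\<bar>R\<bar> < 12"
  proof -
    have "- 24 < 12 * b" "12 * b < 24" using bounds(2) that(1) unfolding T by linarith+
    then have b: "b = -1 \<or> b = 0 \<or> b = 1" by linarith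
    have "- 96 < 24 * a" "24 * a < 96" using bounds(3) that unfolding R by linarith+
    then have a: "a = -3 \<or> a = -2 \<or> a = -1 \<or> a = 0 \<or> a = 1 \<or> a = 2 \<or> a = 3" by linarith
    show ?thesis
      using pairs a b that unfolding R T insert_iff empty_iff prod.inject
      by (elim disjE FalseE conjE; simp)
  qed
  ultimately have *: "T \<noteq> 0 \<and> (3 * \<bar>T\<bar> - \<bar>R\<bar> \<ge> 12 \<or> (R \<noteq> 0 \<and> 3 * \<bar>T\<bar> + \<bar>R\<bar> \<ge> 12 \<and> \<bar>T\<bar> + \<bar>R\<bar> \<ge> 12))"
    by linarith
  show ?thesis
  proof (rule that[of "of_int R / 12" "of_int T / 12"])
    show "w x = ((1 + of_int R / 12 - 3 * (of_int T / 12)) / 2, of_int T / 12)"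
      by (simp add: M(2) m x R_def T_def field_simps)
  next
    show "(of_int T / 12 :: real) \<noteq> 0" using * by simp
  next
    from * have "3 * \<bar>real_of_int T\<bar> - \<bar>real_of_int R\<bar> \<ge> 12 \<or>
        (R \<noteq> 0 \<and> 3 * \<bar>real_of_int T\<bar> + \<bar>real_of_int R\<bar> \<ge> 12 \<and> \<bar>real_of_int T\<bar> + \<bar>real_of_int R\<bar> \<ge> 12)"
      by linarith
    then show "3 * \<bar>of_int T / 12\<bar> - \<bar>of_int R / 12\<bar> \<ge> (1::real) \<or>
        (of_int R / 12 \<noteq> (0::real) \<and> 3 * \<bar>of_int T / 12\<bar> + \<bar>of_int R / 12\<bar> \<ge> (1::real) \<and>
         \<bar>of_int T / 12\<bar> + \<bar>of_int R / 12\<bar> \<ge> (1::real))"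
      by (simp add: abs_divide) linarith
  qed
qed

section \<open>Flags of the Levi quotient\<close>

lemma mat2_nth [simp]:
  "mat2 a b c d $ 1 $ 1 = a" "mat2 a b c d $ 1 $ 2 = b"
  "mat2 a b c d $ 2 $ 1 = c" "mat2 a b c d $ 2 $ 2 = d"
  by (simp_all add: mat2_def)

lemma mat2_eta: "g = mat2 (g$1$1) (g$1$2) (g$2$1) (g$2$2)"
  by (simp add: vec_eq_iff forall_2)

lemma mat2_mult:
  "mat2 a b c d ** mat2 a' b' c' d' =
     mat2 (a * a' + b * c') (a * b' + b * d') (c * a' + d * c') (c * b' + d * d')"
  by (simp add: vec_eq_iff forall_2 matrix_matrix_mult_def sum_2)

lemma mult_nth2: "(A ** B) $ i $ j = A$i$1 * B$1$j + A$i$2 * (B :: 'a::field mat2)$2$j"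
  by (simp add: matrix_matrix_mult_def sum_2)

lemma det_mat2 [simp]: "det (mat2 a b c d) = a * d - b * c"
  by (simp add: det_2)

lemma mat_1_mat2: "mat 1 = mat2 1 0 0 1"
  by (simp add: vec_eq_iff forall_2 mat_def)

lemma minus_mat2: "- mat2 a b c d = mat2 (- a) (- b) (- c) (- d)"
  by (simp add: vec_eq_iff forall_2)

lemma mat2_eq_iff: "mat2 a b c d = mat2 a' b' c' d' \<longleftrightarrow> a = a' \<and> b = b' \<and> c = c' \<and> d = d'"
  by (auto simp: vec_eq_iff forall_2)

definition adj2 :: "'a::field mat2 \<Rightarrow> 'a mat2" where
  "adj2 g = mat2 (g$2$2) (- g$1$2) (- g$2$1) (g$1$1)"

lemma adj2_mat2: "adj2 (mat2 a b c d) = mat2 d (- b) (- c) a"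
  by (simp add: adj2_def)

lemma adj2_mult: "det g = 1 \<Longrightarrow> adj2 g ** g = mat 1" "det g = 1 \<Longrightarrow> g ** adj2 g = mat 1"
  by (simp_all add: adj2_def vec_eq_iff forall_2 matrix_matrix_mult_def sum_2 mat_def det_2 algebra_simps)

lemma det_adj2 [simp]: "det (adj2 g) = det g"
  by (simp add: adj2_def det_2 mult.commute)

interpretation Levi: group Levi
  by (rule group_Levi)

lemma cls_in_Levi [intro]: "det g = 1 \<Longrightarrow> det h = 1 \<Longrightarrow> cls (g, h) \<in> carrier Levi"
  unfolding carrier_Levi by (auto simp: SL2sq_simps)

lemma Levi_cases:
  assumes "l \<in> carrier Levi"
  obtains g h where "l = cls (g, h)" "det g = 1" "det h = 1"
  using assms unfolding carrier_Levi SL2sq_simps by auto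

lemma cls_mult:
  assumes "det g = 1" "det h = 1" "det g' = 1" "det h' = 1"
  shows "cls (g, h) \<otimes>\<^bsub>Levi\<^esub> cls (g', h') = cls (g ** g', h ** h')"
  using normal.rcos_sum[OF mu2_normal, of "(g, h)" "(g', h')"] assms
  by (simp add: cls_def Levi_def SL2sq_simps FactGroup_def)

lemma cls_one: "\<one>\<^bsub>Levi\<^esub> = cls (mat 1, mat 1)"
proof -
  have "cls (mat 1, mat 1) \<otimes>\<^bsub>Levi\<^esub> cls (mat 1, mat 1) = cls (mat 1, mat 1)"
    by (simp add: cls_mult)
  then show ?thesis using cls_in_Levi[OF det_I det_I] by (metis Levi.l_cancel_one)
qed

lemma cls_inv:
  assumes "det g = 1" "det h = 1"
  shows "inv\<^bsub>Levi\<^esub> (cls (g, h)) = cls (adj2 g, adj2 h)"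
  using assms by (intro Levi.inv_equality) (auto simp: cls_mult cls_one adj2_mult)

lemma cls_uminus: "cls (- g) = cls g"
  by (simp add: cls_eq insert_commute)

lemma cls_eq_iff: "cls g = cls g' \<longleftrightarrow> g' = g \<or> g' = - g"
  using cls_eqI[of g' g] cls_uminus[of g] by (auto simp: cls_eq)

text \<open>Throughout, a Boolean \<open>e\<close> selects the lower (\<open>True\<close>) or upper triangular Borel subgroup of
  \<open>SL\<^sub>2\<close>; the corresponding flag of \<open>g\<close> is the line spanned by the column fixed up to scalars, the
  second one if \<open>e\<close> holds.\<close>

definition flag_col :: "bool \<Rightarrow> 'a::field mat2 \<Rightarrow> 'a \<times> 'a" where
  "flag_col e g = (if e then (g$1$2, g$2$2) else (g$1$1, g$2$1))"

definition wedge :: "'a::field \<times> 'a \<Rightarrow> 'a \<times> 'a \<Rightarrow> 'a" where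
  "wedge v w = fst v * snd w - snd v * fst w"

definition borel2 :: "bool \<Rightarrow> 'a::field mat2 set" where
  "borel2 e = {g. det g = 1 \<and> (if e then g$1$2 = 0 else g$2$1 = 0)}"

lemma mat_1_borel2: "mat 1 \<in> borel2 e"
  by (simp add: borel2_def det_I) (simp add: mat_def)

lemma borel2_det: "g \<in> borel2 e \<Longrightarrow> det g = 1"
  by (simp add: borel2_def)

lemma unipotent_borel2: "(if e then mat2 1 0 z 1 else mat2 1 z 0 1) \<in> borel2 e"
  by (simp add: borel2_def)

lemma diag_borel2: "a \<noteq> 0 \<Longrightarrow> mat2 a 0 0 (inverse a) \<in> borel2 e"
  by (simp add: borel2_def)

text \<open>The entry of the product that has to vanish is, up to sign, the wedge of the two flag
  columns; so cosets of the Borel subgroup correspond to lines.\<close>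

lemma adj2_mult_in_borel2:
  assumes "det g = 1" "det g' = 1"
  shows "adj2 g ** g' \<in> borel2 e \<longleftrightarrow> wedge (flag_col e g) (flag_col e g') = 0"
proof -
  have "det (adj2 g ** g') = 1" using assms by (simp add: det_mul)
  then show ?thesis
    by (cases e) (auto simp: borel2_def adj2_def wedge_def flag_col_def mult_nth2 algebra_simps)
qed

definition short_sign :: "bool \<Rightarrow> root" where
  "short_sign e = (if e then - short_root else short_root)"

definition long_sign :: "bool \<Rightarrow> root" where
  "long_sign e = (if e then - highest_root else highest_root)"

lemma root_subgroup_simps:
  "root_subgroup (short_sign e) = range (\<lambda>z. cls (if e then mat2 1 0 z 1 else mat2 1 z 0 1, mat 1))"
  "root_subgroup (long_sign e) = range (\<lambda>z. cls (mat 1, if e then mat2 1 0 z 1 else mat2 1 z 0 1))"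
  by (auto simp: root_subgroup_def short_sign_def long_sign_def)

lemma torus_elt_in_Levi [intro]: "a \<noteq> 0 \<Longrightarrow> b \<noteq> 0 \<Longrightarrow> torus_elt a b \<in> carrier Levi"
  unfolding torus_elt_def by (intro cls_in_Levi) simp_all

lemma root_subgroup_in_Levi: "root_subgroup c \<subseteq> carrier Levi"
  unfolding root_subgroup_def by (auto simp: mat_1_mat2)

lemma subgroup_parabolic: "subgroup (parabolic R) Levi"
  unfolding parabolic_def using root_subgroup_in_Levi
  by (intro Levi.generate_is_subgroup) (auto simp: torus_A_def)

lemma torus_elt_in_parabolic: "a \<noteq> 0 \<Longrightarrow> b \<noteq> 0 \<Longrightarrow> torus_elt a b \<in> parabolic R"
  unfolding parabolic_def by (intro generate.incl) (auto simp: torus_A_def)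

lemma root_subgroup_in_parabolic: "c \<in> R \<Longrightarrow> x \<in> root_subgroup c \<Longrightarrow> x \<in> parabolic R"
  unfolding parabolic_def by (intro generate.incl) auto

lemma borel2_decomp:
  assumes "g \<in> borel2 e"
  obtains a z where "a \<noteq> 0"
    "g = mat2 a 0 0 (inverse a) ** (if e then mat2 1 0 z 1 else mat2 1 z 0 1)"
proof -
  have prod: "g$1$1 * g$2$2 = 1" and off: "if e then g$1$2 = 0 else g$2$1 = 0"
    using assms by (auto simp: borel2_def det_2 split: if_splits)
  then have nz: "g$1$1 \<noteq> 0" by (metis mult_zero_left zero_neq_one)
  have inv: "inverse (g$1$1) = g$2$2" by (rule inverse_unique[OF prod])
  show thesis
  proof (cases e)
    case True
    have "g = mat2 (g$1$1) 0 0 (inverse (g$1$1)) ** mat2 1 0 (g$1$1 * g$2$1) 1"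
      using off True prod prod[unfolded mult.commute[of "g$1$1"]] unfolding inv
      by (simp add: vec_eq_iff forall_2 mult_nth2 flip: mult.assoc)
    then show thesis by (intro that[OF nz, of "g$1$1 * g$2$1"]) (simp only: True if_True)
  next
    case False
    have "g = mat2 (g$1$1) 0 0 (inverse (g$1$1)) ** mat2 1 (g$1$2 / g$1$1) 0 1"
      using off False nz unfolding inv by (simp add: vec_eq_iff forall_2 mult_nth2)
    then show thesis by (intro that[OF nz, of "g$1$2 / g$1$1"]) (simp only: False if_False)
  qed
qed

lemma borel2_short_in_parabolic:
  assumes "short_sign e \<in> R" "g \<in> borel2 e"
  shows "cls (g, mat 1) \<in> parabolic R"
proof -
  obtain a z where az: "a \<noteq> 0" "g = mat2 a 0 0 (inverse a) ** (if e then mat2 1 0 z 1 else mat2 1 z 0 1)"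
    using borel2_decomp[OF assms(2)] by blast
  let ?u = "if e then mat2 1 0 z 1 else mat2 1 z 0 1"
  have "torus_elt a 1 \<otimes>\<^bsub>Levi\<^esub> cls (?u, mat 1) \<in> parabolic R"
    using az(1) assms(1)
    by (intro subgroup.m_closed[OF subgroup_parabolic] torus_elt_in_parabolic
        root_subgroup_in_parabolic[of "short_sign e"]) (auto simp: root_subgroup_simps)
  also have "torus_elt a 1 \<otimes>\<^bsub>Levi\<^esub> cls (?u, mat 1) = cls (g, mat 1)"
    using az by (subst torus_elt_def, subst cls_mult) (auto simp: mat_1_mat2[symmetric])
  finally show ?thesis .
qed

lemma borel2_long_in_parabolic:
  assumes "long_sign e \<in> R" "h \<in> borel2 e"
  shows "cls (mat 1, h) \<in> parabolic R"
proof -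
  obtain a z where az: "a \<noteq> 0" "h = mat2 a 0 0 (inverse a) ** (if e then mat2 1 0 z 1 else mat2 1 z 0 1)"
    using borel2_decomp[OF assms(2)] by blast
  let ?u = "if e then mat2 1 0 z 1 else mat2 1 z 0 1"
  have "torus_elt 1 a \<otimes>\<^bsub>Levi\<^esub> cls (mat 1, ?u) \<in> parabolic R"
    using az(1) assms(1)
    by (intro subgroup.m_closed[OF subgroup_parabolic] torus_elt_in_parabolic
        root_subgroup_in_parabolic[of "long_sign e"]) (auto simp: root_subgroup_simps)
  also have "torus_elt 1 a \<otimes>\<^bsub>Levi\<^esub> cls (mat 1, ?u) = cls (mat 1, h)"
    using az by (subst torus_elt_def, subst cls_mult) (auto simp: mat_1_mat2[symmetric])
  finally show ?thesis .
qed

lemma cls_factor: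
  assumes "det g = 1" "det h = 1"
  shows "cls (g, h) = cls (g, mat 1) \<otimes>\<^bsub>Levi\<^esub> cls (mat 1, h)"
  using assms by (simp add: cls_mult)

lemma borel2_prod_in_parabolic:
  assumes "short_sign e \<in> R" "long_sign e' \<in> R" "g \<in> borel2 e" "h \<in> borel2 e'"
  shows "cls (g, h) \<in> parabolic R"
  unfolding cls_factor[OF borel2_det[OF assms(3)] borel2_det[OF assms(4)]]
  by (rule subgroup.m_closed[OF subgroup_parabolic borel2_short_in_parabolic[OF assms(1,3)]
        borel2_long_in_parabolic[OF assms(2,4)]])

text \<open>The root subgroups of \<eta> and -\<eta> generate the long root factor: outside the
  upper Borel subgroup a matrix is upper times lower times upper unipotent.\<close>

lemma SL2_in_parabolic:
  assumes "highest_root \<in> R" "- highest_root \<in> R" "det h = 1"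
  shows "cls (mat 1, h) \<in> parabolic R"
proof (cases "h$2$1 = 0")
  case True
  then show ?thesis
    using assms by (intro borel2_long_in_parabolic[of False]) (auto simp: long_sign_def borel2_def)
next
  case False
  \<comment> \<open>Solved from the diagonal entries of the triple product; the upper right entry
    then agrees by the determinant.\<close>
  define x y where "x = (h$1$1 - 1) / h$2$1" and "y = (h$2$2 - 1) / h$2$1"
  have [simp]: "det (mat2 1 x 0 1) = 1" "det (mat2 1 0 (h$2$1) 1) = 1" "det (mat2 1 y 0 1) = 1" by simp_all
  have d: "h$1$2 * h$2$1 = h$1$1 * h$2$2 - 1" using assms(3) by (simp add: det_2 algebra_simps)
  have "h = mat2 1 x 0 1 ** mat2 1 0 (h$2$1) 1 ** mat2 1 y 0 1"
    using False d by (subst mat2_eta[of h]) (simp add: mat2_mult mat2_eq_iff x_def y_def divide_simps, simp add: algebra_simps d)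
  then have "cls (mat 1, h) = cls (mat 1, mat2 1 x 0 1) \<otimes>\<^bsub>Levi\<^esub> cls (mat 1, mat2 1 0 (h$2$1) 1)
      \<otimes>\<^bsub>Levi\<^esub> cls (mat 1, mat2 1 y 0 1)"
    by (simp add: cls_mult det_mul del: det_mat2)
  moreover have "cls (mat 1, mat2 1 x 0 1) \<in> parabolic R" "cls (mat 1, mat2 1 0 (h$2$1) 1) \<in> parabolic R"
    "cls (mat 1, mat2 1 y 0 1) \<in> parabolic R"
    by (rule borel2_long_in_parabolic[of False] borel2_long_in_parabolic[of True];
        use assms in \<open>simp add: long_sign_def borel2_def\<close>)+
  ultimately show ?thesis using subgroup.m_closed[OF subgroup_parabolic] by metis
qed

lemma borel2_mult: "g \<in> borel2 e \<Longrightarrow> g' \<in> borel2 e \<Longrightarrow> g ** g' \<in> borel2 e"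
  by (auto simp: borel2_def det_mul mult_nth2 split: if_splits)

lemma adj2_borel2: "g \<in> borel2 e \<Longrightarrow> adj2 g \<in> borel2 e"
  by (auto simp: borel2_def adj2_def det_2 mult.commute split: if_splits)

text \<open>The right-hand side is a subgroup containing the torus and the three root subgroups, and
  factoring (g, h) into its two components gives the converse. Cosets therefore only remember the
  line in the short root factor.\<close>

lemma parabolic_short:
  "parabolic {highest_root, - highest_root, short_sign e} = {cls (g, h) | g h. g \<in> borel2 e \<and> det h = 1}"
    (is "parabolic ?R = ?Q")
proof
  have Q: "subgroup ?Q Levi"
  proof (rule Levi.subgroupI)
    show "?Q \<subseteq> carrier Levi" by (auto simp: borel2_def)
    show "?Q \<noteq> {}" using det_I mat_1_borel2 by blast
  next
    fix l assume "l \<in> ?Q"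
    then obtain g h where "l = cls (g, h)" "g \<in> borel2 e" "det h = 1" by blast
    moreover from this have "inv\<^bsub>Levi\<^esub> l = cls (adj2 g, adj2 h)" by (simp only: cls_inv borel2_det)
    moreover have "det (adj2 h) = 1" using \<open>det h = 1\<close> by simp
    ultimately show "inv\<^bsub>Levi\<^esub> l \<in> ?Q" using adj2_borel2[of g e] by blast
  next
    fix l l' assume "l \<in> ?Q" "l' \<in> ?Q"
    then obtain g h g' h' where "l = cls (g, h)" "g \<in> borel2 e" "det h = 1"
      "l' = cls (g', h')" "g' \<in> borel2 e" "det h' = 1" by blast
    moreover from this have "l \<otimes>\<^bsub>Levi\<^esub> l' = cls (g ** g', h ** h')"
      by (simp only: cls_mult borel2_det)
    moreover have "det (h ** h') = 1" using calculation by (simp add: det_mul)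
    ultimately show "l \<otimes>\<^bsub>Levi\<^esub> l' \<in> ?Q" using borel2_mult[of g e g'] by blast
  qed
  have "torus_A \<subseteq> ?Q"
  proof
    fix l :: "'a levi" assume "l \<in> torus_A"
    then obtain a b where "l = torus_elt a b" "a \<noteq> 0" "b \<noteq> 0" unfolding torus_A_def by blast
    moreover have "det (mat2 b 0 0 (inverse b)) = 1" using \<open>b \<noteq> 0\<close> by simp
    ultimately show "l \<in> ?Q" using diag_borel2[of a e] unfolding torus_elt_def by blast
  qed
  moreover have "root_subgroup c \<subseteq> ?Q" if "c \<in> ?R" for c
  proof -
    have "root_subgroup (long_sign e') \<subseteq> ?Q" for e'
      unfolding root_subgroup_simps using mat_1_borel2 borel2_det[OF unipotent_borel2] by blast
    from this[of False] this[of True]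
    have "root_subgroup highest_root \<subseteq> ?Q" "root_subgroup (- highest_root) \<subseteq> ?Q"
      by (simp_all add: long_sign_def)
    moreover have "root_subgroup (short_sign e) \<subseteq> ?Q"
      unfolding root_subgroup_simps using det_I unipotent_borel2 by blast
    ultimately show ?thesis using that by blast
  qed
  ultimately show "parabolic ?R \<subseteq> ?Q"
    unfolding parabolic_def by (intro Levi.generate_subgroup_incl Q) blast
  show "?Q \<subseteq> parabolic ?R"
  proof clarify
    fix g h :: "'a mat2" assume "g \<in> borel2 e" "det h = 1"
    then show "cls (g, h) \<in> parabolic ?R"
      using subgroup.m_closed[OF subgroup_parabolic borel2_short_in_parabolic[of e ?R g] SL2_in_parabolic[of ?R h]]
      by (simp only: cls_factor borel2_det insertI1 insertI2)
  qed
qed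

lemma (in group) l_coset_eq_iff:
  assumes "subgroup H G" "x \<in> carrier G" "y \<in> carrier G"
  shows "x <# H = y <# H \<longleftrightarrow> inv x \<otimes> y \<in> H"
proof
  assume "x <# H = y <# H"
  moreover have "y \<in> y <# H"
    using assms subgroup.one_closed[OF assms(1)] by (force simp: l_coset_def)
  ultimately obtain h where "h \<in> H" "y = x \<otimes> h" by (auto simp: l_coset_def)
  then show "inv x \<otimes> y \<in> H"
    using assms subgroup.mem_carrier[OF assms(1)] by (simp add: m_assoc[symmetric])
next
  assume "inv x \<otimes> y \<in> H"
  then have "y \<in> x <# H"
    using assms by (auto simp: l_coset_def m_assoc[symmetric] intro!: bexI[of _ "inv x \<otimes> y"])
  then show "x <# H = y <# H" using l_repr_independence assms by blast
qed

lemma flag_eq_iff: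
  assumes "det g = 1" "det h = 1" "det g' = 1" "det h' = 1"
    and R: "R = {highest_root, - highest_root, short_sign e}"
  shows "cls (g, h) <#\<^bsub>Levi\<^esub> parabolic R = cls (g', h') <#\<^bsub>Levi\<^esub> parabolic R \<longleftrightarrow>
    wedge (flag_col e g) (flag_col e g') = 0"
proof -
  have "adj2 g ** g' \<in> borel2 e \<longleftrightarrow> cls (adj2 g ** g', adj2 h ** h') \<in> parabolic R"
  proof
    assume "cls (adj2 g ** g', adj2 h ** h') \<in> parabolic R"
    then obtain a b where "cls (adj2 g ** g', adj2 h ** h') = cls (a, b)" "a \<in> borel2 e"
      unfolding R parabolic_short by blast
    \<comment> \<open>A class determines its representative only up to a common sign, which does not
      affect membership in the Borel subgroup.\<close>
    then have "adj2 g ** g' = a \<or> adj2 g ** g' = - a" unfolding cls_eq_iff by auto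
    with \<open>a \<in> borel2 e\<close> show "adj2 g ** g' \<in> borel2 e"
      by (auto simp: borel2_def minus_mat_1)
  next
    have "det (adj2 h ** h') = 1" using assms by (simp add: det_mul)
    then show "cls (adj2 g ** g', adj2 h ** h') \<in> parabolic R" if "adj2 g ** g' \<in> borel2 e"
      using that unfolding R parabolic_short by blast
  qed
  then show ?thesis
    using assms by (simp add: Levi.l_coset_eq_iff subgroup_parabolic cls_in_Levi cls_inv cls_mult adj2_mult_in_borel2)
qed

section \<open>The torus $T_\psi$ and its Kummer local systems\<close>

lemma infinite_UNIV_alg_closed: "infinite (UNIV :: 'a::alg_closed_field set)"
proof
  assume fin: "finite (UNIV :: 'a set)"
  define q where "q = (\<Prod>a\<in>(UNIV :: 'a set). [:- a, 1:])"
  have "Polynomial.degree q = card (UNIV :: 'a set)"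
    unfolding q_def by (subst degree_prod_eq_sum_degree) auto
  moreover have "card (UNIV :: 'a set) > 0" using fin by (simp add: finite_UNIV_card_ge_0)
  ultimately have "Polynomial.degree (q + 1) > 0" by (subst degree_add_eq_left) auto
  then obtain x where "poly (q + 1) x = 0" using alg_closed_imp_poly_has_root by blast
  moreover have "poly q x = 0"
    unfolding q_def poly_prod using fin by (intro prod_zero) auto
  ultimately show False by simp
qed

lemma ex_nonzero_eval:
  fixes p :: "'a::alg_closed_field poly"
  assumes "p \<noteq> 0"
  obtains s where "s \<noteq> 0" "poly p s \<noteq> 0"
proof -
  have "finite {s. poly (Polynomial.monom 1 1 * p) s = 0}" using assms by (intro poly_roots_finite) simp
  then obtain s where "poly (Polynomial.monom 1 1 * p) s \<noteq> 0"
    using infinite_UNIV_alg_closed[where 'a = 'a] by (metis (mono_tags, lifting) finite_subset mem_Collect_eq subsetI)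
  then show thesis using that[of s] by (auto simp: poly_monom)
qed

section \<open>Zariski open subsets of L tested on representatives\<close>

lemma mem_Union_Levi:
  assumes "U \<subseteq> carrier Levi"
  shows "x \<in> \<Union>U \<longleftrightarrow> x \<in> carrier SL2sq \<and> cls x \<in> U"
proof -
  have "y \<in> carrier SL2sq \<Longrightarrow> - y \<in> carrier SL2sq" for y :: "'a mat2 \<times> 'a mat2"
    by (simp add: SL2sq_simps minus_mat_1)
  then have "l \<in> U \<Longrightarrow> x \<in> l \<Longrightarrow> x \<in> carrier SL2sq \<and> l = cls x" for l
    using assms unfolding carrier_Levi by (auto simp: cls_eq dest!: subsetD)
  moreover have "x \<in> cls x" by (simp add: cls_eq)
  ultimately show ?thesis by auto
qed

lemma openin_Levi_iff:
  "openin zariski_Levi U \<longleftrightarrow> U \<subseteq> carrier Levi \<and>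
     (\<exists>S\<subseteq>poly_funs. \<forall>x\<in>carrier SL2sq. cls x \<in> U \<longleftrightarrow> (\<exists>f\<in>S. f x \<noteq> 0))"
proof -
  have "\<Union>U = {x \<in> carrier SL2sq. \<exists>f\<in>S. f x \<noteq> 0} \<longleftrightarrow>
      (\<forall>x\<in>carrier SL2sq. cls x \<in> U \<longleftrightarrow> (\<exists>f\<in>S. f x \<noteq> 0))"
    if "U \<subseteq> carrier Levi" for S :: "('a mat2 \<times> 'a mat2 \<Rightarrow> 'a) set"
    unfolding set_eq_iff mem_Collect_eq mem_Union_Levi[OF that] by meson
  then show ?thesis unfolding openin_zariski_Levi zariski_open_SL2sq_def by (simp cong: conj_cong)
qed

text \<open>A matrix entry changes sign under \<open>mu2\<close> and does not descend to L, but its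
  nonvanishing locus does.\<close>

lemma openin_Levi_nonvanishing:
  assumes "f \<in> poly_funs" and "U = {l \<in> carrier Levi. \<exists>x\<in>l. f x \<noteq> 0}"
    and "\<And>x. f (- x) = 0 \<longleftrightarrow> f x = 0"
  shows "openin zariski_Levi U"
  unfolding openin_Levi_iff
proof (intro conjI exI[of _ "{f}"] ballI)
  fix x :: "'a mat2 \<times> 'a mat2" assume "x \<in> carrier SL2sq"
  then have "cls x \<in> carrier Levi" unfolding carrier_Levi by blast
  then show "cls x \<in> U \<longleftrightarrow> (\<exists>f\<in>{f}. f x \<noteq> 0)"
    using assms(3) by (auto simp: assms(2) cls_eq)
qed (use assms in auto)

lemma topspace_zariski_Levi: "topspace zariski_Levi = carrier Levi"
proof -
  have "openin zariski_Levi (carrier Levi)"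
    by (rule openin_Levi_nonvanishing[of "\<lambda>_. 1"])
       (auto intro: poly_funs.intros simp: carrier_Levi cls_eq)
  then show ?thesis by (metis openin_subset openin_topspace openin_zariski_Levi subset_antisym)
qed

text \<open>A representative in \<open>SL\<^sub>2 \<times> SL\<^sub>2\<close> of the element \<open>s\<close> of $T_\psi$.\<close>

definition psi_rep :: "'a::field \<Rightarrow> 'a mat2 \<times> 'a mat2" where
  "psi_rep s = (mat2 s 0 0 (inverse s), mat2 (inverse (s^3)) 0 0 (s^3))"

lemma psi_rep_minus: "psi_rep (- s) = - psi_rep s"
  by (simp add: psi_rep_def minus_mat2)

lemma T_psi_eq: "T_psi = {cls (psi_rep s) | s. s \<noteq> 0}"
  by (simp add: T_psi_def torus_elt_def psi_rep_def)

lemma T_psi_cases: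
  assumes "l \<in> T_psi"
  obtains s where "s \<noteq> 0" "l = cls (psi_rep s)"
  using assms unfolding T_psi_eq mem_Collect_eq by (elim exE conjE)

lemma cls_psi_rep_eq_iff: "cls (psi_rep s) = cls (psi_rep s') \<longleftrightarrow> s'^2 = s^2"
proof -
  have "psi_rep s' = psi_rep s \<longleftrightarrow> s' = s" for s s' :: 'a
    by (auto simp: psi_rep_def mat2_eq_iff)
  then show ?thesis
    by (simp add: cls_eq_iff power2_eq_iff flip: psi_rep_minus)
qed

lemma cls_mem_T_psi_iff: "cls x \<in> T_psi \<longleftrightarrow> (\<exists>s. s \<noteq> 0 \<and> x = psi_rep s)"
proof
  assume "cls x \<in> T_psi"
  then obtain s where "s \<noteq> 0" "cls x = cls (psi_rep s)" unfolding T_psi_eq by blast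
  then have "x = psi_rep s \<or> x = psi_rep (- s)"
    unfolding cls_eq_iff psi_rep_minus by (auto simp: minus_equation_iff)
  with \<open>s \<noteq> 0\<close> show "\<exists>s. s \<noteq> 0 \<and> x = psi_rep s" by (metis neg_equal_0_iff_equal)
qed (auto simp: T_psi_eq)

lemma psi_rep_in_T_psi: "s \<noteq> 0 \<Longrightarrow> cls (psi_rep s) \<in> T_psi"
  unfolding cls_mem_T_psi_iff by (intro exI[of _ s] conjI refl)

lemma psi_rep_SL2sq: "s \<noteq> 0 \<Longrightarrow> psi_rep s \<in> carrier SL2sq"
  by (simp add: psi_rep_def SL2sq_simps)

lemma T_psi_subset: "T_psi \<subseteq> carrier Levi"
  unfolding T_psi_eq carrier_Levi using psi_rep_SL2sq by blast

lemma psi_rep_mult: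
  assumes "s \<noteq> 0" "s' \<noteq> 0"
  shows "cls (psi_rep s) \<otimes>\<^bsub>Levi\<^esub> cls (psi_rep s') = cls (psi_rep (s * s'))"
  using assms unfolding psi_rep_def
  by (subst cls_mult) (simp_all add: mat2_mult power_mult_distrib)

lemma psi_rep_one: "cls (psi_rep 1) = \<one>\<^bsub>Levi\<^esub>"
  by (simp add: psi_rep_def cls_one mat_1_mat2)

lemma psi_rep_inv: "s \<noteq> 0 \<Longrightarrow> inv\<^bsub>Levi\<^esub> (cls (psi_rep s)) = cls (psi_rep (inverse s))"
  using T_psi_subset[unfolded T_psi_eq]
  by (intro Levi.inv_equality) (auto simp: psi_rep_mult psi_rep_one intro!: subsetD[OF T_psi_subset[unfolded T_psi_eq]])

lemma T_psi_subgroup: "subgroup T_psi Levi"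
proof (rule Levi.subgroupI[OF T_psi_subset])
  show "T_psi \<noteq> {}" using psi_rep_in_T_psi[OF one_neq_zero] by (rule ex_in_conv[THEN iffD1, OF exI])
  show "inv\<^bsub>Levi\<^esub> l \<in> T_psi" if "l \<in> T_psi" for l :: "'a levi"
  proof -
    from that obtain s where "s \<noteq> 0" "l = cls (psi_rep s)" by (rule T_psi_cases)
    then show ?thesis by (simp add: psi_rep_inv psi_rep_in_T_psi)
  qed
  show "l \<otimes>\<^bsub>Levi\<^esub> l' \<in> T_psi" if "l \<in> T_psi" "l' \<in> T_psi" for l l' :: "'a levi"
  proof -
    from that(1) obtain s where "s \<noteq> 0" "l = cls (psi_rep s)" by (rule T_psi_cases)
    moreover from that(2) obtain s' where "s' \<noteq> 0" "l' = cls (psi_rep s')" by (rule T_psi_cases)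
    ultimately show ?thesis by (simp add: psi_rep_mult psi_rep_in_T_psi)
  qed
qed

lemma T_psi_solvable: "solvable (Levi\<lparr>carrier := T_psi :: 'a::field levi set\<rparr>)"
proof -
  let ?T = "Levi\<lparr>carrier := T_psi :: 'a levi set\<rparr>"
  have comm: "l \<otimes>\<^bsub>Levi\<^esub> l' = l' \<otimes>\<^bsub>Levi\<^esub> l" if "l \<in> T_psi" "l' \<in> T_psi" for l l' :: "'a levi"
  proof -
    from that(1) obtain s where "s \<noteq> 0" "l = cls (psi_rep s)" by (rule T_psi_cases)
    moreover from that(2) obtain s' where "s' \<noteq> 0" "l' = cls (psi_rep s')" by (rule T_psi_cases)
    ultimately show ?thesis by (simp add: psi_rep_mult mult.commute)
  qed
  interpret T: comm_group ?T
  proof (rule group.group_comm_groupI[OF Levi.subgroup_imp_group[OF T_psi_subgroup]])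
    show "x \<otimes>\<^bsub>?T\<^esub> y = y \<otimes>\<^bsub>?T\<^esub> x" if "x \<in> carrier ?T" "y \<in> carrier ?T" for x y :: "'a levi"
      using comm[of x y] that by simp
  qed
  have "(derived ?T ^^ 1) (carrier ?T) = {\<one>\<^bsub>?T\<^esub>}"
    using T.derived_eq_singleton[of "carrier ?T"] by simp
  then show ?thesis unfolding T.solvable_iff_trivial_derived_seq by blast
qed

text \<open>Along \<open>psi_rep\<close> a polynomial function is a Laurent polynomial in s; the
  power of s clears its denominators.\<close>

lemma poly_funs_psi_rep_poly:
  assumes "f \<in> poly_funs"
  shows "\<exists>P N. \<forall>s. s \<noteq> 0 \<longrightarrow> s ^ N * f (psi_rep s) = poly P s"
  using assms
proof induction
  case (1 c)
  show ?case by (rule exI[of _ "[:c:]"], rule exI[of _ 0]) simp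
next
  case (2 i j)
  show ?case
    by (rule exI[of _ "if i = j then if i = 1 then Polynomial.monom 1 2 else 1 else 0"], rule exI[of _ 1])
       (use exhaust_2[of i] exhaust_2[of j] in \<open>auto simp: psi_rep_def poly_monom power2_eq_square\<close>)
next
  case (3 i j)
  show ?case
    by (rule exI[of _ "if i = j then if i = 1 then 1 else Polynomial.monom 1 6 else 0"], rule exI[of _ 3])
       (use exhaust_2[of i] exhaust_2[of j] in \<open>auto simp: psi_rep_def poly_monom simp flip: power_add\<close>)
next
  case (4 f g)
  obtain P N where P: "\<And>s. s \<noteq> 0 \<Longrightarrow> s ^ N * f (psi_rep s) = poly P s"
    using "4.IH"(1) by meson
  obtain Q M where Q: "\<And>s. s \<noteq> 0 \<Longrightarrow> s ^ M * g (psi_rep s) = poly Q s"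
    using "4.IH"(2) by meson
  have "s ^ (N + M) * (f (psi_rep s) + g (psi_rep s)) =
      poly (Polynomial.monom 1 M * P + Polynomial.monom 1 N * Q) s" if "s \<noteq> 0" for s
    by (simp add: poly_monom power_add P[OF that, symmetric] Q[OF that, symmetric] distrib_left mult_ac)
  then show ?case by meson
next
  case (5 f g)
  obtain P N where P: "\<And>s. s \<noteq> 0 \<Longrightarrow> s ^ N * f (psi_rep s) = poly P s"
    using "5.IH"(1) by meson
  obtain Q M where Q: "\<And>s. s \<noteq> 0 \<Longrightarrow> s ^ M * g (psi_rep s) = poly Q s"
    using "5.IH"(2) by meson
  have "s ^ (N + M) * (f (psi_rep s) * g (psi_rep s)) = poly (P * Q) s" if "s \<noteq> 0" for s
    by (simp add: power_add P[OF that, symmetric] Q[OF that, symmetric] mult_ac)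
  then show ?case by meson
qed

text \<open>A function not vanishing at one point of T_psi gives a nonzero polynomial in s, so the
  open set contains all but finitely many parameters.\<close>

lemma open_meets_T_psi:
  assumes "openin zariski_Levi U" "U \<inter> T_psi \<noteq> {}"
  shows "\<exists>P. P \<noteq> 0 \<and> (\<forall>s. s \<noteq> 0 \<longrightarrow> poly P s \<noteq> 0 \<longrightarrow> cls (psi_rep s) \<in> U)"
proof -
  obtain S where S: "S \<subseteq> poly_funs" "\<forall>x\<in>carrier SL2sq. cls x \<in> U \<longleftrightarrow> (\<exists>f\<in>S. f x \<noteq> 0)"
    using assms(1) unfolding openin_Levi_iff by (elim exE conjE)
  have mem: "cls (psi_rep s) \<in> U \<longleftrightarrow> (\<exists>f\<in>S. f (psi_rep s) \<noteq> 0)" if "s \<noteq> 0" for s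
    using S(2) psi_rep_SL2sq[OF that] by (rule bspec)
  obtain s where s: "s \<noteq> 0" "cls (psi_rep s) \<in> U" using assms(2) unfolding T_psi_eq by auto
  obtain f where f: "f \<in> S" "f (psi_rep s) \<noteq> 0" using mem[OF s(1)] s(2) by auto
  obtain P N where P: "\<And>s. s \<noteq> 0 \<Longrightarrow> s ^ N * f (psi_rep s) = poly P s"
    using poly_funs_psi_rep_poly[OF subsetD[OF S(1) f(1)]] by meson
  have "poly P s \<noteq> 0" using P[OF s(1)] s(1) f(2) by (metis mult_eq_0_iff power_not_zero)
  then have "P \<noteq> 0" by auto
  moreover have "cls (psi_rep s) \<in> U" if "s \<noteq> 0" "poly P s \<noteq> 0" for s
  proof -
    have "f (psi_rep s) \<noteq> 0" using P[OF that(1)] that(2) by auto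
    with f(1) show ?thesis unfolding mem[OF that(1)] by auto
  qed
  ultimately show ?thesis by meson
qed

text \<open>In fact T_psi is irreducible: two nonempty relatively open subsets meet wherever the
  product of their polynomials does not vanish.\<close>

lemma T_psi_connected: "connectedin zariski_Levi (T_psi :: 'a::alg_closed_field levi set)"
  unfolding connectedin topspace_zariski_Levi
proof (intro conjI T_psi_subset notI, elim exE conjE)
  fix E1 E2 :: "'a levi set"
  assume E: "openin zariski_Levi E1" "openin zariski_Levi E2" "E1 \<inter> E2 \<inter> T_psi = {}"
    "E1 \<inter> T_psi \<noteq> {}" "E2 \<inter> T_psi \<noteq> {}"
  obtain P where P: "P \<noteq> 0" "\<And>s. s \<noteq> 0 \<Longrightarrow> poly P s \<noteq> 0 \<Longrightarrow> cls (psi_rep s) \<in> E1"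
    using open_meets_T_psi[OF E(1,4)] by meson
  obtain Q where Q: "Q \<noteq> 0" "\<And>s. s \<noteq> 0 \<Longrightarrow> poly Q s \<noteq> 0 \<Longrightarrow> cls (psi_rep s) \<in> E2"
    using open_meets_T_psi[OF E(2,5)] by meson
  obtain s where s: "s \<noteq> 0" "poly (P * Q) s \<noteq> 0"
    by (rule ex_nonzero_eval[of "P * Q"]) (use P(1) Q(1) in simp)
  then have "cls (psi_rep s) \<in> T_psi" unfolding cls_mem_T_psi_iff by (intro exI[of _ s] conjI refl)
  moreover have "poly P s \<noteq> 0" "poly Q s \<noteq> 0" using s(2) by auto
  ultimately have "cls (psi_rep s) \<in> E1 \<inter> E2 \<inter> T_psi" using P(2) Q(2) s(1) by simp
  with E(3) show False by blast
qed

lemma T_psi_closed: "closedin zariski_Levi T_psi"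
  unfolding closedin_def topspace_zariski_Levi openin_Levi_iff
proof (intro conjI T_psi_subset Diff_subset exI ballI)
  \<comment> \<open>Equations of T_psi inside \<open>SL2sq\<close>: both matrices are diagonal and
    h_11 = s^(-3) is the cube of g_22 = s^(-1); the determinants give the other entries.\<close>
  let ?S = "{\<lambda>x. fst x $ 1 $ 2, \<lambda>x. fst x $ 2 $ 1, \<lambda>x. snd x $ 1 $ 2, \<lambda>x. snd x $ 2 $ 1,
    \<lambda>x. snd x $ 1 $ 1 + (-1) * (fst x $ 2 $ 2 * (fst x $ 2 $ 2 * fst x $ 2 $ 2))} ::
    ('a mat2 \<times> 'a mat2 \<Rightarrow> 'a) set"
  show "?S \<subseteq> poly_funs"
    unfolding insert_subset by (intro conjI empty_subsetI poly_funs.intros)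
  fix x :: "'a mat2 \<times> 'a mat2" assume x: "x \<in> carrier SL2sq"
  obtain g h where gh: "x = (g, h)" by fastforce
  have iff: "(\<exists>s. s \<noteq> 0 \<and> x = psi_rep s) \<longleftrightarrow> (\<forall>f\<in>?S. f x = 0)"
  proof
    assume "\<forall>f\<in>?S. f x = 0"
    then have 0: "g$1$2 = 0" "g$2$1 = 0" "h$1$2 = 0" "h$2$1 = 0" "h$1$1 = g$2$2 ^ 3"
      by (auto simp: gh power3_eq_cube mult.assoc)
    with x have 1: "g$1$1 * g$2$2 = 1" "h$1$1 * h$2$2 = 1" by (auto simp: gh SL2sq_simps det_2)
    then have nz: "g$1$1 \<noteq> 0" by (metis mult_zero_left zero_neq_one)
    have "g$2$2 = inverse (g$1$1)" using 1(1) by (metis inverse_unique)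
    moreover have "h$2$2 = inverse (h$1$1)" using 1(2) by (metis inverse_unique)
    ultimately have "x = psi_rep (g$1$1)"
      using 0 by (simp add: gh psi_rep_def vec_eq_iff forall_2 power_inverse)
    with nz show "\<exists>s. s \<noteq> 0 \<and> x = psi_rep s" by blast
  next
    assume "\<exists>s. s \<noteq> 0 \<and> x = psi_rep s"
    then obtain s where "x = psi_rep s" by blast
    then show "\<forall>f\<in>?S. f x = 0"
      by (simp add: psi_rep_def power3_eq_cube mult.assoc)
  qed
  have "cls x \<in> carrier Levi" unfolding carrier_Levi using x by (rule imageI)
  then show "cls x \<in> carrier Levi - T_psi \<longleftrightarrow> (\<exists>f\<in>?S. f x \<noteq> 0)"
    unfolding Diff_iff cls_mem_T_psi_iff iff by simp
qed

text \<open>T_psi is connected and contains the identity, and it is closed and by hypothesis open in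
  \<open>H\<close>, so a component can neither exceed nor miss part of it.\<close>

lemma identity_component_eq:
  assumes "T_psi \<subseteq> H" "H \<subseteq> carrier Levi" "openin (subtopology zariski_Levi H) T_psi"
  shows "identity_component H = (T_psi :: 'a::alg_closed_field levi set)"
proof
  have conn: "connectedin (subtopology zariski_Levi H) T_psi"
    using T_psi_connected assms(1) by (simp add: connectedin_subtopology)
  have one: "\<one>\<^bsub>Levi\<^esub> \<in> T_psi" using subgroup.one_closed[OF T_psi_subgroup] .
  show "T_psi \<subseteq> identity_component H"
    unfolding identity_component_def by (rule connected_component_of_maximal[OF conn one])
  then have "\<one>\<^bsub>Levi\<^esub> \<in> identity_component H" using one by blast
  moreover have "closedin (subtopology zariski_Levi H) T_psi"
    using T_psi_closed assms(1) by (auto simp: closedin_subtopology)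
  ultimately show "identity_component H \<subseteq> T_psi"
    using connectedin_clopen_cases[OF connectedin_connected_component_of _ assms(3)] one
    unfolding identity_component_def disjnt_def by blast
qed

lemma identity_component_T_psi: "identity_component (T_psi :: 'a::alg_closed_field levi set) = T_psi"
proof (rule identity_component_eq)
  show "openin (subtopology zariski_Levi T_psi) T_psi"
    using T_psi_subset by (metis openin_topspace topspace_subtopology_subset topspace_zariski_Levi)
qed (use T_psi_subset in auto)

lemma closed_conn_solvable_T_psi: "closed_conn_solvable (T_psi :: 'a::alg_closed_field levi set)"
  unfolding closed_conn_solvable_def
  using T_psi_subgroup T_psi_closed T_psi_connected T_psi_solvable by blast

lemma is_borel_T_psi: "is_borel B T_psi \<longleftrightarrow> B = (T_psi :: 'a::alg_closed_field levi set)"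
  unfolding is_borel_def using closed_conn_solvable_T_psi by blast

lemma psi_rep_in_L_psi: "s \<noteq> 0 \<Longrightarrow> cls (psi_rep s) \<in> L_psi"
proof -
  assume s: "s \<noteq> 0"
  then have "subst (psi_rep s) psi = psi"
    by (auto simp: subst_def psi_def psi_rep_def fun_eq_iff vector_matrix_mult_def sum_2
        power_mult_distrib field_simps)
  moreover have "cls (psi_rep s) \<in> carrier Levi" using s T_psi_subset unfolding T_psi_eq by blast
  ultimately show ?thesis unfolding L_psi_def mem_Collect_eq act_cls[OF psi_in_V_dual] by blast
qed

text \<open>The absence of x^2 y terms in psi forces g to be diagonal once g_11 is nonzero;
  evaluating psi at unit vectors then determines h.\<close>

lemma psi_stabilizer_diagonal:
  fixes g h :: "'a::field mat2"
  assumes char: "(2::'a) \<noteq> 0" "(3::'a) \<noteq> 0" and det: "det g = 1" "det h = 1"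
    and stab: "subst (g, h) psi = psi" and nz: "g$1$1 \<noteq> 0"
  shows "\<exists>s. s \<noteq> 0 \<and> (g, h) = psi_rep s"
proof -
  let ?a = "g$1$1" and ?b = "g$1$2" and ?c = "g$2$1" and ?d = "g$2$2"
  have eq: "(x * ?a + y * ?c)^3 * (u * h$1$1 + v * h$2$1) + (x * ?b + y * ?d)^3 * (u * h$1$2 + v * h$2$2)
      = x^3 * u + y^3 * v" for x y u v
    using fun_cong[OF stab, of "(vector [x, y], vector [u, v])"]
    by (simp add: subst_def psi_def vector_matrix_mult_def sum_2 mult.commute)
  have mixed: "?a^2 * ?c * (u * h$1$1 + v * h$2$1) + ?b^2 * ?d * (u * h$1$2 + v * h$2$2) = 0" for u v
  proof -
    let ?U = "u * h$1$1 + v * h$2$1" and ?V = "u * h$1$2 + v * h$2$2"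
    \<comment> \<open>The coefficient of x^2 y isolated from values: the difference at (1, 1) and
      (1, -1) contains it twice together with twice the y^3 term, which is the value at (0,
      1).\<close>
    have "2 * 3 * (?a^2 * ?c * ?U + ?b^2 * ?d * ?V) =
      ((?a + ?c)^3 * ?U + (?b + ?d)^3 * ?V) - ((?a - ?c)^3 * ?U + (?b - ?d)^3 * ?V)
       - 2 * (?c^3 * ?U + ?d^3 * ?V)"
      by (simp add: power2_eq_square power3_eq_cube algebra_simps)
    also have "\<dots> = 0"
      using eq[of 1 1 u v] eq[of 1 "-1" u v] eq[of 0 1 u v] by (simp add: algebra_simps)
    finally show ?thesis unfolding mult_eq_0_iff using char by blast
  qed
  have d: "h$1$1 * h$2$2 - h$1$2 * h$2$1 = 1" "?a * ?d - ?b * ?c = 1" using det by (simp_all add: det_2)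
  \<comment> \<open>Cramer's rule: inserting the determinant of h eliminates h from the two
    instances of \<open>mixed\<close>.\<close>
  have "?a^2 * ?c = ?a^2 * ?c * (h$1$1 * h$2$2 - h$1$2 * h$2$1)" using d by simp
  also have "\<dots> = h$2$2 * (?a^2 * ?c * h$1$1 + ?b^2 * ?d * h$1$2) - h$1$2 * (?a^2 * ?c * h$2$1 + ?b^2 * ?d * h$2$2)"
    by (simp add: algebra_simps)
  also have "\<dots> = 0" using mixed[of 1 0] mixed[of 0 1] by simp
  finally have c: "?c = 0" using nz by simp
  with d(2) have ad: "?a * ?d = 1" by simp
  then have dnz: "?d \<noteq> 0" by auto
  have "?b^2 * ?d = ?b^2 * ?d * (h$1$1 * h$2$2 - h$1$2 * h$2$1)" using d by simp
  also have "\<dots> = h$1$1 * (?a^2 * ?c * h$2$1 + ?b^2 * ?d * h$2$2) - h$2$1 * (?a^2 * ?c * h$1$1 + ?b^2 * ?d * h$1$2)"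
    by (simp add: algebra_simps)
  also have "\<dots> = 0" using mixed[of 1 0] mixed[of 0 1] by simp
  finally have b: "?b = 0" using dnz by simp
  have "?a^3 * h$1$1 = 1" "h$2$1 = 0" "h$1$2 = 0" "?d^3 * h$2$2 = 1"
    using eq[of 1 0 1 0] eq[of 1 0 0 1] eq[of 0 1 1 0] eq[of 0 1 0 1] nz dnz by (simp_all add: b c)
  moreover have "?d = inverse ?a" using ad by (metis inverse_unique)
  moreover from calculation have "h$1$1 = inverse (?a^3)" "h$2$2 = ?a^3"
    using nz by (auto simp: field_simps)
  ultimately have "(g, h) = psi_rep ?a" using b c by (simp add: psi_rep_def vec_eq_iff forall_2)
  with nz show ?thesis by blast
qed

text \<open>The open condition that g_11 is nonzero selects T_psi in the stabilizer; elements of the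
  other component exchange x and y and have g_11 = 0.\<close>

lemma identity_component_L_psi:
  assumes "(2::'a::alg_closed_field) \<noteq> 0" "(3::'a) \<noteq> 0"
  shows "identity_component L_psi = (T_psi :: 'a levi set)"
proof (rule identity_component_eq)
  show "T_psi \<subseteq> (L_psi :: 'a levi set)" using psi_rep_in_L_psi by (auto simp only: T_psi_eq mem_Collect_eq)
  show "(L_psi :: 'a levi set) \<subseteq> carrier Levi" by (auto simp only: L_psi_def)
  let ?U = "{l \<in> carrier Levi. \<exists>x\<in>l. fst x $ 1 $ 1 \<noteq> (0 :: 'a)}"
  have U: "openin zariski_Levi ?U"
    by (rule openin_Levi_nonvanishing[of "\<lambda>x. fst x $ 1 $ 1"]) (auto intro: poly_funs.intros)
  have T: "T_psi = L_psi \<inter> ?U"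
  proof (intro equalityI subsetI)
    fix l :: "'a levi" assume "l \<in> T_psi"
    then obtain s where s: "s \<noteq> 0" "l = cls (psi_rep s)" unfolding T_psi_eq by blast
    moreover have "psi_rep s \<in> l" by (simp add: s cls_eq)
    moreover have "fst (psi_rep s) $ 1 $ 1 \<noteq> 0" using s by (simp add: psi_rep_def)
    ultimately have "l \<in> ?U" using subsetD[OF T_psi_subset \<open>l \<in> T_psi\<close>] by (intro CollectI conjI bexI)
    then show "l \<in> L_psi \<inter> ?U" using psi_rep_in_L_psi[OF s(1)] s(2) by simp
  next
    fix l :: "'a levi" assume l: "l \<in> L_psi \<inter> ?U"
    then have "l \<in> carrier Levi" by simp
    then obtain g h where gh: "l = cls (g, h)" "det g = 1" "det h = 1" by (rule Levi_cases)
    have "g$1$1 \<noteq> 0" using l by (auto simp: gh(1) cls_eq)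
    moreover have "subst (g, h) psi = psi" using l by (simp add: gh(1) L_psi_def act_cls[OF psi_in_V_dual])
    ultimately show "l \<in> T_psi"
      unfolding gh(1) cls_mem_T_psi_iff by (intro psi_stabilizer_diagonal[OF assms gh(2,3)])
  qed
  show "openin (subtopology zariski_Levi L_psi) (T_psi :: 'a levi set)"
    unfolding T by (rule openin_subtopology_Int2[OF U])
qed

text \<open>The parameter of $T_\psi \cong \mathbb G_m$ is \<open>s\<^sup>2\<close>: a polynomial function on
  \<open>SL\<^sub>2 \<times> SL\<^sub>2\<close> restricts to a Laurent polynomial in \<open>s\<close>, whose odd part \<open>B\<close> vanishes if the function
  descends to \<open>L\<close>.\<close>

lemma poly_funs_psi_rep_laurent:
  assumes "f \<in> poly_funs"
  shows "\<exists>A\<in>laurent_funs 1. \<exists>B\<in>laurent_funs 1. \<forall>s z. s \<noteq> 0 \<longrightarrow> z 0 = s^2 \<longrightarrow> f (psi_rep s) = A z + s * B z"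
  using assms
proof induction
  case (1 c)
  show ?case by (rule bexI[of _ "\<lambda>_. c"], rule bexI[of _ "\<lambda>_. 0"]) (auto intro: laurent_funs.intros)
next
  case (2 i j)
  let ?B = "if i = j then if i = 1 then (\<lambda>_. 1) else (\<lambda>z. inverse (z 0)) else (\<lambda>_. 0)"
  have B: "?B \<in> laurent_funs 1" by (auto intro: laurent_funs.intros)
  have eq: "\<forall>s z. s \<noteq> 0 \<longrightarrow> z 0 = s^2 \<longrightarrow> fst (psi_rep s) $ i $ j = 0 + s * ?B z"
    using exhaust_2[of i] exhaust_2[of j] by (auto simp: psi_rep_def power2_eq_square)
  show ?case by (rule bexI[of _ "\<lambda>_. 0", OF bexI[of _ ?B]]) (rule eq, rule B, rule laurent_funs.intros(1))
next
  case (3 i j)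
  let ?B = "if i = j then if i = 1 then (\<lambda>z. inverse (z 0) * inverse (z 0)) else (\<lambda>z. z 0) else (\<lambda>_. 0)"
  have B: "?B \<in> laurent_funs 1" by (auto intro: laurent_funs.intros)
  have eq: "\<forall>s z. s \<noteq> 0 \<longrightarrow> z 0 = s^2 \<longrightarrow> snd (psi_rep s) $ i $ j = 0 + s * ?B z"
    using exhaust_2[of i] exhaust_2[of j] by (auto simp: psi_rep_def power2_eq_square power3_eq_cube)
  show ?case by (rule bexI[of _ "\<lambda>_. 0", OF bexI[of _ ?B]]) (rule eq, rule B, rule laurent_funs.intros(1))
next
  case (4 f g)
  obtain A B where AB: "A \<in> laurent_funs 1" "B \<in> laurent_funs 1"
    and f: "\<And>s z. s \<noteq> 0 \<Longrightarrow> z 0 = s^2 \<Longrightarrow> f (psi_rep s) = A z + s * B z"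
    using "4.IH"(1) by meson
  obtain A' B' where AB': "A' \<in> laurent_funs 1" "B' \<in> laurent_funs 1"
    and g: "\<And>s z. s \<noteq> 0 \<Longrightarrow> z 0 = s^2 \<Longrightarrow> g (psi_rep s) = A' z + s * B' z"
    using "4.IH"(2) by meson
  have "f (psi_rep s) + g (psi_rep s) = (A z + A' z) + s * (B z + B' z)" if "s \<noteq> 0" "z 0 = s^2" for s z
    by (simp add: f[where z = z, OF that] g[where z = z, OF that] algebra_simps)
  then show ?case
    by (intro bexI[of _ "\<lambda>z. A z + A' z", OF bexI[of _ "\<lambda>z. B z + B' z"]] allI impI laurent_funs.intros(4) AB AB')
next
  case (5 f g)
  obtain A B where AB: "A \<in> laurent_funs 1" "B \<in> laurent_funs 1"
    and f: "\<And>s z. s \<noteq> 0 \<Longrightarrow> z 0 = s^2 \<Longrightarrow> f (psi_rep s) = A z + s * B z"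
    using "5.IH"(1) by meson
  obtain A' B' where AB': "A' \<in> laurent_funs 1" "B' \<in> laurent_funs 1"
    and g: "\<And>s z. s \<noteq> 0 \<Longrightarrow> z 0 = s^2 \<Longrightarrow> g (psi_rep s) = A' z + s * B' z"
    using "5.IH"(2) by meson
  have "f (psi_rep s) * g (psi_rep s) = (A z * A' z + z 0 * (B z * B' z)) + s * (A z * B' z + B z * A' z)"
    if "s \<noteq> 0" "z 0 = s^2" for s z
    using that(2) by (simp add: f[where z = z, OF that] g[where z = z, OF that] algebra_simps power2_eq_square)
  then show ?case
    by (intro bexI[of _ "\<lambda>z. A z * A' z + z 0 * (B z * B' z)", OF bexI[of _ "\<lambda>z. A z * B' z + B z * A' z"]]
        allI impI laurent_funs.intros AB AB' zero_less_one)
qed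

lemma is_torus_T_psi:
  assumes char: "(2::'a::alg_closed_field) \<noteq> 0"
  shows "is_torus (T_psi :: 'a levi set)"
proof -
  \<comment> \<open>Arbitrary square roots, with no multiplicativity required: the class of
    \<open>psi_rep s\<close> depends only on s^2.\<close>
  obtain r where r: "r x ^ 2 = x" for x :: 'a
    using nth_root_exists[of 2] by (metis zero_less_numeral)
  have r0: "r x \<noteq> 0" if "x \<noteq> 0" for x using r[of x] that by auto
  define \<phi> where "\<phi> z = cls (psi_rep (r (z 0)))" for z :: "nat \<Rightarrow> 'a"
  have inj: "inj_on \<phi> (gm_power 1)"
  proof (rule inj_onI)
    fix z z' :: "nat \<Rightarrow> 'a" assume z: "z \<in> gm_power 1" "z' \<in> gm_power 1" "\<phi> z = \<phi> z'"
    then have "z 0 = z' 0" by (simp add: \<phi>_def cls_psi_rep_eq_iff r)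
    moreover have "z i = z' i" if "i \<ge> 1" for i using z that by (simp add: gm_power_def)
    ultimately show "z = z'" by (metis ext less_one not_le)
  qed
  have img: "\<phi> ` gm_power 1 = T_psi"
  proof (intro equalityI subsetI)
    fix l :: "'a levi" assume "l \<in> T_psi"
    then obtain s where s: "s \<noteq> 0" "l = cls (psi_rep s)" unfolding T_psi_eq by blast
    define z where "z i = (if i = 0 then s^2 else 1)" for i :: nat
    have "z \<in> gm_power 1" using s by (simp add: gm_power_def z_def)
    moreover have "\<phi> z = l" by (simp add: \<phi>_def z_def s cls_psi_rep_eq_iff r)
    ultimately show "l \<in> \<phi> ` gm_power 1" by blast
  next
    fix l assume "l \<in> \<phi> ` gm_power 1"
    then obtain z where z: "z \<in> gm_power 1" "l = \<phi> z" by blast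
    then have "r (z 0) \<noteq> 0" by (intro r0) (simp add: gm_power_def)
    then show "l \<in> T_psi" unfolding z(2) \<phi>_def T_psi_eq by blast
  qed
  have mult: "\<phi> (\<lambda>i. z i * z' i) = \<phi> z \<otimes>\<^bsub>Levi\<^esub> \<phi> z'" if "z \<in> gm_power 1" "z' \<in> gm_power 1" for z z'
  proof -
    have "r (z 0) \<noteq> 0" "r (z' 0) \<noteq> 0" using that by (simp_all add: r0 gm_power_def)
    then show ?thesis by (simp add: \<phi>_def psi_rep_mult cls_psi_rep_eq_iff power_mult_distrib r)
  qed
  have reg: "\<exists>g\<in>laurent_funs 1. \<forall>z\<in>gm_power 1. F (\<phi> z) = g z" if F: "Levi_regular F" for F
  proof -
    obtain f where f: "f \<in> poly_funs" "\<And>x. x \<in> carrier SL2sq \<Longrightarrow> F (cls x) = f x"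
      using F unfolding Levi_regular_def by blast
    obtain A B where AB: "A \<in> laurent_funs 1"
      "\<And>s z. s \<noteq> 0 \<Longrightarrow> z 0 = s^2 \<Longrightarrow> f (psi_rep s) = A z + s * B z"
      using poly_funs_psi_rep_laurent[OF f(1)] by blast
    have "F (\<phi> z) = A z" if z: "z \<in> gm_power 1" for z
    proof -
      let ?s = "r (z 0)"
      have s: "?s \<noteq> 0" using z by (intro r0) (simp add: gm_power_def)
      have "F (\<phi> z) = f (psi_rep ?s)" using f(2) psi_rep_SL2sq[OF s] by (simp add: \<phi>_def)
      \<comment> \<open>F sees only the class, so f is even in s along T_psi and its odd part
        vanishes because 2 is nonzero.\<close>
      moreover have "cls (psi_rep ?s) = cls (psi_rep (- ?s))" by (simp add: cls_psi_rep_eq_iff)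
      then have "f (psi_rep ?s) = f (psi_rep (- ?s))"
        using f(2)[of "psi_rep ?s"] f(2)[of "psi_rep (- ?s)"] psi_rep_SL2sq s by (metis neg_equal_0_iff_equal)
      moreover have "f (psi_rep ?s) = A z + ?s * B z" "f (psi_rep (- ?s)) = A z - ?s * B z"
        using AB(2)[of ?s z] AB(2)[of "- ?s" z] s r by simp_all
      ultimately have "A z + ?s * B z = A z - ?s * B z" by simp
      then have "2 * (?s * B z) = 0" by (simp only: mult_2) (simp add: algebra_simps)
      with char have "?s * B z = 0" by (metis mult_eq_0_iff)
      then show ?thesis using \<open>F (\<phi> z) = f (psi_rep ?s)\<close> \<open>f (psi_rep ?s) = A z + ?s * B z\<close> by simp
    qed
    with AB(1) show ?thesis by blast
  qed
  have coord: "\<exists>F. Levi_regular F \<and> (\<forall>z\<in>gm_power 1. F (\<phi> z) = z i)" if "i < 1" for i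
  proof -
    \<comment> \<open>The square of g_11 restricts to s^2, the coordinate of the torus, and squaring
      removes the ambiguity of the chosen representative.\<close>
    define F where "F l = (fst (SOME x. x \<in> l) $ 1 $ 1)^2" for l :: "'a levi"
    have F: "F (cls x) = fst x $ 1 $ 1 * fst x $ 1 $ 1" for x
    proof -
      have "(SOME y. y \<in> cls x) \<in> cls x" by (rule someI[of _ x]) (simp add: cls_eq)
      then have "(SOME y. y \<in> cls x) = x \<or> (SOME y. y \<in> cls x) = - x" unfolding cls_eq by simp
      then show ?thesis unfolding F_def by (elim disjE) (simp_all add: power2_eq_square)
    qed
    have "Levi_regular F"
      unfolding Levi_regular_def using F by (intro bexI[of _ "\<lambda>x. fst x $ 1 $ 1 * fst x $ 1 $ 1"])
        (auto intro: poly_funs.intros)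
    moreover have "F (\<phi> z) = z i" for z
      using that r[of "z 0"] by (simp add: \<phi>_def F psi_rep_def power2_eq_square)
    ultimately show ?thesis by blast
  qed
  show ?thesis
    unfolding is_torus_def using inj img mult reg coord T_psi_subset
    by (intro exI[of _ 1] exI[of _ \<phi>]) (auto simp only: bij_betw_def)
qed

lemma T_psi_nontrivial:
  assumes "(2::'a::alg_closed_field) \<noteq> 0"
  shows "T_psi \<noteq> {\<one>\<^bsub>Levi\<^esub> :: 'a levi}"
proof
  assume T: "T_psi = {\<one>\<^bsub>Levi\<^esub> :: 'a levi}"
  \<comment> \<open>The parameter -1 already represents the identity, so a fourth root of unity is
    taken.\<close>
  obtain s :: 'a where s: "s^2 = -1" using nth_root_exists[of 2 "-1::'a"] by auto
  then have "s \<noteq> 0" by auto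
  then have "cls (psi_rep s) = cls (psi_rep 1)" using T unfolding psi_rep_one T_psi_eq by blast
  then have "(1::'a) = -1" using s by (simp add: cls_psi_rep_eq_iff)
  then have "(1::'a) + 1 = 0" by (metis add.right_inverse)
  with assms show False by simp
qed

section \<open>Frobenius and the Lang covering of T_psi\<close>

lemma frob_T_psi:
  fixes t :: "'k::finite_field alg_closure levi"
  assumes "t \<in> T_psi"
  shows "frob t \<in> T_psi"
proof -
  let ?q = "CARD('k)"
  obtain s where s: "s \<noteq> 0" "t = cls (psi_rep s)" using assms unfolding T_psi_eq by blast
  \<comment> \<open>Elements of k equal their q-th powers, which settles the sign for even and odd q
    alike; hence Frobenius respects the cosets of \<open>mu2\<close>.\<close>
  have "to_ac ((-1 :: 'k) ^ ?q) = to_ac (-1)" by (simp only: finite_field_power_card_eq_same)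
  then have "(-1 :: 'k alg_closure) ^ ?q = -1" by simp
  then have neg: "(- x) ^ ?q = - (x ^ ?q)" for x :: "'k alg_closure"
    by (metis mult_minus1 power_mult_distrib)
  have map: "map_matrix (\<lambda>x. x ^ ?q) (mat2 a b c d) = mat2 (a ^ ?q) (b ^ ?q) (c ^ ?q) (d ^ ?q)"
    for a b c d :: "'k alg_closure"
    by (simp add: map_matrix_def vec_eq_iff forall_2)
  have zero: "(0 :: 'k alg_closure) ^ ?q = 0" by (simp add: zero_power)
  have "frob t = cls (psi_rep (s ^ ?q))"
    unfolding s(2) frob_def cls_eq psi_rep_minus[symmetric]
    by (simp add: psi_rep_def map neg zero power_inverse mult.commute flip: power_mult)
  then show ?thesis using s(1) unfolding T_psi_eq by (auto intro: exI[of _ "s ^ ?q"])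
qed

lemma lang_preimage_T_psi: "lang_preimage T_psi = (T_psi :: 'k::finite_field alg_closure levi set)"
  unfolding lang_preimage_def
  using frob_T_psi subgroup.m_closed[OF T_psi_subgroup] subgroup.m_inv_closed[OF T_psi_subgroup] by blast

text \<open>The Lang preimage of T_psi is T_psi itself, so a section is a constant c. Equivariance
  under t gives c = chi(t) c, hence c = 0.\<close>

lemma not_kummer_trivial_T_psi:
  fixes chi :: "'k::finite_field alg_closure levi \<Rightarrow> 'e::field"
  assumes "t \<in> T_psi_k" "chi t \<noteq> 1"
  shows "\<not> kummer_trivial chi T_psi"
proof
  assume "kummer_trivial chi T_psi"
  then obtain f where f: "continuous_map (subtopology zariski_Levi T_psi) (discrete_topology UNIV) f"
    "\<And>a t. a \<in> T_psi_k \<Longrightarrow> t \<in> T_psi \<Longrightarrow> f (a \<otimes>\<^bsub>Levi\<^esub> t) = chi a * f t"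
    "\<And>t. t \<in> T_psi \<Longrightarrow> f t \<noteq> 0"
    unfolding kummer_trivial_def kummer_sections_def lang_preimage_T_psi by blast
  have "connectedin (subtopology zariski_Levi T_psi) (T_psi :: 'k alg_closure levi set)"
    using T_psi_connected by (simp add: connectedin_subtopology)
  from connectedin_continuous_map_image[OF f(1) this] obtain c where "f ` T_psi \<subseteq> {c}"
    unfolding connectedin_discrete_topology by blast
  then have const: "f x = c" if "x \<in> T_psi" for x using that by blast
  have t: "t \<in> T_psi" using assms(1) by (simp add: T_psi_k_def)
  have one: "\<one>\<^bsub>Levi\<^esub> \<in> (T_psi :: 'k alg_closure levi set)" using subgroup.one_closed[OF T_psi_subgroup] .
  have "t \<otimes>\<^bsub>Levi\<^esub> \<one>\<^bsub>Levi\<^esub> = t" using t T_psi_subset by (intro Levi.r_one) blast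
  then have "c = chi t * c" using f(2)[OF assms(1) one] const[OF t] const[OF one] by simp
  moreover have "c \<noteq> 0" using f(3)[OF one] const[OF one] by simp
  ultimately show False using assms(2) by simp
qed

section \<open>The varieties $Y_w$\<close>

definition form_of :: "(nat \<Rightarrow> nat \<Rightarrow> 'a::field) \<Rightarrow> 'a form" where
  "form_of c = (\<lambda>(p, r). \<Sum>i\<le>3. \<Sum>j\<le>1. c i j * (p$1)^(3 - i) * (p$2)^i * (r$1)^(1 - j) * (r$2)^j)"

lemma form_of_expand:
  "form_of c (p, r) =
     (c 0 0 * (p$1)^3 + c 1 0 * (p$1)^2 * p$2 + c 2 0 * p$1 * (p$2)^2 + c 3 0 * (p$2)^3) * r$1 +
     (c 0 1 * (p$1)^3 + c 1 1 * (p$1)^2 * p$2 + c 2 1 * p$1 * (p$2)^2 + c 3 1 * (p$2)^3) * r$2"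
  by (simp add: form_of_def numeral_3_eq_3 numeral_2_eq_2 algebra_simps)

lemma V_dual_eq: "V_dual = range form_of"
  unfolding V_dual_def form_of_def by auto

text \<open>In characteristic different from 2 the coefficients of a binary cubic are combinations of
  its values at \<open>(1, 0), (0, 1), (1, 1), (1, -1)\<close>.\<close>

definition form_coeff :: "nat \<Rightarrow> nat \<Rightarrow> 'a::field form \<Rightarrow> 'a" where
  "form_coeff i j f =
     (let F = (\<lambda>x y. f (vector [x, y], if j = 0 then vector [1, 0] else vector [0, 1]))
      in if i = 0 then F 1 0 else if i = 1 then (F 1 1 - F 1 (-1)) / 2 - F 0 1
         else if i = 2 then (F 1 1 + F 1 (-1)) / 2 - F 1 0 else F 0 1)"

lemma index_cases: "i \<le> 3 \<longleftrightarrow> i = 0 \<or> i = 1 \<or> i = 2 \<or> i = (3::nat)" "j \<le> 1 \<longleftrightarrow> j = 0 \<or> j = (1::nat)"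
  by auto

lemma form_coeff_form_of:
  assumes "(2::'a::field) \<noteq> 0" "i \<le> 3" "j \<le> 1"
  shows "form_coeff i j (form_of c) = (c i j :: 'a)"
  using assms(2,3) unfolding index_cases
  by (elim disjE; simp add: form_coeff_def form_of_expand; simp add: assms(1) field_simps)

lemma form_of_add: "(\<lambda>z. form_of c z + form_of d z) = form_of (\<lambda>i j. c i j + d i j)"
  by (auto simp: fun_eq_iff form_of_expand algebra_simps)

lemma form_of_scale: "(\<lambda>z. k * form_of c z) = form_of (\<lambda>i j. k * c i j)"
  by (auto simp: fun_eq_iff form_of_expand algebra_simps)

text \<open>The default 0 is dictated by \<open>V_P\<close>, whose members must vanish outside
  \<open>V_dual\<close>.\<close>

definition coeff_functional :: "nat \<Rightarrow> nat \<Rightarrow> 'a::field form \<Rightarrow> 'a" where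
  "coeff_functional i j f = (if f \<in> V_dual then form_coeff i j f else 0)"

lemma coeff_functional_form_of:
  assumes "(2::'a::field) \<noteq> 0" "i \<le> 3" "j \<le> 1"
  shows "coeff_functional i j (form_of c) = (c i j :: 'a)"
  using form_coeff_form_of[OF assms] by (simp add: coeff_functional_def V_dual_eq)

text \<open>The affine root of the weight space dual to the monomial $x^{3-i} y^i u^{1-j} v^j$.\<close>

definition weight_root :: "nat \<Rightarrow> nat \<Rightarrow> aff_root" where
  "weight_root i j = (if j = 0 then (-1, int i - 3, 1) else (1, int i, 0))"

lemma weight_root_mem:
  assumes "i \<le> 3"
  shows "weight_root i j \<in> real_aff_roots" "aff_val (weight_root i j) x_P = 1 / real m_P"
proof -
  show "weight_root i j \<in> real_aff_roots"
    using assms unfolding index_cases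
    by (elim disjE; simp add: weight_root_def real_aff_roots_def g2_roots_def)
  show "aff_val (weight_root i j) x_P = 1 / real m_P"
    by (simp add: weight_root_def x_P_eq m_P_eq)
qed

lemma subst_diag_form_of:
  assumes "a \<noteq> 0" "b \<noteq> 0"
  shows "subst (mat2 (inverse a) 0 0 a, mat2 (inverse b) 0 0 b) (form_of c) =
    form_of (\<lambda>i j. inverse a ^ (3 - i) * a ^ i * (inverse b ^ (1 - j) * b ^ j) * c i j)"
  by (auto simp: fun_eq_iff subst_def form_of_expand vector_matrix_mult_def sum_2 power_mult_distrib
      eval_nat_numeral algebra_simps)

text \<open>The inverse of a torus element scales the monomial with exponents (3 - i, i, 1 - j, j)
  by a^(2i - 3) b^(2j - 1), which is the character of the gradient of
  \<open>weight_root i j\<close>.\<close>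

lemma coeff_functional_in_V_P_space:
  assumes "(2::'a::field) \<noteq> 0" "i \<le> 3" "j \<le> 1"
  shows "(coeff_functional i j :: 'a form \<Rightarrow> 'a) \<in> V_P_space (weight_root i j)"
proof -
  note coeff = coeff_functional_form_of[OF assms]
  have V_P: "(coeff_functional i j :: 'a form \<Rightarrow> 'a) \<in> V_P"
    unfolding V_P_def mem_Collect_eq V_dual_eq
  proof (intro conjI ballI allI impI; (elim rangeE)?)
    fix f g :: "'a form" and c d assume "f = form_of c" "g = form_of d"
    then show "coeff_functional i j (\<lambda>z. f z + g z) = coeff_functional i j f + coeff_functional i j g"
      by (simp only: form_of_add coeff)
  next
    fix k and f :: "'a form" and c assume "f = form_of c"
    then show "coeff_functional i j (\<lambda>z. k * f z) = k * coeff_functional i j f"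
      by (simp only: form_of_scale coeff)
  next
    fix f :: "'a form" assume "f \<notin> range form_of"
    then show "coeff_functional i j f = 0" by (simp add: coeff_functional_def V_dual_eq)
  qed
  have "coeff_functional i j (act (inv\<^bsub>Levi\<^esub> (torus_elt a b)) f) =
      root_char (gradient (weight_root i j)) a b * coeff_functional i j f"
    if ab: "a \<noteq> 0" "b \<noteq> 0" and f: "f \<in> V_dual" for a b and f :: "'a form"
  proof -
    obtain c where c: "f = form_of c" using f unfolding V_dual_eq by (elim rangeE)
    have "inv\<^bsub>Levi\<^esub> (torus_elt a b) = cls (mat2 (inverse a) 0 0 a, mat2 (inverse b) 0 0 b)"
      unfolding torus_elt_def by (subst cls_inv) (simp_all add: ab adj2_mat2)
    then have "act (inv\<^bsub>Levi\<^esub> (torus_elt a b)) f =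
        form_of (\<lambda>i j. inverse a ^ (3 - i) * a ^ i * (inverse b ^ (1 - j) * b ^ j) * c i j)"
      by (simp only: act_cls[OF f[unfolded c]] c subst_diag_form_of[OF ab])
    moreover have "inverse a ^ (3 - i) * a ^ i * (inverse b ^ (1 - j) * b ^ j) =
        root_char (gradient (weight_root i j)) a b"
      using assms(2,3) ab unfolding index_cases
      by (elim disjE; simp add: weight_root_def root_char_def power_int_def;
          simp add: eval_nat_numeral field_simps)
    ultimately show ?thesis by (simp only: coeff c)
  qed
  with V_P show ?thesis unfolding V_P_space_def mem_Collect_eq by meson
qed

text \<open>Depth 1/2 means c_1 + 2 n = 1, so the gradient determines the affine root.\<close>

lemma finite_depth_roots: "finite {\<alpha> \<in> real_aff_roots. aff_val \<alpha> x_P = 1 / real m_P \<and> P \<alpha>}"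
proof (rule finite_subset)
  show "finite ((\<lambda>(c1, c2). (c1, c2, (1 - c1) div 2)) ` g2_roots)"
    by (simp add: g2_roots_def)
  show "{\<alpha> \<in> real_aff_roots. aff_val \<alpha> x_P = 1 / real m_P \<and> P \<alpha>} \<subseteq>
      (\<lambda>(c1, c2). (c1, c2, (1 - c1) div 2)) ` g2_roots"
  proof
    fix \<alpha> assume \<alpha>: "\<alpha> \<in> {\<alpha> \<in> real_aff_roots. aff_val \<alpha> x_P = 1 / real m_P \<and> P \<alpha>}"
    obtain c1 c2 n where eq: "\<alpha> = (c1, c2, n)" by (metis prod_cases3)
    have "real_of_int (c1 + 2 * n) = real_of_int 1" using \<alpha> by (simp add: eq x_P_eq m_P_eq)
    then have "c1 + 2 * n = 1" by (simp only: of_int_eq_iff)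
    then have "n = (1 - c1) div 2" by simp
    moreover have "(c1, c2) \<in> g2_roots" using \<alpha> by (simp add: eq real_aff_roots_def)
    ultimately show "\<alpha> \<in> (\<lambda>(c1, c2). (c1, c2, (1 - c1) div 2)) ` g2_roots"
      unfolding eq by (intro image_eqI[of _ _ "(c1, c2)"]) simp_all
  qed
qed

lemma zero_in_V_P_space: "(\<lambda>_. 0) \<in> V_P_space \<alpha>"
  by (simp add: V_P_space_def V_P_def)

text \<open>The coefficient functional is itself a member of V_w: take it as one summand and zero
  for all others.\<close>

lemma V_perp_coeff:
  assumes "(2::'a::field) \<noteq> 0" "i \<le> 3" "j \<le> 1"
    and f: "(f :: 'a form) \<in> V_perp xQ w" and "aff_val (weight_root i j) (w xQ) \<le> 0"
  shows "form_coeff i j f = 0"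
proof -
  define S where "S = {\<alpha> \<in> real_aff_roots. aff_val \<alpha> x_P = 1 / real m_P \<and> aff_val \<alpha> (w xQ) \<le> 0}"
  have fin: "finite S" unfolding S_def by (rule finite_depth_roots)
  have mem: "weight_root i j \<in> S" using assms weight_root_mem by (simp add: S_def)
  define v where "v \<alpha> = (if \<alpha> = weight_root i j then coeff_functional i j else (\<lambda>_. 0 :: 'a))" for \<alpha>
  have v: "\<forall>\<alpha>\<in>S. v \<alpha> \<in> V_P_space \<alpha>"
    using coeff_functional_in_V_P_space[OF assms(1-3)] by (simp add: v_def zero_in_V_P_space)
  have "(\<lambda>f. \<Sum>\<alpha>\<in>S. v \<alpha> f) = coeff_functional i j"
  proof
    fix f :: "'a form"
    have "(\<Sum>\<alpha>\<in>S. v \<alpha> f) = (\<Sum>\<alpha>\<in>S. if \<alpha> = weight_root i j then coeff_functional i j f else 0)"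
      by (intro sum.cong) (simp_all add: v_def)
    then show "(\<Sum>\<alpha>\<in>S. v \<alpha> f) = coeff_functional i j f" using fin mem by simp
  qed
  moreover have "(\<lambda>f. \<Sum>\<alpha>\<in>S. v \<alpha> f) \<in> V_sub xQ w"
    unfolding V_sub_def Let_def S_def[symmetric] mem_Collect_eq using v by (intro exI[of _ v] conjI refl)
  ultimately have "coeff_functional i j f = 0" using f unfolding V_perp_def by simp
  then show ?thesis using f by (simp add: coeff_functional_def V_perp_def)
qed

lemma subst_psi_form_of:
  "subst (g, h) psi = form_of (\<lambda>i j. of_nat (3 choose i) *
     ((g$1$1)^(3 - i) * (g$2$1)^i * (if j = 0 then h$1$1 else h$2$1) +
      (g$1$2)^(3 - i) * (g$2$2)^i * (if j = 0 then h$1$2 else h$2$2)))"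
proof -
  have "(3 choose 1) = 3" "(3 choose 2) = 3" by (simp_all add: eval_nat_numeral)
  then show ?thesis
    by (simp add: fun_eq_iff subst_def psi_def form_of_expand vector_matrix_mult_def sum_2)
       (simp add: power2_eq_square power3_eq_cube algebra_simps)
qed

lemma act_psi_in_V_dual:
  assumes "l \<in> carrier Levi"
  shows "act l psi \<in> V_dual"
proof -
  obtain g h where "l = cls (g, h)" using Levi_cases[OF assms] by metis
  then show ?thesis by (simp only: act_cls[OF psi_in_V_dual] subst_psi_form_of V_dual_eq rangeI)
qed

text \<open>Eliminating between the equations leaves q^2 U = 0 and p^2 V = 0 up to the nonzero
  determinant. As neither (p, q) nor (U, V) is zero, both points of the projective line are
  coordinate points.\<close>

lemma proportional_cubes:
  fixes p q p' q' U V :: "'a::field"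
  assumes "q^3 * U = p^3 * V" "q^2 * q' * U = p^2 * p' * V" "p' * q - p * q' \<noteq> 0"
    and "U \<noteq> 0 \<or> V \<noteq> 0"
  shows "p * q = 0" "U * V = 0"
proof -
  have "q^2 * (p' * q - p * q') * U = p' * (q^3 * U) - p * (q^2 * q' * U)"
    by (simp add: power2_eq_square power3_eq_cube algebra_simps)
  also have "\<dots> = 0" unfolding assms(1,2) by (simp add: power2_eq_square power3_eq_cube algebra_simps)
  finally have 1: "q = 0 \<or> U = 0" using assms(3) by simp
  have "p^2 * (p' * q - p * q') * V = q * (p^2 * p' * V) - q' * (p^3 * V)"
    by (simp add: power2_eq_square power3_eq_cube algebra_simps)
  also have "\<dots> = 0" unfolding assms(1,2)[symmetric] by (simp add: power2_eq_square power3_eq_cube algebra_simps)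
  finally have 2: "p = 0 \<or> V = 0" using assms(3) by simp
  show "p * q = 0" "U * V = 0" using 1 2 assms(3,4) by auto
qed

text \<open>A diagonal matrix moves a line by a wedge proportional to the product of its two
  coordinates, so a coordinate line in each factor is fixed.\<close>

lemma T_psi_fixes_flag:
  assumes det: "det g = 1" "det h = 1" and "s \<noteq> 0"
    and R: "short_sign e \<in> R" "long_sign e' \<in> R"
    and col: "fst (flag_col e g) * snd (flag_col e g) = 0" "fst (flag_col e' h) * snd (flag_col e' h) = 0"
  shows "cls (psi_rep s) <#\<^bsub>Levi\<^esub> (cls (g, h) <#\<^bsub>Levi\<^esub> parabolic R) = cls (g, h) <#\<^bsub>Levi\<^esub> parabolic R"
proof -
  let ?a = "mat2 s 0 0 (inverse s)" and ?b = "mat2 (inverse (s^3)) 0 0 (s^3)"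
  have dab: "det ?a = 1" "det ?b = 1" using \<open>s \<noteq> 0\<close> by simp_all
  have wedge: "wedge (flag_col e k) (flag_col e (mat2 x 0 0 y ** k)) =
      fst (flag_col e k) * snd (flag_col e k) * (y - x)" for k and x y :: 'a and e
    by (simp add: wedge_def flag_col_def mult_nth2 algebra_simps)
  have "adj2 g ** (?a ** g) \<in> borel2 e"
    using det dab by (subst adj2_mult_in_borel2) (simp_all only: det_mul wedge col mult_zero_left mult_1)
  moreover have "adj2 h ** (?b ** h) \<in> borel2 e'"
    using det dab by (subst adj2_mult_in_borel2) (simp_all only: det_mul wedge col mult_zero_left mult_1)
  ultimately have "cls (adj2 g ** (?a ** g), adj2 h ** (?b ** h)) \<in> parabolic R"
    by (rule borel2_prod_in_parabolic[OF R])
  then have "inv\<^bsub>Levi\<^esub> (cls (g, h)) \<otimes>\<^bsub>Levi\<^esub> (cls (psi_rep s) \<otimes>\<^bsub>Levi\<^esub> cls (g, h)) \<in> parabolic R"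
    using det dab by (simp only: psi_rep_def cls_inv cls_mult det_mul det_adj2 mult_1)
  moreover have c: "cls (g, h) \<in> carrier Levi" "cls (psi_rep s) \<in> carrier Levi"
    using det psi_rep_in_T_psi[OF \<open>s \<noteq> 0\<close>] T_psi_subset by (auto simp only: cls_in_Levi)
  ultimately have eq: "cls (g, h) <#\<^bsub>Levi\<^esub> parabolic R = (cls (psi_rep s) \<otimes>\<^bsub>Levi\<^esub> cls (g, h)) <#\<^bsub>Levi\<^esub> parabolic R"
    by (subst Levi.l_coset_eq_iff[OF subgroup_parabolic]) (simp_all only: Levi.m_closed)
  show ?thesis
    unfolding Levi.lcos_m_assoc[OF subgroup.subset[OF subgroup_parabolic] c(2,1)] by (rule eq[symmetric])
qed

lemma sign_in_para_roots:
  "short_sign e \<in> para_roots z \<longleftrightarrow> (if e then 0 \<le> snd z else snd z \<le> 0)"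
  "long_sign e \<in> para_roots z \<longleftrightarrow>
     (if e then 1 \<le> 2 * fst z + 3 * snd z else 2 * fst z + 3 * snd z \<le> 1)"
  by (cases e; simp only: short_sign_def long_sign_def para_roots_iff if_True if_False)+

lemma Y_var_T_psi_fixed:
  fixes y :: "'a::field levi set"
  assumes char: "(2::'a) \<noteq> 0" "(3::'a) \<noteq> 0"
    and z: "w xQ = ((1 + r - 3 * t) / 2, t)" "t \<noteq> 0"
      "3 * \<bar>t\<bar> - \<bar>r\<bar> \<ge> 1 \<or> (r \<noteq> 0 \<and> 3 * \<bar>t\<bar> + \<bar>r\<bar> \<ge> 1 \<and> \<bar>t\<bar> + \<bar>r\<bar> \<ge> 1)"
    and y: "y \<in> Y_var xQ w" and s: "s \<noteq> 0"
  shows "cls (psi_rep s) <#\<^bsub>Levi\<^esub> y = y"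
proof -
  obtain l where l: "y = l <#\<^bsub>Levi\<^esub> Q_sub xQ w" "l \<in> carrier Levi" "act (inv\<^bsub>Levi\<^esub> l) psi \<in> V_perp xQ w"
    using y unfolding Y_var_def mem_Collect_eq by (elim exE conjE)
  obtain g h where gh: "l = cls (g, h)" and det: "det g = 1" "det h = 1" using l(2) by (rule Levi_cases)
  \<comment> \<open>\<open>(U j, V j)\<close> are the rows of the inverse of h, j = 0 belonging to u
    and j = 1 to v.\<close>
  define U V where "U j = (if j = 0 then h$2$2 else - h$2$1)" and "V j = (if j = 0 then - h$1$2 else h$1$1)" for j :: nat
  let ?f = "act (inv\<^bsub>Levi\<^esub> l) psi"
  have f: "?f = form_of (\<lambda>i j. of_nat (3 choose i) *
      ((g$2$2)^(3 - i) * (- g$2$1)^i * U j + (- g$1$2)^(3 - i) * (g$1$1)^i * V j))"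
    unfolding gh cls_inv[OF det] act_cls[OF psi_in_V_dual] subst_psi_form_of by (simp add: adj2_def U_def V_def cong: if_cong)
  have vanish: "of_nat (3 choose i) * ((g$2$2)^(3 - i) * (- g$2$1)^i * U j + (- g$1$2)^(3 - i) * (g$1$1)^i * V j) = 0"
    if "i \<le> 3" "j \<le> 1" "aff_val (weight_root i j) (w xQ) \<le> 0" for i j
    using V_perp_coeff[OF char(1) that(1,2) l(3) that(3)] unfolding f form_coeff_form_of[OF char(1) that(1,2)] .
  have choose: "(3 choose 1) = 3" "(3 choose 2) = 3" by (simp_all add: eval_nat_numeral)
  have val: "aff_val (weight_root i j) (w xQ) = (1 + (if j = 0 then - r else r) + (2 * real i - 3) * t) / 2" for i j
    by (simp add: weight_root_def z(1) field_simps)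
  \<comment> \<open>The sign of t decides which end of the cubic is killed, x^3 and x^2 y or y^3 and
    x y^2. Accordingly (p, q) is the column of g defining the flag and (p', q') the other
    one.\<close>
  define up where "up = (t > 0)"
  define p q p' q' where "p = (if up then g$1$2 else g$1$1)" and "q = (if up then g$2$2 else g$2$1)"
    and "p' = (if up then g$1$1 else g$1$2)" and "q' = (if up then g$2$1 else g$2$2)"
  have outer: "q^3 * U j = p^3 * V j" if "j \<le> 1" "1 + (if j = 0 then - r else r) \<le> 3 * \<bar>t\<bar>" for j
  proof (cases up)
    case True
    then have "aff_val (weight_root 0 j) (w xQ) \<le> 0" using that(2) by (simp add: val up_def)
    from vanish[OF _ that(1) this] True show ?thesis by (simp add: p_def q_def power3_eq_cube algebra_simps)
  next
    case False
    then have "aff_val (weight_root 3 j) (w xQ) \<le> 0" using that(2) z(2) by (simp add: val up_def)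
    from vanish[OF _ that(1) this] False show ?thesis by (simp add: p_def q_def power3_eq_cube algebra_simps)
  qed
  have inner: "q^2 * q' * U j = p^2 * p' * V j" if "j \<le> 1" "1 + (if j = 0 then - r else r) \<le> \<bar>t\<bar>" for j
  proof (cases up)
    case True
    then have "aff_val (weight_root 1 j) (w xQ) \<le> 0" using that(2) by (simp add: val up_def)
    from vanish[OF _ that(1) this] True char(2) show ?thesis
      by (simp add: p_def q_def p'_def q'_def power2_eq_square choose algebra_simps)
  next
    case False
    then have "aff_val (weight_root 2 j) (w xQ) \<le> 0" using that(2) z(2) by (simp add: val up_def)
    from vanish[OF _ that(1) this] False char(2) show ?thesis
      by (simp add: p_def q_def p'_def q'_def power2_eq_square choose algebra_simps)
  qed
  have det': "p' * q - p * q' \<noteq> 0"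
  proof -
    have "p' * q - p * q' = (if up then det g else - det g)"
      by (simp add: p_def q_def p'_def q'_def det_2)
    then show ?thesis by (simp add: det)
  qed
  have UV: "U 0 * V 1 - U 1 * V 0 = 1" using det(2) by (simp add: U_def V_def det_2 algebra_simps)
  show ?thesis
  proof (cases "3 * \<bar>t\<bar> - \<bar>r\<bar> \<ge> 1")
    case True
    \<comment> \<open>Both coefficients at the outer monomial vanish; inverting the matrix of
      \<open>U\<close>, \<open>V\<close> gives p = q = 0, against the determinant. So Y_w is
      empty.\<close>
    have eqs: "q^3 * U 0 = p^3 * V 0" "q^3 * U 1 = p^3 * V 1"
      by (rule outer; use True in simp)+
    have "q^3 = (q^3 * U 0) * V 1 - (q^3 * U 1) * V 0"
      using arg_cong[OF UV, of "\<lambda>x. q^3 * x"] by (simp add: algebra_simps)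
    also have "\<dots> = 0" unfolding eqs by (simp add: algebra_simps)
    finally have "q = 0" by simp
    have "p^3 = U 0 * (p^3 * V 1) - U 1 * (p^3 * V 0)"
      using arg_cong[OF UV, of "\<lambda>x. p^3 * x"] by (simp add: algebra_simps)
    also have "\<dots> = 0" unfolding eqs[symmetric] by (simp add: algebra_simps)
    finally have "p = 0" by simp
    with \<open>q = 0\<close> det' show ?thesis by simp
  next
    case False
    then have r: "r \<noteq> 0" "3 * \<bar>t\<bar> + \<bar>r\<bar> \<ge> 1" "\<bar>t\<bar> + \<bar>r\<bar> \<ge> 1" using z(3) by auto
    \<comment> \<open>Of u and v, the variable for which r enters the inequality as -|r|, so that
      the inner coefficient vanishes too.\<close>
    define j :: nat where "j = (if r > 0 then 0 else 1)"
    have j: "j \<le> 1" "(if j = 0 then - r else r) = - \<bar>r\<bar>" using r(1) by (auto simp: j_def)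
    have "U j \<noteq> 0 \<or> V j \<noteq> 0" using UV by (auto simp: j_def)
    moreover have "q^3 * U j = p^3 * V j" by (rule outer[OF j(1)]) (use r j(2) in simp)
    moreover have "q^2 * q' * U j = p^2 * p' * V j" by (rule inner[OF j(1)]) (use r j(2) in simp)
    ultimately have "p * q = 0" "U j * V j = 0" using proportional_cubes[OF _ _ det'] by metis+
    then have "fst (flag_col up g) * snd (flag_col up g) = 0"
      "fst (flag_col (r > 0) h) * snd (flag_col (r > 0) h) = 0"
      by (auto simp: flag_col_def p_def q_def U_def V_def j_def split: if_splits)
    moreover have "short_sign up \<in> para_roots (w xQ)"
      unfolding sign_in_para_roots using z by (simp add: up_def)
    moreover have "long_sign (r > 0) \<in> para_roots (w xQ)"
      unfolding sign_in_para_roots using r(1) by (simp add: z(1) field_simps)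
    ultimately show ?thesis unfolding l(1) gh Q_sub_def by (intro T_psi_fixes_flag det s)
  qed
qed

section \<open>The open orbit\<close>

definition bary :: "bool \<Rightarrow> apt" where
  "bary e = (if e then (1/4, 1/6) else (3/4, -1/6))"

abbreviation Q_short :: "bool \<Rightarrow> 'a::field levi set" where
  "Q_short e \<equiv> parabolic {highest_root, - highest_root, short_sign e}"

lemma Q_sub_bary: "Q_sub (bary e) id = Q_short e"
proof -
  have "para_roots (bary e) = {highest_root, - highest_root, short_sign e}"
    by (cases e) (auto simp: bary_def para_roots_eq short_sign_def)
  then show ?thesis by (simp add: Q_sub_def)
qed

text \<open>At the barycenter t is 1/6 or -1/6 and r = 0, so the affine roots of depth 1/2 take the
  values (1 + (2i - 3) t) / 2, at least 1/4. Thus V_w = 0.\<close>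

lemma V_perp_bary: "V_perp (bary e) id = V_dual"
proof -
  have "aff_val \<alpha> (bary e) > 0" if "\<alpha> \<in> real_aff_roots" "aff_val \<alpha> x_P = 1 / real m_P" for \<alpha>
  proof -
    obtain c1 c2 n where \<alpha>: "\<alpha> = (c1, c2, n)" by (metis prod_cases3)
    have "real_of_int (c1 + 2 * n) = real_of_int 1" using that(2) by (simp add: \<alpha> x_P_eq m_P_eq)
    then have n: "c1 + 2 * n = 1" by (simp only: of_int_eq_iff)
    have "(c1, c2) \<in> g2_roots" using that(1) by (simp add: \<alpha> real_aff_roots_def)
    then have "(c1 = 1 \<and> n = 0 \<and> 0 \<le> c2 \<and> c2 \<le> 3) \<or> (c1 = -1 \<and> n = 1 \<and> -3 \<le> c2 \<and> c2 \<le> 0)"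
      using n unfolding g2_root_cases prod.inject by presburger
    then have "0 \<le> c2 \<and> c2 \<le> 3 \<and> c1 = 1 \<and> n = 0 \<or> 0 \<le> - c2 \<and> - c2 \<le> 3 \<and> c1 = -1 \<and> n = 1" by auto
    then have "0 \<le> real_of_int c2 \<and> real_of_int c2 \<le> 3 \<and> c1 = 1 \<and> n = 0 \<or>
        0 \<le> - real_of_int c2 \<and> - real_of_int c2 \<le> 3 \<and> c1 = -1 \<and> n = 1" by linarith
    then show ?thesis by (cases e) (auto simp: \<alpha> bary_def)
  qed
  then have empty: "{\<alpha> \<in> real_aff_roots. aff_val \<alpha> x_P = 1 / real m_P \<and> aff_val \<alpha> (bary e) \<le> 0} = {}"
    by (auto simp only: not_le[symmetric])
  have "V_sub (bary e) id = {\<lambda>f :: 'a form. 0}"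
    unfolding V_sub_def Let_def id_apply empty by simp
  then show ?thesis by (simp add: V_perp_def)
qed

lemma flags_bary: "flags (bary e) id = {l <#\<^bsub>Levi\<^esub> Q_short e | l. l \<in> carrier Levi}"
  by (simp only: flags_def Q_sub_bary)

lemma Y_var_bary: "Y_var (bary e) id = flags (bary e) id"
proof -
  have "act (inv\<^bsub>Levi\<^esub> l) psi \<in> V_perp (bary e) id" if "l \<in> carrier Levi" for l :: "'a levi"
    unfolding V_perp_bary using that by (intro act_psi_in_V_dual Levi.inv_closed)
  then show ?thesis unfolding Y_var_def flags_def by meson
qed

lemma flag_cases:
  assumes "x \<in> flags (bary e) id"
  obtains g h where "x = cls (g, h) <#\<^bsub>Levi\<^esub> Q_short e" "det g = 1" "det h = 1"
proof -
  obtain l where "l \<in> carrier Levi" "x = l <#\<^bsub>Levi\<^esub> Q_short e"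
    using assms unfolding flags_bary mem_Collect_eq by (elim exE conjE)
  then show thesis using that Levi_cases by metis
qed

text \<open>On the flag variety $\mathbb P^1$ the element \<open>s\<close> of $T_\psi$ scales the coordinate by \<open>s\<^sup>2\<close>,
  so the open orbit is where both coordinates are nonzero.\<close>

lemma flag_move:
  assumes "det g = 1" "det h = 1" "s \<noteq> 0"
  shows "cls (psi_rep s) <#\<^bsub>Levi\<^esub> (cls (g, h) <#\<^bsub>Levi\<^esub> Q_short e) =
    cls (fst (psi_rep s) ** g, snd (psi_rep s) ** h) <#\<^bsub>Levi\<^esub> Q_short e"
    and "det (fst (psi_rep s) ** g) = 1" "det (snd (psi_rep s) ** h) = 1"
    and "flag_col e (fst (psi_rep s) ** g) = (s * fst (flag_col e g), inverse s * snd (flag_col e g))"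
proof -
  have d: "det (fst (psi_rep s)) = 1" "det (snd (psi_rep s)) = 1"
    using assms(3) by (simp_all add: psi_rep_def)
  then show "det (fst (psi_rep s) ** g) = 1" "det (snd (psi_rep s) ** h) = 1"
    using assms by (simp_all add: det_mul)
  show "flag_col e (fst (psi_rep s) ** g) = (s * fst (flag_col e g), inverse s * snd (flag_col e g))"
    by (simp add: flag_col_def psi_rep_def mult_nth2)
  have "cls (psi_rep s) \<in> carrier Levi" "cls (g, h) \<in> carrier Levi"
    using psi_rep_in_T_psi[OF assms(3)] T_psi_subset assms by (auto simp only: cls_in_Levi)
  from Levi.lcos_m_assoc[OF subgroup.subset[OF subgroup_parabolic] this]
  have "cls (psi_rep s) <#\<^bsub>Levi\<^esub> (cls (g, h) <#\<^bsub>Levi\<^esub> Q_short e) =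
      (cls (psi_rep s) \<otimes>\<^bsub>Levi\<^esub> cls (g, h)) <#\<^bsub>Levi\<^esub> Q_short e" .
  also have "cls (psi_rep s) \<otimes>\<^bsub>Levi\<^esub> cls (g, h) = cls (fst (psi_rep s) ** g, snd (psi_rep s) ** h)"
    using cls_mult[OF d assms(1,2)] by simp
  finally show "cls (psi_rep s) <#\<^bsub>Levi\<^esub> (cls (g, h) <#\<^bsub>Levi\<^esub> Q_short e) =
    cls (fst (psi_rep s) ** g, snd (psi_rep s) ** h) <#\<^bsub>Levi\<^esub> Q_short e" .
qed

lemma flag_move_eq_iff:
  assumes "det g = 1" "det h = 1" "det g' = 1" "det h' = 1" "s \<noteq> 0"
  shows "cls (psi_rep s) <#\<^bsub>Levi\<^esub> (cls (g, h) <#\<^bsub>Levi\<^esub> Q_short e) = cls (g', h') <#\<^bsub>Levi\<^esub> Q_short e \<longleftrightarrow>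
    s^2 * fst (flag_col e g) * snd (flag_col e g') = snd (flag_col e g) * fst (flag_col e g')"
proof -
  have "cls (psi_rep s) <#\<^bsub>Levi\<^esub> (cls (g, h) <#\<^bsub>Levi\<^esub> Q_short e) = cls (g', h') <#\<^bsub>Levi\<^esub> Q_short e \<longleftrightarrow>
      wedge (s * fst (flag_col e g), inverse s * snd (flag_col e g)) (flag_col e g') = 0"
    unfolding flag_move(1)[OF assms(1,2,5)]
      flag_eq_iff[OF flag_move(2,3)[OF assms(1,2,5)] assms(3,4) refl] flag_move(4)[OF assms(1,2,5)] ..
  \<comment> \<open>The factor s clears the inverse and leaves s^2, the parameter of T_psi.\<close>
  also have "\<dots> \<longleftrightarrow> s * wedge (s * fst (flag_col e g), inverse s * snd (flag_col e g)) (flag_col e g') = 0"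
    using assms(5) by simp
  also have "s * wedge (s * fst (flag_col e g), inverse s * snd (flag_col e g)) (flag_col e g') =
      s^2 * fst (flag_col e g) * snd (flag_col e g') - snd (flag_col e g) * fst (flag_col e g')"
    using assms(5) by (simp add: wedge_def power2_eq_square algebra_simps)
  finally show ?thesis by simp
qed

lemma flag_col_nonzero: "det g = 1 \<Longrightarrow> fst (flag_col e g) \<noteq> 0 \<or> snd (flag_col e g) \<noteq> 0"
  by (auto simp: flag_col_def det_2)

definition base_mat :: "bool \<Rightarrow> 'a::field mat2" where
  "base_mat e = (if e then mat2 1 1 0 1 else mat2 1 0 1 1)"

lemma base_mat: "det (base_mat e) = 1" "flag_col e (base_mat e) = (1, 1)"
  by (simp_all add: base_mat_def flag_col_def)

definition open_orbit :: "bool \<Rightarrow> 'a::field levi set set" where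
  "open_orbit e = flag_orbit T_psi (cls (base_mat e, mat 1) <#\<^bsub>Levi\<^esub> Q_short e)"

lemma mem_open_orbit_iff:
  fixes g h :: "'a::alg_closed_field mat2"
  assumes "det g = 1" "det h = 1"
  shows "cls (g, h) <#\<^bsub>Levi\<^esub> Q_short e \<in> open_orbit e \<longleftrightarrow> fst (flag_col e g) * snd (flag_col e g) \<noteq> 0"
proof -
  have "cls (g, h) <#\<^bsub>Levi\<^esub> Q_short e \<in> open_orbit e \<longleftrightarrow>
      (\<exists>s. s \<noteq> 0 \<and> cls (psi_rep s) <#\<^bsub>Levi\<^esub> (cls (base_mat e, mat 1) <#\<^bsub>Levi\<^esub> Q_short e) =
        cls (g, h) <#\<^bsub>Levi\<^esub> Q_short e)"
    unfolding open_orbit_def flag_orbit_def T_psi_eq mem_Collect_eq by metis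
  also have "\<dots> \<longleftrightarrow> (\<exists>s. s \<noteq> 0 \<and> s^2 * snd (flag_col e g) = fst (flag_col e g))"
    by (intro ex_cong1 conj_cong refl, subst flag_move_eq_iff)
      (simp_all add: base_mat assms det_I)
  also have "\<dots> \<longleftrightarrow> fst (flag_col e g) * snd (flag_col e g) \<noteq> 0"
  proof
    assume "\<exists>s. s \<noteq> 0 \<and> s^2 * snd (flag_col e g) = fst (flag_col e g)"
    then show "fst (flag_col e g) * snd (flag_col e g) \<noteq> 0"
      using flag_col_nonzero[OF assms(1), of e] by auto
  next
    assume nz: "fst (flag_col e g) * snd (flag_col e g) \<noteq> 0"
    obtain s where s: "s^2 = fst (flag_col e g) / snd (flag_col e g)"
      using nth_root_exists[of 2] by (metis zero_less_numeral)
    then have "s \<noteq> 0" "s^2 * snd (flag_col e g) = fst (flag_col e g)" using nz by auto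
    then show "\<exists>s. s \<noteq> 0 \<and> s^2 * snd (flag_col e g) = fst (flag_col e g)" by metis
  qed
  finally show ?thesis .
qed

lemma base_in_flags: "cls (base_mat e, mat 1) <#\<^bsub>Levi\<^esub> Q_short e \<in> flags (bary e) id"
proof -
  have "cls (base_mat e, mat 1) \<in> carrier Levi" by (intro cls_in_Levi base_mat det_I)
  then show ?thesis unfolding flags_bary mem_Collect_eq by metis
qed

lemma open_orbit_subset: "open_orbit e \<subseteq> flags (bary e) id"
proof
  fix x :: "'a levi set" assume "x \<in> open_orbit e"
  then obtain b where b: "b \<in> T_psi" "x = b <#\<^bsub>Levi\<^esub> (cls (base_mat e, mat 1) <#\<^bsub>Levi\<^esub> Q_short e)"
    unfolding open_orbit_def flag_orbit_def mem_Collect_eq by metis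
  obtain s where s: "s \<noteq> 0" "b = cls (psi_rep s)" using b(1) by (rule T_psi_cases)
  have x: "x = cls (fst (psi_rep s) ** base_mat e, snd (psi_rep s) ** mat 1) <#\<^bsub>Levi\<^esub> Q_short e"
    unfolding b(2) s(2) by (rule flag_move(1)[OF base_mat(1) det_I s(1)])
  have "cls (fst (psi_rep s) ** base_mat e, snd (psi_rep s) ** mat 1) \<in> carrier Levi"
    by (intro cls_in_Levi flag_move(2,3)[OF base_mat(1) det_I s(1)])
  then show "x \<in> flags (bary e) id" unfolding flags_bary mem_Collect_eq x by metis
qed

lemma mem_Union_flags_iff:
  assumes "Y \<subseteq> flags (bary e) id"
  shows "l \<in> \<Union>Y \<longleftrightarrow> l \<in> carrier Levi \<and> l <#\<^bsub>Levi\<^esub> Q_short e \<in> Y"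
proof
  assume "l \<in> \<Union>Y"
  then obtain y where y: "y \<in> Y" "l \<in> y" by (elim UnionE)
  then have "y \<in> flags (bary e) id" using assms by (simp only: subsetD)
  then obtain l' where l': "l' \<in> carrier Levi" "y = l' <#\<^bsub>Levi\<^esub> Q_short e"
    unfolding flags_bary mem_Collect_eq by metis
  have "l \<in> carrier Levi"
    using Levi.l_coset_subset_G[OF subgroup.subset[OF subgroup_parabolic] l'(1)] y(2) unfolding l'(2) by (rule subsetD)
  moreover have "l' <#\<^bsub>Levi\<^esub> Q_short e = l <#\<^bsub>Levi\<^esub> Q_short e"
    using Levi.l_repr_independence[OF _ l'(1) subgroup_parabolic] y(2) unfolding l'(2) by metis
  ultimately show "l \<in> carrier Levi \<and> l <#\<^bsub>Levi\<^esub> Q_short e \<in> Y" using y(1) l'(2) by simp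
next
  assume l: "l \<in> carrier Levi \<and> l <#\<^bsub>Levi\<^esub> Q_short e \<in> Y"
  have "\<one>\<^bsub>Levi\<^esub> \<in> Q_short e" by (rule subgroup.one_closed[OF subgroup_parabolic])
  then have "l \<otimes>\<^bsub>Levi\<^esub> \<one>\<^bsub>Levi\<^esub> \<in> l <#\<^bsub>Levi\<^esub> Q_short e" unfolding l_coset_def by (intro UN_I) simp_all
  then show "l \<in> \<Union>Y" using l by (auto simp only: Levi.r_one)
qed

lemma is_open_orbit_open_orbit:
  "is_open_orbit T_psi (flags (bary e) id) (open_orbit e :: 'a::alg_closed_field levi set set)"
  unfolding is_open_orbit_def
proof (intro conjI open_orbit_subset)
  show "\<exists>y\<in>flags (bary e) id. open_orbit e = flag_orbit T_psi (y :: 'a levi set)"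
    using base_in_flags open_orbit_def by (rule bexI[rotated])
  have all: "\<Union> (flags (bary e) id) = (carrier Levi :: 'a levi set)"
  proof (intro Set.set_eqI)
    fix l :: "'a levi"
    show "l \<in> \<Union> (flags (bary e) id) \<longleftrightarrow> l \<in> carrier Levi"
      unfolding mem_Union_flags_iff[OF subset_refl] unfolding flags_bary mem_Collect_eq by metis
  qed
  let ?f = "\<lambda>x :: 'a mat2 \<times> 'a mat2. fst (flag_col e (fst x)) * snd (flag_col e (fst x))"
  have poly: "?f \<in> poly_funs" by (cases e) (auto simp: flag_col_def intro!: poly_funs.intros)
  have neg: "?f (- x) = 0 \<longleftrightarrow> ?f x = 0" for x by (simp add: flag_col_def)
  have "\<Union> (open_orbit e) = {l \<in> carrier Levi. \<exists>x\<in>l. ?f x \<noteq> 0}"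
  proof (intro Set.set_eqI)
    fix l :: "'a levi"
    have "l <#\<^bsub>Levi\<^esub> Q_short e \<in> open_orbit e \<longleftrightarrow> (\<exists>x\<in>l. ?f x \<noteq> 0)" if "l \<in> carrier Levi"
    proof -
      obtain g h where gh: "l = cls (g, h)" "det g = 1" "det h = 1" using \<open>l \<in> carrier Levi\<close> by (rule Levi_cases)
      show ?thesis unfolding gh(1) mem_open_orbit_iff[OF gh(2,3)] by (simp add: cls_eq flag_col_def)
    qed
    then show "l \<in> \<Union> (open_orbit e) \<longleftrightarrow> l \<in> {l \<in> carrier Levi. \<exists>x\<in>l. ?f x \<noteq> 0}"
      unfolding mem_Union_flags_iff[OF open_orbit_subset] mem_Collect_eq by (rule conj_cong[OF refl])
  qed
  then have "openin zariski_Levi (\<Union> (open_orbit e :: 'a levi set set))"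
    using openin_Levi_nonvanishing[OF poly _ neg] by simp
  moreover have "\<Union> (open_orbit e :: 'a levi set set) \<subseteq> \<Union> (flags (bary e) id)"
    by (rule Union_mono[OF open_orbit_subset])
  ultimately show "openin (subtopology zariski_Levi (\<Union> (flags (bary e) id))) (\<Union> (open_orbit e :: 'a levi set set))"
    unfolding all by (metis inf.absorb1 openin_subtopology_Int)
qed

lemma flag_stab_open_orbit:
  fixes x :: "'a::alg_closed_field levi set"
  assumes "x \<in> open_orbit e"
  shows "flag_stab T_psi x = {\<one>\<^bsub>Levi\<^esub>}"
proof -
  obtain g h where x: "x = cls (g, h) <#\<^bsub>Levi\<^esub> Q_short e" "det g = 1" "det h = 1"
    using subsetD[OF open_orbit_subset assms] by (rule flag_cases)
  have nz: "fst (flag_col e g) * snd (flag_col e g) \<noteq> 0"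
    using assms unfolding x(1) mem_open_orbit_iff[OF x(2,3)] .
  have fix_iff: "cls (psi_rep s) <#\<^bsub>Levi\<^esub> x = x \<longleftrightarrow> cls (psi_rep s) = \<one>\<^bsub>Levi\<^esub>" if "s \<noteq> 0" for s
  proof -
    have "cls (psi_rep s) <#\<^bsub>Levi\<^esub> x = x \<longleftrightarrow> s^2 = 1"
      unfolding x(1) flag_move_eq_iff[OF x(2,3,2,3) that] using nz by simp
    then show ?thesis unfolding psi_rep_one[symmetric] cls_psi_rep_eq_iff by auto
  qed
  show ?thesis
  proof (intro Set.set_eqI)
    fix l :: "'a levi"
    have "l <#\<^bsub>Levi\<^esub> x = x \<longleftrightarrow> l = \<one>\<^bsub>Levi\<^esub>" if "l \<in> T_psi"
      using T_psi_cases[OF that] fix_iff by metis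
    then show "l \<in> flag_stab T_psi x \<longleftrightarrow> l \<in> {\<one>\<^bsub>Levi\<^esub>}"
      using subgroup.one_closed[OF T_psi_subgroup] unfolding flag_stab_def mem_Collect_eq singleton_iff by metis
  qed
qed

lemma flag_stab_eq_T_psi:
  assumes "\<And>s. s \<noteq> 0 \<Longrightarrow> cls (psi_rep s) <#\<^bsub>Levi\<^esub> y = y"
  shows "flag_stab T_psi y = T_psi"
proof -
  have "l <#\<^bsub>Levi\<^esub> y = y" if "l \<in> T_psi" for l using T_psi_cases[OF that] assms by metis
  then show ?thesis unfolding flag_stab_def by (simp add: Collect_conv_if set_eq_iff) metis
qed

lemma flag_stab_boundary:
  fixes x :: "'a::alg_closed_field levi set"
  assumes "x \<in> flags (bary e) id - open_orbit e"
  shows "flag_stab T_psi x = T_psi"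
proof (rule flag_stab_eq_T_psi)
  fix s :: 'a assume s: "s \<noteq> 0"
  obtain g h where x: "x = cls (g, h) <#\<^bsub>Levi\<^esub> Q_short e" "det g = 1" "det h = 1"
    using assms by (elim DiffE flag_cases)
  have "fst (flag_col e g) * snd (flag_col e g) = 0"
    using assms unfolding x(1) Diff_iff mem_open_orbit_iff[OF x(2,3)] by simp
  then show "cls (psi_rep s) <#\<^bsub>Levi\<^esub> x = x"
    unfolding x(1) flag_move_eq_iff[OF x(2,3,2,3) s] by (auto simp: mult.assoc)
qed

section \<open>Lie algebras of stabilizers\<close>

lemma poly_eqI_alg_closed:
  fixes p q :: "'a::alg_closed_field poly"
  assumes "\<And>x. poly p x = poly q x"
  shows "p = q"
proof (rule ccontr)
  assume "p \<noteq> q"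
  then have "finite {x. poly (p - q) x = 0}" by (intro poly_roots_finite) simp
  moreover have "{x. poly (p - q) x = 0} = UNIV" using assms by simp
  ultimately show False using infinite_UNIV_alg_closed[where 'a = 'a] by simp
qed

text \<open>\<open>lie_of\<close> asserts only that some \<open>q\<close> exists; over an infinite
  field it must be the explicit expansion \<open>r\<close>, whose linear coefficient can be read
  off.\<close>

lemma lie_of_coeff:
  fixes H :: "'a::alg_closed_field levi set"
  assumes "d \<in> lie_of H" "f \<in> poly_funs" "\<And>x. x \<in> \<Union>H \<Longrightarrow> f x = 0"
    and "\<And>s. poly r s = f (mat 1 + map_matrix ((*) s) (fst d), mat 1 + map_matrix ((*) s) (snd d))"
  shows "poly.coeff r 1 = 0"
proof -
  have "(\<forall>x\<in>\<Union>H. f x = 0) \<longrightarrow> (\<exists>q. poly.coeff q 1 = 0 \<and>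
      (\<forall>s. poly q s = f (mat 1 + map_matrix ((*) s) (fst d), mat 1 + map_matrix ((*) s) (snd d))))"
    using assms(1)[unfolded lie_of_def mem_Collect_eq] assms(2) by (rule bspec)
  with assms(3) obtain q where q: "poly.coeff q 1 = 0"
    "\<And>s. poly q s = f (mat 1 + map_matrix ((*) s) (fst d), mat 1 + map_matrix ((*) s) (snd d))"
    by meson
  have "q = r" by (rule poly_eqI_alg_closed) (simp only: q(2) assms(4))
  with q(1) show ?thesis by simp
qed

lemma zero_in_lie_of:
  assumes "\<one>\<^bsub>Levi\<^esub> \<in> H"
  shows "0 \<in> lie_of H"
proof -
  have one: "(mat 1, mat 1) \<in> \<Union>H" using assms by (intro UnionI[of "\<one>\<^bsub>Levi\<^esub>"]) (simp_all add: cls_one cls_eq)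
  have zero: "map_matrix ((*) s) (0 :: 'a mat2) = 0" for s :: 'a
    by (simp add: map_matrix_def vec_eq_iff)
  show ?thesis unfolding lie_of_def mem_Collect_eq
  proof (intro ballI impI)
    fix f :: "'a mat2 \<times> 'a mat2 \<Rightarrow> 'a" assume "\<forall>x\<in>\<Union>H. f x = 0"
    then have "f (mat 1, mat 1) = 0" using one by (rule bspec)
    then show "\<exists>q. poly.coeff q 1 = 0 \<and>
        (\<forall>s. poly q s = f (mat 1 + map_matrix ((*) s) (fst 0), mat 1 + map_matrix ((*) s) (snd 0)))"
      by (intro exI[of _ 0]) (simp add: zero)
  qed
qed

text \<open>Linearized equations of T_psi: tangent vectors are pairs diag(-c, c), diag(3c,
  -3c).\<close>

lemma lie_of_T_psi:
  assumes "d \<in> lie_of (T_psi :: 'a::alg_closed_field levi set)"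
  shows "fst d $ 1 $ 2 = 0" "fst d $ 2 $ 1 = 0" "snd d $ 1 $ 2 = 0" "snd d $ 2 $ 1 = 0"
    "fst d $ 1 $ 1 + fst d $ 2 $ 2 = 0" "snd d $ 1 $ 1 = 3 * fst d $ 2 $ 2" "snd d $ 1 $ 1 + snd d $ 2 $ 2 = 0"
proof -
  have rep: "\<exists>s. s \<noteq> 0 \<and> x = psi_rep s" if "x \<in> \<Union>T_psi" for x :: "'a mat2 \<times> 'a mat2"
    using that unfolding mem_Union_Levi[OF T_psi_subset] cls_mem_T_psi_iff by simp
  have coeff: "poly.coeff r 1 = 0"
    if "f \<in> poly_funs" "\<And>s. s \<noteq> 0 \<Longrightarrow> f (psi_rep s) = 0"
      "\<And>s. poly r s = f (mat 1 + map_matrix ((*) s) (fst d), mat 1 + map_matrix ((*) s) (snd d))"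
    for f :: "'a mat2 \<times> 'a mat2 \<Rightarrow> 'a" and r
  proof (rule lie_of_coeff[OF assms that(1) _ that(3)])
    fix x :: "'a mat2 \<times> 'a mat2" assume "x \<in> \<Union>T_psi"
    then show "f x = 0" using rep that(2) by metis
  qed
  have "poly.coeff [:0, fst d $ 1 $ 2:] 1 = 0"
    by (rule coeff[of "\<lambda>x. fst x $ 1 $ 2"]) (simp_all add: psi_rep_def mat_def map_matrix_def poly_funs.intros)
  then show "fst d $ 1 $ 2 = 0" by simp
  have "poly.coeff [:0, fst d $ 2 $ 1:] 1 = 0"
    by (rule coeff[of "\<lambda>x. fst x $ 2 $ 1"]) (simp_all add: psi_rep_def mat_def map_matrix_def poly_funs.intros)
  then show "fst d $ 2 $ 1 = 0" by simp
  have "poly.coeff [:0, snd d $ 1 $ 2:] 1 = 0"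
    by (rule coeff[of "\<lambda>x. snd x $ 1 $ 2"]) (simp_all add: psi_rep_def mat_def map_matrix_def poly_funs.intros)
  then show "snd d $ 1 $ 2 = 0" by simp
  have "poly.coeff [:0, snd d $ 2 $ 1:] 1 = 0"
    by (rule coeff[of "\<lambda>x. snd x $ 2 $ 1"]) (simp_all add: psi_rep_def mat_def map_matrix_def poly_funs.intros)
  then show "snd d $ 2 $ 1 = 0" by simp
  have "poly.coeff [:0, fst d $ 1 $ 1 + fst d $ 2 $ 2, fst d $ 1 $ 1 * fst d $ 2 $ 2:] 1 = 0"
    by (rule coeff[of "\<lambda>x. fst x $ 1 $ 1 * fst x $ 2 $ 2 + (-1)"], intro poly_funs.intros)
       (simp_all add: psi_rep_def mat_def map_matrix_def algebra_simps)
  then show "fst d $ 1 $ 1 + fst d $ 2 $ 2 = 0" by simp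
  have "poly.coeff [:0, snd d $ 1 $ 1 + snd d $ 2 $ 2, snd d $ 1 $ 1 * snd d $ 2 $ 2:] 1 = 0"
    by (rule coeff[of "\<lambda>x. snd x $ 1 $ 1 * snd x $ 2 $ 2 + (-1)"], intro poly_funs.intros)
       (simp_all add: psi_rep_def mat_def map_matrix_def algebra_simps)
  then show "snd d $ 1 $ 1 + snd d $ 2 $ 2 = 0" by simp
  let ?c = "fst d $ 2 $ 2"
  \<comment> \<open>The expansion of (1 + s h) - (1 + s c)^3 along the tangent line, with h the
    entry \<open>snd d $ 1 $ 1\<close>.\<close>
  have "poly.coeff [:0, snd d $ 1 $ 1 - 3 * ?c, - 3 * ?c * ?c, - (?c * ?c * ?c):] 1 = 0"
    by (rule coeff[of "\<lambda>x. snd x $ 1 $ 1 + (-1) * (fst x $ 2 $ 2 * (fst x $ 2 $ 2 * fst x $ 2 $ 2))"],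
        intro poly_funs.intros)
       (simp_all add: psi_rep_def mat_def map_matrix_def power3_eq_cube algebra_simps)
  then show "snd d $ 1 $ 1 = 3 * ?c" by simp
qed

text \<open>On a tangent vector diag(c, -c) of T_psi in the short factor, the equation fixing the
  line (p : q) has derivative -2pqc. Both coordinates are nonzero on the open orbit and 2 is
  invertible, so c = 0.\<close>

lemma lie_of_open_orbit_stab:
  assumes char: "(2::'a::alg_closed_field) \<noteq> 0" and x: "x \<in> open_orbit e"
  shows "lie_of T_psi \<inter> lie_of (flag_stab (carrier Levi) (x :: 'a levi set)) = {0}"
proof (intro equalityI subsetI)
  fix d assume "d \<in> lie_of T_psi \<inter> lie_of (flag_stab (carrier Levi) x)"
  then have dT: "d \<in> lie_of T_psi" and dS: "d \<in> lie_of (flag_stab (carrier Levi) x)" by simp_all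
  note T = lie_of_T_psi[OF dT]
  obtain g h where gh: "x = cls (g, h) <#\<^bsub>Levi\<^esub> Q_short e" "det g = 1" "det h = 1"
    using subsetD[OF open_orbit_subset x] by (rule flag_cases)
  define p q where "p = fst (flag_col e g)" and "q = snd (flag_col e g)"
  have nz: "p * q \<noteq> 0" using x unfolding gh(1) mem_open_orbit_iff[OF gh(2,3)] p_def q_def .
  \<comment> \<open>The wedge of (p, q) with its image under the first factor, which vanishes when
    the line is fixed.\<close>
  define f :: "'a mat2 \<times> 'a mat2 \<Rightarrow> 'a" where
    "f = (\<lambda>k. p * (p * fst k $ 2 $ 1 + q * fst k $ 2 $ 2) + (- q) * (p * fst k $ 1 $ 1 + q * fst k $ 1 $ 2))"
  have poly: "f \<in> poly_funs" unfolding f_def by (intro poly_funs.intros)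
  have van: "f k = 0" if k: "k \<in> \<Union> (flag_stab (carrier Levi) x)" for k
  proof -
    have "flag_stab (carrier Levi) x \<subseteq> carrier Levi" unfolding flag_stab_def by (rule Collect_restrict)
    from k[unfolded mem_Union_Levi[OF this]]
    have "k \<in> carrier SL2sq" and fixed: "cls k <#\<^bsub>Levi\<^esub> x = x" unfolding flag_stab_def by simp_all
    obtain a b where ab: "k = (a, b)" by fastforce
    have det: "det a = 1" "det b = 1" using \<open>k \<in> carrier SL2sq\<close> by (simp_all add: SL2sq_simps ab)
    have "cls (a, b) \<in> carrier Levi" "cls (g, h) \<in> carrier Levi" using det gh by (simp_all only: cls_in_Levi)
    from Levi.lcos_m_assoc[OF subgroup.subset[OF subgroup_parabolic] this]
    have "cls (a, b) <#\<^bsub>Levi\<^esub> x = cls (a ** g, b ** h) <#\<^bsub>Levi\<^esub> Q_short e"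
      unfolding gh(1) cls_mult[OF det gh(2,3)] .
    then have coset: "cls (g, h) <#\<^bsub>Levi\<^esub> Q_short e = cls (a ** g, b ** h) <#\<^bsub>Levi\<^esub> Q_short e"
      using fixed unfolding ab gh(1) by (rule trans[OF sym, rotated])
    have det_ab: "det (a ** g) = 1" "det (b ** h) = 1" using det gh by (simp_all add: det_mul)
    have "wedge (flag_col e g) (flag_col e (a ** g)) = 0"
      using coset unfolding flag_eq_iff[OF gh(2,3) det_ab refl] .
    then show ?thesis
      by (simp add: f_def ab p_def q_def wedge_def flag_col_def mult_nth2 algebra_simps split: if_splits)
  qed
  have "poly.coeff [:0, p * q * (fst d $ 2 $ 2 - fst d $ 1 $ 1):] 1 = 0"
    by (rule lie_of_coeff[OF dS poly van]) (simp_all add: f_def mat_def map_matrix_def T algebra_simps)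
  with nz have eq: "fst d $ 2 $ 2 = fst d $ 1 $ 1" by simp
  have "2 * fst d $ 1 $ 1 = 0" using T(5) unfolding eq mult_2 .
  with char have 11: "fst d $ 1 $ 1 = 0" by (metis mult_eq_0_iff)
  then have 22: "fst d $ 2 $ 2 = 0" using eq by simp
  have "snd d $ 1 $ 1 = 0" "snd d $ 2 $ 2 = 0" using T(6,7) by (simp_all add: 22)
  then have "fst d = 0" "snd d = 0" using T(1-4) 11 22 by (simp_all add: vec_eq_iff forall_2)
  then show "d \<in> {0}" by (simp add: prod_eq_iff)
next
  fix d :: "'a mat2 \<times> 'a mat2" assume "d \<in> {0}"
  moreover have "\<one>\<^bsub>Levi\<^esub> \<in> (T_psi :: 'a levi set)" by (rule subgroup.one_closed[OF T_psi_subgroup])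
  moreover have "\<one>\<^bsub>Levi\<^esub> \<in> flag_stab (carrier Levi) x"
  proof -
    have "\<one>\<^bsub>Levi\<^esub> \<in> flag_stab T_psi x" unfolding flag_stab_open_orbit[OF x] by (rule singletonI)
    then show ?thesis unfolding flag_stab_def by simp
  qed
  ultimately show "d \<in> lie_of T_psi \<inter> lie_of (flag_stab (carrier Levi) x)" by (simp add: zero_in_lie_of)
qed

lemma nonrelevant_Y_var_stab:
  fixes y :: "'a::alg_closed_field levi set"
  assumes "(2::'a) \<noteq> 0" "(3::'a) \<noteq> 0" "w \<in> nonrelevant (bary e)" "y \<in> Y_var (bary e) w"
  shows "flag_stab T_psi y = T_psi"
proof (rule flag_stab_eq_T_psi)
  fix s :: 'a assume s: "s \<noteq> 0"
  have id: "id \<in> weyl_at (bary e)" unfolding weyl_at_def by (rule refl_group.intros)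
  have "w \<in> ext_aff_weyl" "w \<notin> weyl_at x_P"
  proof -
    \<comment> \<open>Taking the identity for the other two factors, W_P lies in the relevant double
      coset; this is the exclusion used for the position of w.\<close>
    have "w \<in> {p \<circ> o' \<circ> q | p o' q. p \<in> weyl_at x_P \<and> o' \<in> Omega \<and> q \<in> weyl_at (bary e)}" if "w \<in> weyl_at x_P"
      unfolding mem_Collect_eq by (intro exI[of _ w] exI[of _ id] conjI that id) (simp_all add: Omega_eq)
    then show "w \<in> ext_aff_weyl" "w \<notin> weyl_at x_P" using assms(3) unfolding nonrelevant_def by auto
  qed
  moreover have "bary e = (1/4, 1/6) \<or> bary e = (3/4, -1/6)" by (simp add: bary_def)
  ultimately obtain t r where "w (bary e) = ((1 + r - 3 * t) / 2, t)" "t \<noteq> 0"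
    "3 * \<bar>t\<bar> - \<bar>r\<bar> \<ge> 1 \<or> (r \<noteq> 0 \<and> 3 * \<bar>t\<bar> + \<bar>r\<bar> \<ge> 1 \<and> \<bar>t\<bar> + \<bar>r\<bar> \<ge> 1)"
    by (rule translate_position)
  then show "cls (psi_rep s) <#\<^bsub>Levi\<^esub> y = y"
    by (rule Y_var_T_psi_fixed[where w = w, OF assms(1,2) _ _ _ assms(4) s])
qed

theorem proposition5p2p1:
  fixes bil :: "('k::finite_field oct \<Rightarrow> 'k oct) \<Rightarrow> ('k oct \<Rightarrow> 'k oct) \<Rightarrow> 'k"
    and chi :: "'k alg_closure levi \<Rightarrow> 'l::prime_card Qlbar"
    and F :: "apt set"
  assumes "CARD('l) \<noteq> CHAR('k)"
    and "\<not> CHAR('k) dvd m_P"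
    and "nondegenerate_invariant_form bil"
    and "is_facet_Q F"
    and "T_character chi"
    and "\<exists>t\<in>T_psi_k. chi t \<noteq> 1"
  shows "euphotic (barycenter F) chi \<and> is_strict (barycenter F) chi"
proof -
  \<comment> \<open>Here m = 2, so the hypothesis on m makes 2 invertible.\<close>
  have "of_nat 2 \<noteq> (0 :: 'k)" using assms(2) unfolding of_nat_eq_0_iff_char_dvd m_P_eq .
  then have "(2 :: 'k) \<noteq> 0" by simp
  then have char: "(2 :: 'k alg_closure) \<noteq> 0" "(3 :: 'k alg_closure) \<noteq> 0"
    using no_nondegenerate_form_char_3[OF assms(3)] to_ac_eq_0_iff[of "2 :: 'k"] to_ac_eq_0_iff[of "3 :: 'k"]
    unfolding to_ac_numeral by simp_all
  have kummer: "\<not> kummer_trivial chi T_psi"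
    using assms(6) by (elim bexE) (rule not_kummer_trivial_T_psi)
  have "barycenter F = bary True \<or> barycenter F = bary False"
    unfolding bary_def if_True if_False by (rule barycenter_facet_Q[OF assms(4)])
  then obtain e where bary: "barycenter F = bary e" by (elim disjE that)
  note borel = identity_component_L_psi[OF char] is_borel_T_psi
  have "euphotic (bary e) chi"
    unfolding euphotic_def borel Omega_eq
  proof (intro conjI ballI allI impI)
    fix w :: "apt \<Rightarrow> apt" and B :: "'k alg_closure levi set" assume "w \<in> {id}" "B = T_psi"
    then have eq: "w = id" "B = T_psi" by simp_all
    show "\<exists>Orb. is_open_orbit B (Y_var (bary e) w) Orb \<and> (\<forall>y\<in>Orb. finite (flag_stab B y))"
      unfolding eq Y_var_bary
      by (intro exI[of _ "open_orbit e"] conjI is_open_orbit_open_orbit ballI) (simp add: flag_stab_open_orbit)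
  next
    fix w assume w: "w \<in> nonrelevant (bary e)"
    show "spectrally_meager (T_psi :: 'k alg_closure levi set) (Y_var (bary e) w)"
      unfolding spectrally_meager_def borel
      by (intro allI impI ballI exI[of _ T_psi] conjI is_torus_T_psi T_psi_nontrivial char)
         (simp only: nonrelevant_Y_var_stab[OF char w] subset_refl)
  next
    fix w and B :: "'k alg_closure levi set" and S assume w: "w \<in> nonrelevant (bary e)" and B: "B = T_psi" and S: "S \<in> stab_components B (Y_var (bary e) w)"
    obtain y where "y \<in> Y_var (bary e) w" "S = identity_component (flag_stab T_psi y)"
      using S unfolding stab_components_def B mem_Collect_eq by (elim exE conjE)
    then have "S = T_psi" by (simp only: nonrelevant_Y_var_stab[OF char w] identity_component_T_psi)
    then show "\<not> kummer_trivial chi S" using kummer by simp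
  qed
  moreover have "is_strict (bary e) chi"
    unfolding is_strict_def borel Omega_eq
  proof (intro ballI allI impI)
    fix w :: "apt \<Rightarrow> apt" and B :: "'k alg_closure levi set" assume "w \<in> {id}" "B = T_psi"
    then have eq: "w = id" "B = T_psi" by simp_all
    show "\<exists>Orb. is_open_orbit B (flags (bary e) w) Orb \<and>
        (\<forall>x\<in>flags (bary e) w - Orb. \<not> kummer_trivial chi (identity_component (flag_stab B x))) \<and>
        (\<forall>x\<in>Orb. flag_stab B x = {\<one>\<^bsub>Levi\<^esub>} \<and> lie_of B \<inter> lie_of (flag_stab (carrier Levi) x) = {0})"
      unfolding eq
      by (intro exI[of _ "open_orbit e"] conjI is_open_orbit_open_orbit ballI flag_stab_open_orbit
          lie_of_open_orbit_stab char)
         (simp_all only: flag_stab_boundary identity_component_T_psi kummer not_False_eq_True)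
  qed
  ultimately show ?thesis unfolding bary by simp
qed

end
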